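(* Let $G=(V,E)$ be a dynamic graph, $\mathcal{P}$ the 3-cycle (triangle), and $\varepsilon\in(0,1)$. One can query $\mathbf{c}(G,\mathcal{P},a)$ for an arbitrary vertex or edge $a$ in (i) worst-case $O(\min(m^{2\varepsilon},n^2))$ time, with $O(m^{\max(\varepsilon,1-\varepsilon)})$ amortized update time and $O(\min(n^2,m^{1+\varepsilon}))$ space, if $a\in V$; (ii) worst-case $O(\min(m^{1-\varepsilon},n))$ time, with $O(m^{\varepsilon})$ amortized update time and $O(\min(n^2,m^{1+\varepsilon}))$ space, if $a\in E$.
   Context: A dynamic graph $G=(V,E)$ is a simple undirected graph on a fixed vertex set of $n$ vertices undergoing edge insertions and deletions; $m$ is the current number of edges. Degrees and adjacency are accessible in constant time. For a vertex or edge $a$, $\mathbf{c}(G,\mathcal{P},a)$ is the number of subgraphs of $G$ isomorphic to $\mathcal{P}$ that contain $a$. *)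

theory Defs
  imports Complex_Main
begin

section \<open>Graphs and subgraph counts\<close>

type_synonym 'a graph = "'a set \<times> 'a set set"

definition verts :: "'a graph \<Rightarrow> 'a set" where
  "verts G = fst G"

definition edges :: "'a graph \<Rightarrow> 'a set set" where
  "edges G = snd G"

definition simple_graph :: "'a graph \<Rightarrow> bool" where
  "simple_graph G \<longleftrightarrow> finite (verts G) \<and> (\<forall>e\<in>edges G. e \<subseteq> verts G \<and> card e = 2)"

definition degree :: "'a graph \<Rightarrow> 'a \<Rightarrow> nat" where
  "degree G v = card {e \<in> edges G. v \<in> e}"

definition subgraph :: "'a graph \<Rightarrow> 'a graph \<Rightarrow> bool" where
  "subgraph H G \<longleftrightarrow> simple_graph H \<and> verts H \<subseteq> verts G \<and> edges H \<subseteq> edges G"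

definition isomorphic :: "'a graph \<Rightarrow> 'b graph \<Rightarrow> bool" where
  "isomorphic G H \<longleftrightarrow> (\<exists>f. bij_betw f (verts G) (verts H) \<and>
     (\<forall>u\<in>verts G. \<forall>v\<in>verts G. {u, v} \<in> edges G \<longleftrightarrow> {f u, f v} \<in> edges H))"

datatype 'a element = Vertex 'a | Edge "'a set"

fun contains :: "'a graph \<Rightarrow> 'a element \<Rightarrow> bool" where
  "contains H (Vertex v) = (v \<in> verts H)"
| "contains H (Edge e) = (e \<in> edges H)"

definition subgraph_count :: "'a graph \<Rightarrow> 'b graph \<Rightarrow> 'a element \<Rightarrow> nat" where
  "subgraph_count G P a = card {H. subgraph H G \<and> isomorphic H P \<and> contains H a}"

definition three_cycle :: "nat graph" where
  "three_cycle = ({0, 1, 2}, {{0, 1}, {1, 2}, {0, 2}})"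


section \<open>A word RAM with cost semantics\<close>

text \<open>
  Programs are structured programs over registers and an indirectly addressed memory, both
  holding words, i.e. natural numbers below a bound \<open>W\<close>; all arithmetic is modulo \<open>W\<close>.
  \<open>Deg\<close> and \<open>Adj\<close> are the constant-time access to degrees and adjacency in the current
  graph. \<open>Pow\<close> makes the real parameter \<open>\<epsilon>\<close> available: a finite program has no other means
  of computing \<open>x powr \<epsilon>\<close>, even approximately, when \<open>\<epsilon>\<close> is not a computable real.
\<close>

datatype binop = Add | Sub | Mul | Div | Less | Eq

datatype expr =
    Num nat
  | Reg nat
  | Load expr
  | Bin binop expr expr
  | Deg expr
  | Adj expr expr
  | Pow expr

datatype com =
    Skip
  | Assign nat expr
  | Store expr expr
  | Seq com com
  | If expr com com
  | While expr com

type_synonym state = "(nat \<Rightarrow> nat) \<times> (nat \<Rightarrow> nat)"  \<comment> \<open>registers, memory\<close>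

fun apply_bin :: "binop \<Rightarrow> nat \<Rightarrow> nat \<Rightarrow> nat" where
  "apply_bin Add x y = x + y"
| "apply_bin Sub x y = x - y"
| "apply_bin Mul x y = x * y"
| "apply_bin Div x y = x div y"
| "apply_bin Less x y = of_bool (x < y)"
| "apply_bin Eq x y = of_bool (x = y)"

fun eval :: "nat \<Rightarrow> real \<Rightarrow> nat graph \<Rightarrow> state \<Rightarrow> expr \<Rightarrow> nat" where
  "eval W \<epsilon> G s (Num c) = c mod W"
| "eval W \<epsilon> G s (Reg i) = fst s i mod W"
| "eval W \<epsilon> G s (Load e) = snd s (eval W \<epsilon> G s e) mod W"
| "eval W \<epsilon> G s (Bin f e1 e2) = apply_bin f (eval W \<epsilon> G s e1) (eval W \<epsilon> G s e2) mod W"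
| "eval W \<epsilon> G s (Deg e) = degree G (eval W \<epsilon> G s e) mod W"
| "eval W \<epsilon> G s (Adj e1 e2) = of_bool ({eval W \<epsilon> G s e1, eval W \<epsilon> G s e2} \<in> edges G) mod W"
| "eval W \<epsilon> G s (Pow e) = nat \<lfloor>real (eval W \<epsilon> G s e) powr \<epsilon>\<rfloor> mod W"

fun expr_time :: "expr \<Rightarrow> nat" where
  "expr_time (Num c) = 1"
| "expr_time (Reg i) = 1"
| "expr_time (Load e) = 1 + expr_time e"
| "expr_time (Bin f e1 e2) = 1 + expr_time e1 + expr_time e2"
| "expr_time (Deg e) = 1 + expr_time e"
| "expr_time (Adj e1 e2) = 1 + expr_time e1 + expr_time e2"
| "expr_time (Pow e) = 1 + expr_time e"

text \<open>
  Memory is initially zero, and a cell is in use as long as it is nonzero. Counting the cells in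
  use, rather than the largest address, means that a table with few nonzero entries only takes
  the space of a dictionary.
\<close>

definition cells_in_use :: "state \<Rightarrow> nat" where
  "cells_in_use s = card {i. fst s i \<noteq> 0} + card {a. snd s a \<noteq> 0}"

text \<open>
  \<open>exec W \<epsilon> G c s t p s'\<close>: on graph \<open>G\<close>, program \<open>c\<close> started in \<open>s\<close> halts in \<open>s'\<close> after \<open>t\<close>
  unit-time steps, and \<open>p\<close> is the maximum of \<open>cells_in_use\<close> over all states on the way.
\<close>

inductive exec ::
  "nat \<Rightarrow> real \<Rightarrow> nat graph \<Rightarrow> com \<Rightarrow> state \<Rightarrow> nat \<Rightarrow> nat \<Rightarrow> state \<Rightarrow> bool"
  for W \<epsilon> G where
  exec_Skip:
    "exec W \<epsilon> G Skip s 1 (cells_in_use s) s"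
| exec_Assign:
    "s' = ((fst s)(i := eval W \<epsilon> G s e), snd s) \<Longrightarrow>
     exec W \<epsilon> G (Assign i e) s (1 + expr_time e) (max (cells_in_use s) (cells_in_use s')) s'"
| exec_Store:
    "s' = (fst s, (snd s)(eval W \<epsilon> G s e1 := eval W \<epsilon> G s e2)) \<Longrightarrow>
     exec W \<epsilon> G (Store e1 e2) s (1 + expr_time e1 + expr_time e2)
       (max (cells_in_use s) (cells_in_use s')) s'"
| exec_Seq:
    "exec W \<epsilon> G c1 s t1 p1 s' \<Longrightarrow> exec W \<epsilon> G c2 s' t2 p2 s'' \<Longrightarrow>
     exec W \<epsilon> G (Seq c1 c2) s (t1 + t2) (max p1 p2) s''"
| exec_If_true:
    "eval W \<epsilon> G s b \<noteq> 0 \<Longrightarrow> exec W \<epsilon> G c1 s t p s' \<Longrightarrow>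
     exec W \<epsilon> G (If b c1 c2) s (1 + expr_time b + t) p s'"
| exec_If_false:
    "eval W \<epsilon> G s b = 0 \<Longrightarrow> exec W \<epsilon> G c2 s t p s' \<Longrightarrow>
     exec W \<epsilon> G (If b c1 c2) s (1 + expr_time b + t) p s'"
| exec_While_false:
    "eval W \<epsilon> G s b = 0 \<Longrightarrow>
     exec W \<epsilon> G (While b c) s (1 + expr_time b) (cells_in_use s) s"
| exec_While_true:
    "eval W \<epsilon> G s b \<noteq> 0 \<Longrightarrow> exec W \<epsilon> G c s t1 p1 s' \<Longrightarrow>
     exec W \<epsilon> G (While b c) s' t2 p2 s'' \<Longrightarrow>
     exec W \<epsilon> G (While b c) s (1 + expr_time b + t1 + t2) (max p1 p2) s''"

inductive_cases exec_SkipE: "exec W \<epsilon> G Skip s t p s'"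
inductive_cases exec_AssignE: "exec W \<epsilon> G (Assign i e) s t p s'"
inductive_cases exec_StoreE: "exec W \<epsilon> G (Store e1 e2) s t p s'"
inductive_cases exec_SeqE: "exec W \<epsilon> G (Seq c1 c2) s t p s'"
inductive_cases exec_IfE: "exec W \<epsilon> G (If b c1 c2) s t p s'"
inductive_cases exec_WhileE: "exec W \<epsilon> G (While b c) s t p s'"

lemma exec_deterministic:
  assumes "exec W \<epsilon> G c s t p s'" and "exec W \<epsilon> G c s u q s''"
  shows "t = u \<and> p = q \<and> s' = s''"
  using assms
proof (induction arbitrary: u q s'' rule: exec.induct)
  case (exec_Skip s)
  then show ?case by (elim exec_SkipE) simp
next
  case (exec_Assign s' s i e)
  from exec_Assign.prems show ?case by (rule exec_AssignE) (simp add: exec_Assign.hyps)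
next
  case (exec_Store s' s e1 e2)
  from exec_Store.prems show ?case by (rule exec_StoreE) (simp add: exec_Store.hyps)
next
  case (exec_Seq c1 s t1 p1 s' c2 t2 p2 s2)
  from exec_Seq.prems show ?case by (rule exec_SeqE) (use exec_Seq.IH in metis)
next
  case (exec_If_true s b c1 t p s' c2)
  from exec_If_true.prems exec_If_true.hyps obtain t'
    where "u = 1 + expr_time b + t'" "exec W \<epsilon> G c1 s t' q s''"
    by - (erule exec_IfE; simp)
  with exec_If_true.IH show ?case by metis
next
  case (exec_If_false s b c2 t p s' c1)
  from exec_If_false.prems exec_If_false.hyps obtain t'
    where "u = 1 + expr_time b + t'" "exec W \<epsilon> G c2 s t' q s''"
    by - (erule exec_IfE; simp)
  with exec_If_false.IH show ?case by metis
next
  case (exec_While_false s b c)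
  from exec_While_false.prems exec_While_false.hyps show ?case
    by - (erule exec_WhileE; simp)
next
  case (exec_While_true s b c t1 p1 s' t2 p2 s2)
  from exec_While_true.prems exec_While_true.hyps(1) obtain t1' p1' r t2' p2'
    where "u = 1 + expr_time b + t1' + t2'" "q = max p1' p2'"
      "exec W \<epsilon> G c s t1' p1' r" "exec W \<epsilon> G (While b c) r t2' p2' s''"
    by - (erule exec_WhileE; simp)
  with exec_While_true.IH show ?case by metis
qed


section \<open>Dynamic graphs and data structures\<close>

definition empty_graph :: "nat \<Rightarrow> nat graph" where
  "empty_graph n = ({..<n}, {})"

datatype oper = Insert nat nat | Delete nat nat | Query_vertex nat | Query_edge nat nat

fun is_update :: "oper \<Rightarrow> bool" where
  "is_update (Insert u v) = True"
| "is_update (Delete u v) = True"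
| "is_update (Query_vertex v) = False"
| "is_update (Query_edge u v) = False"

fun apply_oper :: "oper \<Rightarrow> nat graph \<Rightarrow> nat graph" where
  "apply_oper (Insert u v) G = (verts G, edges G \<union> {{u, v}})"
| "apply_oper (Delete u v) G = (verts G, edges G - {{u, v}})"
| "apply_oper (Query_vertex v) G = G"
| "apply_oper (Query_edge u v) G = G"

fun valid_oper :: "nat graph \<Rightarrow> oper \<Rightarrow> bool" where
  "valid_oper G (Insert u v) \<longleftrightarrow> u \<in> verts G \<and> v \<in> verts G \<and> u \<noteq> v \<and> {u, v} \<notin> edges G"
| "valid_oper G (Delete u v) \<longleftrightarrow> {u, v} \<in> edges G"
| "valid_oper G (Query_vertex v) \<longleftrightarrow> v \<in> verts G"
| "valid_oper G (Query_edge u v) \<longleftrightarrow> {u, v} \<in> edges G"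

fun valid_opers :: "nat graph \<Rightarrow> oper list \<Rightarrow> bool" where
  "valid_opers G [] \<longleftrightarrow> True"
| "valid_opers G (x # xs) \<longleftrightarrow> valid_oper G x \<and> valid_opers (apply_oper x G) xs"

fun expected_answer :: "nat graph \<Rightarrow> 'b graph \<Rightarrow> oper \<Rightarrow> nat" where
  "expected_answer G P (Query_vertex v) = subgraph_count G P (Vertex v)"
| "expected_answer G P (Query_edge u v) = subgraph_count G P (Edge {u, v})"
| "expected_answer G P _ = 0"

record data_structure =
  insert_prog :: com
  delete_prog :: com
  query_prog :: com

fun prog_of :: "data_structure \<Rightarrow> oper \<Rightarrow> com" where
  "prog_of D (Insert u v) = insert_prog D"
| "prog_of D (Delete u v) = delete_prog D"
| "prog_of D (Query_vertex v) = query_prog D"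
| "prog_of D (Query_edge u v) = query_prog D"

text \<open>
  Registers only live for the duration of one call and carry its arguments: the number of
  vertices in register 0, the vertex (or end points) in registers 1 and 2. The answer of a query
  is returned in register 0.
\<close>

fun input_regs :: "nat \<Rightarrow> oper \<Rightarrow> nat \<Rightarrow> nat" where
  "input_regs n (Insert u v) = (\<lambda>_. 0)(0 := n, 1 := u, 2 := v)"
| "input_regs n (Delete u v) = (\<lambda>_. 0)(0 := n, 1 := u, 2 := v)"
| "input_regs n (Query_vertex v) = (\<lambda>_. 0)(0 := n, 1 := v)"
| "input_regs n (Query_edge u v) = (\<lambda>_. 0)(0 := n, 1 := u, 2 := v)"

record event =
  ev_oper :: oper
  ev_graph :: "nat graph"
  ev_answer :: nat
  ev_time :: nat
  ev_space :: nat

text \<open>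
  \<open>run W \<epsilon> D n xs G M es\<close>: starting with the empty graph on \<open>n\<close> vertices and zero memory, all
  calls for the operations \<open>xs\<close> halt; afterwards the graph is \<open>G\<close> and the memory \<open>M\<close>, and \<open>es\<close>
  records the calls. The program called for an update sees the updated graph. By
  \<open>exec_deterministic\<close>, \<open>xs\<close> determines \<open>G\<close>, \<open>M\<close> and \<open>es\<close>.
\<close>

inductive run ::
  "nat \<Rightarrow> real \<Rightarrow> data_structure \<Rightarrow> nat \<Rightarrow> oper list \<Rightarrow> nat graph \<Rightarrow> (nat \<Rightarrow> nat) \<Rightarrow> event list \<Rightarrow> bool"
  for W \<epsilon> D n where
  run_Nil: "run W \<epsilon> D n [] (empty_graph n) (\<lambda>_. 0) []"
| run_snoc:
    "run W \<epsilon> D n xs G M es \<Longrightarrow> G' = apply_oper x G \<Longrightarrow>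
     exec W \<epsilon> G' (prog_of D x) (input_regs n x, M) t p (R', M') \<Longrightarrow>
     run W \<epsilon> D n (xs @ [x]) G' M'
       (es @ [\<lparr>ev_oper = x, ev_graph = G', ev_answer = R' 0, ev_time = t, ev_space = p\<rparr>])"

text \<open>
  The bounds are functions of the current number \<open>m\<close> of edges and the number \<open>n\<close> of vertices; an
  edgeless graph is treated like \<open>m = 1\<close>, since no call takes time \<open>0\<close>. Words have \<open>O(log n)\<close>
  bits. The programs and the constants \<open>k\<close> and \<open>C\<close> depend neither on \<open>n\<close> nor on the operations.
\<close>

definition ev_bound :: "(nat \<Rightarrow> nat \<Rightarrow> real) \<Rightarrow> event \<Rightarrow> real" where
  "ev_bound f e = f (max 1 (card (edges (ev_graph e)))) (card (verts (ev_graph e)))"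

definition dynamic_subgraph_counting ::
  "real \<Rightarrow> 'b graph \<Rightarrow> oper set \<Rightarrow> (nat \<Rightarrow> nat \<Rightarrow> real) \<Rightarrow> (nat \<Rightarrow> nat \<Rightarrow> real) \<Rightarrow> (nat \<Rightarrow> nat \<Rightarrow> real) \<Rightarrow> bool"
where
  "dynamic_subgraph_counting \<epsilon> P Q query_time update_time space \<longleftrightarrow>
     (\<exists>D k C. \<forall>n xs.
        valid_opers (empty_graph n) xs \<and> (\<forall>x\<in>set xs. is_update x \<or> x \<in> Q) \<longrightarrow>
        (\<exists>G M es. run ((n + 2) ^ k) \<epsilon> D n xs G M es \<and>
           (\<forall>e\<in>set es. \<not> is_update (ev_oper e) \<longrightarrow>
              ev_answer e = expected_answer (ev_graph e) P (ev_oper e) \<and>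
              real (ev_time e) \<le> C * ev_bound query_time e) \<and>
           (\<Sum>e\<leftarrow>filter (is_update \<circ> ev_oper) es. real (ev_time e)) \<le>
             C * (\<Sum>e\<leftarrow>filter (is_update \<circ> ev_oper) es. ev_bound update_time e) \<and>
           (\<forall>e\<in>set es. real (ev_space e) \<le> C * ev_bound space e)))"

definition vertex_queries :: "oper set" where
  "vertex_queries = range Query_vertex"

definition edge_queries :: "oper set" where
  "edge_queries = {Query_edge u v | u v. True}"

end

theory Submission
  imports Defs
begin

text \<open>
  Updates are grouped into phases. A phase that starts with \<open>m\<^sub>0\<close> edges fixes a capacity
  \<open>\<theta> = \<lfloor>m\<^sub>0\<^bsup>\<epsilon>\<^esup>\<rfloor>\<close> and lasts for \<open>m\<^sub>0 / 2\<close> updates. Every vertex \<open>w\<close> keeps a set \<open>S w\<close> of at most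
  \<open>\<theta>\<close> slots for neighbours, which only grows during a phase: deleting an edge leaves the slot in
  place. A vertex becomes heavy when a new neighbour finds its slots full, so there are only
  \<open>O(m\<^bsup>1-\<epsilon>\<^esup>)\<close> heavy vertices, and all neighbours of a vertex that is not heavy have slots.

  For every pair, a table counts the common neighbours \<open>w\<close> with both members in \<open>S w\<close>; the other
  common neighbours are found by scanning the heavy vertices. This answers edge queries. For vertex
  queries, a second table counts the triangles at \<open>v\<close> whose opposite edge is not contained in
  \<open>S v\<close>; the others are found by scanning the pairs in \<open>S v\<close>. Since slots never move, an edge
  \<open>{a, b}\<close> contributes the same amounts to both tables when it is inserted and when it is deleted:
  \<open>O(\<theta>)\<close> codegrees change, and \<open>O(\<theta>)\<close> plus the number of heavy vertices is enough to update the
  triangle counts.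

  At the end of a phase all edges are deleted one by one, the slots are emptied, and the edges are
  inserted again under the new capacity; the updates of the phase pay for this. At most
  \<open>\<Sum>w. |S w|\<^sup>2 \<le> \<theta> * (\<Sum>w. |S w|) = O(m\<^bsup>1+\<epsilon>\<^esup>)\<close> codegrees are nonzero.
\<close>


section \<open>Reasoning about programs\<close>

text \<open>Inserting \<open>{a, b}\<close> changes the triangle count of every common neighbour
  \<open>z\<close>, and there may be far too many of them. The table therefore omits triangles whose
  opposite edge lies in \<open>S z\<close>: the only \<open>z\<close> that need a write lack a slot
  for one of their neighbours, and such vertices are heavy. Heavy vertices are few because each has
  \<open>\<theta>\<close> slots filled, while a logged insertion fills at most two. Update times are
  bounded in \<open>m\<close> alone, so a rebuild must not sweep over all vertices or pairs; the log
  of insertions leads it to every row in use. Its running time can exceed the space allowed, so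
  bounding space by time fails for it as a whole: loop invariants bound the nonzero entries between
  rounds, and time bounds space only within a round. A phase is short enough that \<open>m\<close>,
  \<open>m\<^sub>0\<close> and the length of the log agree up to constant factors (reading 0 as 1),
  so amounts fixed at the start of a phase can be charged to the current \<open>m\<close>. Since a
  power with exponent in [0, 1] does not enlarge a factor above 1, no constant depends on
  \<open>\<epsilon>\<close>.\<close>

definition finite_state :: "state \<Rightarrow> bool" where
  "finite_state s \<longleftrightarrow> finite {i. fst s i \<noteq> 0} \<and> finite {a. snd s a \<noteq> 0}"

lemma finite_card_nonzero_upd:
  fixes g :: "nat \<Rightarrow> nat"
  assumes "finite {i. g i \<noteq> 0}"
  shows "finite {i. (g(k := v)) i \<noteq> 0}" "card {i. (g(k := v)) i \<noteq> 0} \<le> card {i. g i \<noteq> 0} + 1"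
proof -
  have sub: "{i. (g(k := v)) i \<noteq> 0} \<subseteq> insert k {i. g i \<noteq> 0}" by auto
  show "finite {i. (g(k := v)) i \<noteq> 0}"
    by (rule finite_subset[OF sub]) (use assms in simp)
  have "card {i. (g(k := v)) i \<noteq> 0} \<le> card (insert k {i. g i \<noteq> 0})"
    by (rule card_mono[OF _ sub]) (use assms in simp)
  also have "\<dots> \<le> card {i. g i \<noteq> 0} + 1"
    using card_insert_le_m1[of "Suc (card {i. g i \<noteq> 0})" _ k] by simp
  finally show "card {i. (g(k := v)) i \<noteq> 0} \<le> card {i. g i \<noteq> 0} + 1" .
qed

text \<open>A step makes at most one cell nonzero and takes at least one time unit. Finiteness is
  carried along because \<open>card\<close> is 0 on infinite sets.\<close>

lemma exec_space_le:
  assumes "exec W \<epsilon> G c s t p s'" and "finite_state s"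
  shows "finite_state s' \<and> p \<le> cells_in_use s + t \<and> cells_in_use s' \<le> p"
  using assms
proof (induction rule: exec.induct)
  case (exec_Assign s' s i e)
  then show ?case
    using finite_card_nonzero_upd[of "fst s" i "eval W \<epsilon> G s e"]
    by (auto simp: finite_state_def cells_in_use_def)
next
  case (exec_Store s' s e1 e2)
  then show ?case
    using finite_card_nonzero_upd[of "snd s" "eval W \<epsilon> G s e1" "eval W \<epsilon> G s e2"]
    by (auto simp: finite_state_def cells_in_use_def)
qed auto

fun written :: "com \<Rightarrow> nat set" where
  "written Skip = {}"
| "written (Assign i e) = {i}"
| "written (Store e1 e2) = {}"
| "written (Seq c1 c2) = written c1 \<union> written c2"
| "written (If b c1 c2) = written c1 \<union> written c2"
| "written (While b c) = written c"

lemma exec_unwritten: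
  assumes "exec W \<epsilon> G c s t p s'" and "r \<notin> written c"
  shows "fst s' r = fst s r"
  using assms by (induction rule: exec.induct) auto

fun loop_free :: "com \<Rightarrow> bool" where
  "loop_free (Seq c1 c2) \<longleftrightarrow> loop_free c1 \<and> loop_free c2"
| "loop_free (If b c1 c2) \<longleftrightarrow> loop_free c1 \<and> loop_free c2"
| "loop_free (While b c) \<longleftrightarrow> False"
| "loop_free _ \<longleftrightarrow> True"

text \<open>The value at \<open>While\<close> is a dummy, as the function is applied to loop-free
  programs only. Adding the two branches of an \<open>If\<close> instead of taking the maximum costs
  only a constant factor.\<close>

fun max_time :: "com \<Rightarrow> nat" where
  "max_time Skip = 1"
| "max_time (Assign i e) = 1 + expr_time e"
| "max_time (Store e1 e2) = 1 + expr_time e1 + expr_time e2"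
| "max_time (Seq c1 c2) = max_time c1 + max_time c2"
| "max_time (If b c1 c2) = 1 + expr_time b + (max_time c1 + max_time c2)"
| "max_time (While b c) = 0"

fun sem :: "nat \<Rightarrow> real \<Rightarrow> nat graph \<Rightarrow> com \<Rightarrow> state \<Rightarrow> state" where
  "sem W \<epsilon> G Skip s = s"
| "sem W \<epsilon> G (Assign i e) s = ((fst s)(i := eval W \<epsilon> G s e), snd s)"
| "sem W \<epsilon> G (Store e1 e2) s = (fst s, (snd s)(eval W \<epsilon> G s e1 := eval W \<epsilon> G s e2))"
| "sem W \<epsilon> G (Seq c1 c2) s = sem W \<epsilon> G c2 (sem W \<epsilon> G c1 s)"
| "sem W \<epsilon> G (If b c1 c2) s = (if eval W \<epsilon> G s b \<noteq> 0 then sem W \<epsilon> G c1 s else sem W \<epsilon> G c2 s)"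
| "sem W \<epsilon> G (While b c) s = s"

text \<open>Reduces straight-line code to rewriting: \<open>sem\<close> yields the final state by
  simplification, and the running time is bounded by a number fixed by the program text.\<close>

lemma exec_sem:
  assumes "loop_free c"
  shows "\<exists>t p. exec W \<epsilon> G c s t p (sem W \<epsilon> G c s) \<and> t \<le> max_time c"
  using assms
proof (induction c arbitrary: s)
  case Skip
  then show ?case using exec_Skip by (metis max_time.simps(1) order_refl sem.simps(1))
next
  case (Assign i e)
  then show ?case using exec_Assign[OF refl] by (metis max_time.simps(2) order_refl sem.simps(2))
next
  case (Store e1 e2)
  then show ?case using exec_Store[OF refl] by (metis max_time.simps(3) order_refl sem.simps(3))
next
  case (Seq c1 c2)
  obtain t1 p1 where 1: "exec W \<epsilon> G c1 s t1 p1 (sem W \<epsilon> G c1 s)" "t1 \<le> max_time c1"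
    using Seq by fastforce
  obtain t2 p2 where 2: "exec W \<epsilon> G c2 (sem W \<epsilon> G c1 s) t2 p2 (sem W \<epsilon> G c2 (sem W \<epsilon> G c1 s))"
      "t2 \<le> max_time c2"
    using Seq by fastforce
  show ?case using exec_Seq[OF 1(1) 2(1)] 1(2) 2(2) by (metis add_mono max_time.simps(4) sem.simps(4))
next
  case (If b c1 c2)
  show ?case
  proof (cases "eval W \<epsilon> G s b = 0")
    case True
    obtain t p where "exec W \<epsilon> G c2 s t p (sem W \<epsilon> G c2 s)" "t \<le> max_time c2"
      using If by fastforce
    then show ?thesis using exec_If_false[OF True, of c2 t p "sem W \<epsilon> G c2 s" c1] True by fastforce
  next
    case False
    obtain t p where "exec W \<epsilon> G c1 s t p (sem W \<epsilon> G c1 s)" "t \<le> max_time c1"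
      using If by fastforce
    then show ?thesis using exec_If_true[OF False, of c1 t p "sem W \<epsilon> G c1 s" c2] False by fastforce
  qed
qed simp

text \<open>Memory is divided into thirty-two interleaved tables with two indices, the second of which
  stays below \<open>n\<close>.\<close>

type_synonym tables = "nat \<Rightarrow> nat \<Rightarrow> nat \<Rightarrow> nat"

definition address :: "nat \<Rightarrow> nat \<Rightarrow> nat \<Rightarrow> nat \<Rightarrow> nat" where
  "address n j p q = 32 * (p * n + q) + j"

text \<open>Entries in tables from 32 on or in columns from \<open>n\<close> on leave no trace, so
  the abstract tables determine the memory but not conversely.\<close>

definition memory :: "nat \<Rightarrow> tables \<Rightarrow> nat \<Rightarrow> nat" where
  "memory n f a = f (a mod 32) (a div 32 div n) (a div 32 mod n)"

definition upd :: "tables \<Rightarrow> nat \<Rightarrow> nat \<Rightarrow> nat \<Rightarrow> nat \<Rightarrow> tables" where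
  "upd f j p q v = (\<lambda>j' p' q'. if j' = j \<and> p' = p \<and> q' = q then v else f j' p' q')"

lemma upd_apply: "upd f j p q v j' p' q' = (if j' = j \<and> p' = p \<and> q' = q then v else f j' p' q')"
  by (simp add: upd_def)

lemma address_decode:
  assumes "q < n" "j < 32"
  shows "address n j p q mod 32 = j" "address n j p q div 32 div n = p" "address n j p q div 32 mod n = q"
proof -
  have "(32 * x + j) mod 32 = j" "(32 * x + j) div 32 = x" for x using assms by auto
  then have *: "address n j p q mod 32 = j" "address n j p q div 32 = p * n + q"
    unfolding address_def by blast+
  show "address n j p q mod 32 = j" "address n j p q div 32 div n = p" "address n j p q div 32 mod n = q"
    unfolding * using assms by simp_all
qed

lemma memory_address: "q < n \<Longrightarrow> j < 32 \<Longrightarrow> memory n f (address n j p q) = f j p q"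
  by (simp add: memory_def address_decode)

lemma address_eq_iff:
  assumes "q < n" "j < 32"
  shows "a = address n j p q \<longleftrightarrow> a mod 32 = j \<and> a div 32 div n = p \<and> a div 32 mod n = q"
proof
  assume "a = address n j p q"
  then show "a mod 32 = j \<and> a div 32 div n = p \<and> a div 32 mod n = q"
    using assms by (simp add: address_decode)
next
  assume a: "a mod 32 = j \<and> a div 32 div n = p \<and> a div 32 mod n = q"
  have "a = 32 * (a div 32) + a mod 32" by simp
  also have "a div 32 = (a div 32 div n) * n + a div 32 mod n" by simp
  finally show "a = address n j p q" unfolding address_def using a by simp
qed

lemma memory_upd:
  assumes "q < n" "j < 32"
  shows "(memory n f)(address n j p q := v) = memory n (upd f j p q v)"
proof
  fix a
  show "((memory n f)(address n j p q := v)) a = memory n (upd f j p q v) a"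
    unfolding fun_upd_apply address_eq_iff[OF assms] by (simp add: memory_def upd_apply)
qed

text \<open>The row length is taken from register 0, so a program has to keep \<open>n\<close> there
  as long as it accesses tables.\<close>

definition Addr :: "nat \<Rightarrow> expr \<Rightarrow> expr \<Rightarrow> expr" where
  "Addr j e1 e2 = Bin Add (Bin Mul (Num 32) (Bin Add (Bin Mul e1 (Reg 0)) e2)) (Num j)"

definition At :: "nat \<Rightarrow> expr \<Rightarrow> expr \<Rightarrow> expr" where
  "At j e1 e2 = Load (Addr j e1 e2)"

definition Put :: "nat \<Rightarrow> expr \<Rightarrow> expr \<Rightarrow> expr \<Rightarrow> com" where
  "Put j e1 e2 e = Store (Addr j e1 e2) e"

text \<open>The bound is evaluated again in every round; the loop rules ask for it to keep its
  value.\<close>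

definition For :: "nat \<Rightarrow> expr \<Rightarrow> com \<Rightarrow> com" where
  "For i e c = Seq (Assign i (Num 0))
     (While (Bin Less (Reg i) e) (Seq c (Assign i (Bin Add (Reg i) (Num 1)))))"

lemma macro_simps [simp]:
  "expr_time (Addr j e1 e2) = 7 + expr_time e1 + expr_time e2"
  "expr_time (At j e1 e2) = 8 + expr_time e1 + expr_time e2"
  "max_time (Put j e1 e2 e) = 8 + expr_time e1 + expr_time e2 + expr_time e"
  "loop_free (Put j e1 e2 e)"
  "written (Put j e1 e2 e) = {}"
  "written (For i e c) = insert i (written c)"
  by (auto simp: Addr_def At_def Put_def For_def)

section \<open>Word arithmetic without overflow\<close>

locale ram =
  fixes n W :: nat and \<epsilon> :: real and G :: "nat graph"
  assumes n_pos: "0 < n" and W_eq: "W = (n + 2) ^ 10"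
begin

text \<open>Bounds every first index and every table entry that occurs.\<close>

definition PB :: nat where "PB = 4 * n * n + 8"

text \<open>An address is cubic in \<open>n\<close>, because first indices may reach
  \<open>PB\<close>. Three of the ten factors of \<open>W\<close> cover that growth, and the other
  seven supply the constant \<open>3 ^ 7 = 2187\<close>.\<close>

lemma W_big: "100 * (PB * n) + 100 * PB + 100 < W"
proof -
  have "3 ^ 7 \<le> (n + 2) ^ 7" by (rule power_mono) (use n_pos in auto)
  then have "2187 * (n + 2) ^ 3 \<le> (n + 2) ^ 7 * (n + 2) ^ 3" by (intro mult_right_mono) auto
  also have "\<dots> = W" by (simp add: W_eq flip: power_add)
  finally have *: "2187 * (n + 2) ^ 3 \<le> W" .
  have e: "(n + 2) ^ 3 = n*n*n + 6*(n*n) + 12*n + 8"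
    by (simp add: power3_eq_cube algebra_simps)
  have "PB * n = 4*(n*n*n) + 8*n" "PB = 4*(n*n) + 8" by (simp_all add: PB_def algebra_simps)
  then show ?thesis using * unfolding e distrib_left by linarith
qed

lemma PB_bounds: "n \<le> PB" "n * n \<le> PB" "8 \<le> PB" "100 * PB + 100 < W"
proof -
  show "n \<le> PB" unfolding PB_def by (simp add: trans_le_add1)
  show "n * n \<le> PB" "8 \<le> PB" unfolding PB_def by auto
  show "100 * PB + 100 < W" using W_big by linarith
qed

lemma less_W: "x \<le> 90 * PB \<Longrightarrow> x < W"
  using PB_bounds by linarith

abbreviation ev :: "(nat \<Rightarrow> nat) \<Rightarrow> tables \<Rightarrow> expr \<Rightarrow> nat" where
  "ev R f e \<equiv> eval W \<epsilon> G (R, memory n f) e"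

lemma ev_Num: "c < W \<Longrightarrow> ev R f (Num c) = c"
  and ev_Reg: "R i < W \<Longrightarrow> ev R f (Reg i) = R i"
  and ev_Add: "ev R f e1 + ev R f e2 < W \<Longrightarrow> ev R f (Bin Add e1 e2) = ev R f e1 + ev R f e2"
  by simp_all

lemma eval_less_W: "eval W \<epsilon> G s e < W"
  by (cases e) (use PB_bounds in \<open>auto intro!: mod_less_divisor\<close>)

lemma ev_Sub: "ev R f (Bin Sub e1 e2) = ev R f e1 - ev R f e2"
  using eval_less_W[of "(R, memory n f)" e1] by simp

lemma ev_Less: "ev R f (Bin Less e1 e2) = of_bool (ev R f e1 < ev R f e2)"
  using PB_bounds by (auto simp: of_bool_def)

lemma ev_Eq: "ev R f (Bin Eq e1 e2) = of_bool (ev R f e1 = ev R f e2)"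
  using PB_bounds by (auto simp: of_bool_def)

text \<open>Every intermediate result stays below \<open>32 * (PB * n + n) + 32\<close>, hence below
  \<open>W\<close>, and no reduction takes effect.\<close>

lemma ev_Addr:
  assumes "R 0 = n" "ev R f e1 \<le> PB" "ev R f e2 < n" "j < 32"
  shows "ev R f (Addr j e1 e2) = address n j (ev R f e1) (ev R f e2)"
proof -
  let ?p = "ev R f e1" and ?q = "ev R f e2"
  have pn: "?p * n \<le> PB * n" using assms by simp
  have [simp]: "n mod W = n" "j mod W = j" "32 mod W = 32"
    using PB_bounds assms by auto
  have [simp]: "(?p * n) mod W = ?p * n" using pn W_big by (intro mod_less) linarith
  have [simp]: "(?p * n + ?q) mod W = ?p * n + ?q" using pn W_big assms PB_bounds
    by (intro mod_less) linarith
  have [simp]: "(32 * (?p * n + ?q)) mod W = 32 * (?p * n + ?q)" using pn W_big assms PB_bounds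
    unfolding distrib_left by (intro mod_less) linarith
  have [simp]: "(32 * (?p * n + ?q) + j) mod W = 32 * (?p * n + ?q) + j" using pn W_big assms PB_bounds
    unfolding distrib_left by (intro mod_less) linarith
  show ?thesis by (simp add: Addr_def assms(1) address_def del: distrib_left_numeral)
qed

lemma ev_At:
  assumes "R 0 = n" "ev R f e1 \<le> PB" "ev R f e2 < n" "j < 32" "f j (ev R f e1) (ev R f e2) < W"
  shows "ev R f (At j e1 e2) = f j (ev R f e1) (ev R f e2)"
  unfolding At_def eval.simps ev_Addr[OF assms(1-4)] using assms by (simp add: memory_address)

lemma sem_Put:
  assumes "R 0 = n" "ev R f e1 \<le> PB" "ev R f e2 < n" "j < 32"
  shows "sem W \<epsilon> G (Put j e1 e2 e) (R, memory n f) =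
    (R, memory n (upd f j (ev R f e1) (ev R f e2) (ev R f e)))"
  unfolding Put_def sem.simps fst_conv snd_conv ev_Addr[OF assms] using assms by (simp add: memory_upd)

section \<open>Total correctness with bounds on time and space\<close>

lemmas [simp del] = eval.simps

text \<open>A total-correctness triple. Existence of an execution is enough because
  \<open>exec\<close> is deterministic. The frame condition on registers is built in, so
  postconditions mention only what a program computes.\<close>

definition ok :: "com \<Rightarrow> (nat \<Rightarrow> nat) \<Rightarrow> tables \<Rightarrow> nat \<Rightarrow> ((nat \<Rightarrow> nat) \<Rightarrow> tables \<Rightarrow> bool) \<Rightarrow> bool" where
  "ok c R f T Q \<longleftrightarrow> (\<exists>t p R' f'. exec W \<epsilon> G c (R, memory n f) t p (R', memory n f') \<and>
     t \<le> T \<and> (\<forall>r. r \<notin> written c \<longrightarrow> R' r = R r) \<and> Q R' f')"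

definition okS :: "com \<Rightarrow> (nat \<Rightarrow> nat) \<Rightarrow> tables \<Rightarrow> nat \<Rightarrow> nat \<Rightarrow> ((nat \<Rightarrow> nat) \<Rightarrow> tables \<Rightarrow> bool) \<Rightarrow> bool" where
  "okS c R f T S Q \<longleftrightarrow> (\<exists>t p R' f'. exec W \<epsilon> G c (R, memory n f) t p (R', memory n f') \<and>
     t \<le> T \<and> p \<le> S \<and> (\<forall>r. r \<notin> written c \<longrightarrow> R' r = R r) \<and> Q R' f')"

lemma okI:
  assumes "exec W \<epsilon> G c (R, memory n f) t p (R', memory n f')" "t \<le> T"
    "\<And>r. r \<notin> written c \<Longrightarrow> R' r = R r" "Q R' f'"
  shows "ok c R f T Q"
  unfolding ok_def using assms by blast

lemma okSI:
  assumes "exec W \<epsilon> G c (R, memory n f) t p (R', memory n f')" "t \<le> T" "p \<le> S"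
    "\<And>r. r \<notin> written c \<Longrightarrow> R' r = R r" "Q R' f'"
  shows "okS c R f T S Q"
  unfolding okS_def using assms by blast

lemma ok_loop_free:
  assumes "loop_free c" "max_time c \<le> T" "sem W \<epsilon> G c (R, memory n f) = (R', memory n f')" "Q R' f'"
  shows "ok c R f T Q"
proof -
  obtain t p where e: "exec W \<epsilon> G c (R, memory n f) t p (R', memory n f')" "t \<le> max_time c"
    using exec_sem[OF assms(1), of W \<epsilon> G "(R, memory n f)"] assms(3) by auto
  then show ?thesis unfolding ok_def
    using assms exec_unwritten[OF e(1)] by (intro exI[of _ t] exI[of _ p] exI[of _ R'] exI[of _ f']) auto
qed

lemma ok_mono:
  assumes "ok c R f T Q" "T \<le> T'"
    "\<And>R' f'. Q R' f' \<Longrightarrow> (\<And>r. r \<notin> written c \<Longrightarrow> R' r = R r) \<Longrightarrow> Q' R' f'"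
  shows "ok c R f T' Q'"
proof -
  from assms(1) obtain t p R' f' where "exec W \<epsilon> G c (R, memory n f) t p (R', memory n f')"
     "t \<le> T" "\<forall>r. r \<notin> written c \<longrightarrow> R' r = R r" "Q R' f'" unfolding ok_def by blast
  then show ?thesis using assms(2,3) unfolding ok_def
    by (intro exI[of _ t] exI[of _ p] exI[of _ R'] exI[of _ f']) auto
qed

lemma okS_mono:
  assumes "okS c R f T S Q" "T \<le> T'" "S \<le> S'"
    "\<And>R' f'. Q R' f' \<Longrightarrow> (\<And>r. r \<notin> written c \<Longrightarrow> R' r = R r) \<Longrightarrow> Q' R' f'"
  shows "okS c R f T' S' Q'"
proof -
  from assms(1) obtain t p R' f' where "exec W \<epsilon> G c (R, memory n f) t p (R', memory n f')"
     "t \<le> T" "p \<le> S" "\<forall>r. r \<notin> written c \<longrightarrow> R' r = R r" "Q R' f'" unfolding okS_def by blast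
  then show ?thesis using assms(2-4) unfolding okS_def
    by (intro exI[of _ t] exI[of _ p] exI[of _ R'] exI[of _ f']) auto
qed

lemma ok_iff_okS: "ok c R f T Q \<longleftrightarrow> (\<exists>S. okS c R f T S Q)"
  unfolding ok_def okS_def by (meson order_refl)

text \<open>By \<open>exec_space_le\<close>, the time of a program bounds the cells that it adds. A
  rebuild as a whole runs too long for this, so there the rule is applied to single loop bodies and
  short blocks.\<close>

lemma okS_of_ok:
  assumes "ok c R f T Q" "finite_state (R, memory n f)"
  shows "okS c R f T (cells_in_use (R, memory n f) + T) Q"
proof -
  from assms(1) obtain t p R' f' where e: "exec W \<epsilon> G c (R, memory n f) t p (R', memory n f')"
     "t \<le> T" "\<forall>r. r \<notin> written c \<longrightarrow> R' r = R r" "Q R' f'" unfolding ok_def by blast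
  have "p \<le> cells_in_use (R, memory n f) + t" using exec_space_le[OF e(1) assms(2)] by blast
  then show ?thesis using e unfolding okS_def
    by (intro exI[of _ t] exI[of _ p] exI[of _ R'] exI[of _ f']) auto
qed

lemma okS_Seq:
  assumes "okS c1 R f T1 S Q1"
    "\<And>R' f'. Q1 R' f' \<Longrightarrow> (\<And>r. r \<notin> written c1 \<Longrightarrow> R' r = R r) \<Longrightarrow> okS c2 R' f' T2 S Q"
  shows "okS (Seq c1 c2) R f (T1 + T2) S Q"
proof -
  from assms(1) obtain t p R' f' where 1: "exec W \<epsilon> G c1 (R, memory n f) t p (R', memory n f')"
     "t \<le> T1" "p \<le> S" "\<forall>r. r \<notin> written c1 \<longrightarrow> R' r = R r" "Q1 R' f'" unfolding okS_def by blast
  from 1 assms(2) have "okS c2 R' f' T2 S Q" by blast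
  then obtain t2 p2 R2 f2 where 2: "exec W \<epsilon> G c2 (R', memory n f') t2 p2 (R2, memory n f2)"
     "t2 \<le> T2" "p2 \<le> S" "\<forall>r. r \<notin> written c2 \<longrightarrow> R2 r = R' r" "Q R2 f2" unfolding okS_def by blast
  show ?thesis unfolding okS_def
    using exec_Seq[OF 1(1) 2(1)] 1 2
    by (intro exI[of _ "t + t2"] exI[of _ "max p p2"] exI[of _ R2] exI[of _ f2]) auto
qed

lemma okS_large:
  assumes "okS c R f T S Q" "S \<le> S'"
  shows "okS c R f T S' Q"
  using okS_mono[OF assms(1) order_refl assms(2)] .

lemma ok_Seq:
  assumes "ok c1 R f T1 Q1"
    "\<And>R' f'. Q1 R' f' \<Longrightarrow> (\<And>r. r \<notin> written c1 \<Longrightarrow> R' r = R r) \<Longrightarrow> ok c2 R' f' T2 Q"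
  shows "ok (Seq c1 c2) R f (T1 + T2) Q"
proof -
  from assms(1) obtain t p R' f' where 1: "exec W \<epsilon> G c1 (R, memory n f) t p (R', memory n f')"
     "t \<le> T1" "\<forall>r. r \<notin> written c1 \<longrightarrow> R' r = R r" "Q1 R' f'" unfolding ok_def by blast
  from 1 assms(2) have "ok c2 R' f' T2 Q" by blast
  then obtain S where "okS c2 R' f' T2 S Q" unfolding ok_iff_okS by blast
  moreover have "okS c1 R f T1 p (\<lambda>R'' f''. R'' = R' \<and> f'' = f')"
    unfolding okS_def using 1 by auto
  ultimately have "okS (Seq c1 c2) R f (T1 + T2) (max p S) Q"
    by (intro okS_Seq[where ?Q1.0 = "\<lambda>R'' f''. R'' = R' \<and> f'' = f'"]) (auto elim: okS_large)
  then show ?thesis unfolding ok_iff_okS by blast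
qed

lemma okS_If:
  assumes "ev R f b \<noteq> 0 \<Longrightarrow> okS c1 R f T S Q" "ev R f b = 0 \<Longrightarrow> okS c2 R f T S Q"
  shows "okS (If b c1 c2) R f (1 + expr_time b + T) S Q"
proof (cases "ev R f b = 0")
  case True
  then obtain t p R' f' where "exec W \<epsilon> G c2 (R, memory n f) t p (R', memory n f')"
     "t \<le> T" "p \<le> S" "\<forall>r. r \<notin> written c2 \<longrightarrow> R' r = R r" "Q R' f'"
    using assms(2) unfolding okS_def by blast
  then show ?thesis by (intro okSI[OF exec_If_false[OF True]]) auto
next
  case False
  then obtain t p R' f' where "exec W \<epsilon> G c1 (R, memory n f) t p (R', memory n f')"
     "t \<le> T" "p \<le> S" "\<forall>r. r \<notin> written c1 \<longrightarrow> R' r = R r" "Q R' f'"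
    using assms(1) unfolding okS_def by blast
  then show ?thesis by (intro okSI[OF exec_If_true[OF False]]) auto
qed

lemma ok_If:
  assumes "ev R f b \<noteq> 0 \<Longrightarrow> ok c1 R f T Q" "ev R f b = 0 \<Longrightarrow> ok c2 R f T Q"
  shows "ok (If b c1 c2) R f (1 + expr_time b + T) Q"
  using assms okS_If[of R f b c1 T _ Q c2] unfolding ok_iff_okS by metis

text \<open>The invariant is indexed by the number of finished rounds, and the induction runs over
  the \<open>N - k\<close> remaining ones. \<open>cells\<close> covers the last evaluation of the
  guard, whose peak is the final state.\<close>

lemma okS_While:
  fixes N :: nat
  assumes step: "\<And>k R f. k < N \<Longrightarrow> Inv k R f \<Longrightarrow> okS c R f T S (\<lambda>R' f'. Inv (k + 1) R' f')"
    and guard: "\<And>k R f. k \<le> N \<Longrightarrow> Inv k R f \<Longrightarrow> ev R f b = of_bool (k < N)"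
    and cells: "\<And>R f. Inv N R f \<Longrightarrow> cells_in_use (R, memory n f) \<le> S"
    and "k \<le> N" "Inv k R f"
  shows "okS (While b c) R f (1 + expr_time b + (N - k) * (T + 1 + expr_time b)) S (Inv N)"
  using assms(4,5)
proof (induction "N - k" arbitrary: k R f)
  case 0
  then have "k = N" by simp
  then have "exec W \<epsilon> G (While b c) (R, memory n f) (1 + expr_time b)
      (cells_in_use (R, memory n f)) (R, memory n f)"
    using guard[of N R f] 0 by (intro exec_While_false) simp
  moreover have "cells_in_use (R, memory n f) \<le> S" using cells 0 \<open>k = N\<close> by blast
  ultimately show ?case using 0 \<open>k = N\<close> by (intro okSI) auto
next
  case (Suc d)
  then have k: "k < N" by simp
  from step[OF k Suc.prems(2)] obtain t p R' f' where 1: "exec W \<epsilon> G c (R, memory n f) t p (R', memory n f')"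
     "t \<le> T" "p \<le> S" "\<forall>r. r \<notin> written c \<longrightarrow> R' r = R r" "Inv (k + 1) R' f'" unfolding okS_def by blast
  have "d = N - (k + 1)" "k + 1 \<le> N" using Suc.hyps(2) k by auto
  from Suc.hyps(1)[OF this 1(5)] obtain t2 p2 R2 f2 where
    2: "exec W \<epsilon> G (While b c) (R', memory n f') t2 p2 (R2, memory n f2)"
     "t2 \<le> 1 + expr_time b + (N - (k + 1)) * (T + 1 + expr_time b)" "p2 \<le> S"
     "\<forall>r. r \<notin> written c \<longrightarrow> R2 r = R' r" "Inv N R2 f2" unfolding okS_def written.simps by blast
  have "N - k = Suc (N - (k + 1))" using k by simp
  then have tm: "1 + expr_time b + t + t2 \<le> 1 + expr_time b + (N - k) * (T + 1 + expr_time b)"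
    using 1(2) 2(2) by simp
  have ex: "exec W \<epsilon> G (While b c) (R, memory n f) (1 + expr_time b + t + t2) (max p p2) (R2, memory n f2)"
    using guard[of k] k Suc.prems 1 2 by (intro exec_While_true) auto
  show ?case by (rule okSI[OF ex tm]) (use 1(3,4) 2(3-5) in auto)
qed

lemma okS_Assign:
  assumes "Q (R(i := ev R f e)) f" "cells_in_use (R, memory n f) \<le> S"
    "cells_in_use (R(i := ev R f e), memory n f) \<le> S"
  shows "okS (Assign i e) R f (1 + expr_time e) S Q"
  using assms by (intro okSI[OF exec_Assign]) auto

text \<open>Both \<open>R'\<close> and its incremented version must fit into \<open>S\<close>, since
  the assignment to the counter records the cells before and after it. The constants 10 generously
  cover guard and increment.\<close>

lemma okS_For:
  fixes N :: nat
  assumes step: "\<And>k R f. k < N \<Longrightarrow> Inv k R f \<Longrightarrow> R i = k \<Longrightarrow> okS c R f T S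
      (\<lambda>R' f'. R' i = k \<and> Inv (k + 1) (R'(i := k + 1)) f' \<and>
        cells_in_use (R', memory n f') \<le> S \<and> cells_in_use (R'(i := k + 1), memory n f') \<le> S)"
    and bound: "\<And>k R f. k \<le> N \<Longrightarrow> Inv k R f \<Longrightarrow> R i = k \<Longrightarrow> ev R f e = N"
    and "N \<le> PB" and init: "Inv 0 (R(i := 0)) f"
    and cells: "cells_in_use (R, memory n f) \<le> S" "cells_in_use (R(i := 0), memory n f) \<le> S"
  shows "okS (For i e c) R f (10 + expr_time e + N * (T + 10 + expr_time e)) S
     (\<lambda>R' f'. Inv N R' f' \<and> R' i = N)"
proof -
  have NW: "k \<le> N \<Longrightarrow> k < W" for k using less_W[of k] assms(3) by linarith
  have [simp]: "1 mod W = 1" "0 mod W = 0" using PB_bounds by auto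
  define J where "J k R f \<longleftrightarrow> Inv k R f \<and> R i = k \<and> cells_in_use (R, memory n f) \<le> S" for k R f
  have "okS (While (Bin Less (Reg i) e) (Seq c (Assign i (Bin Add (Reg i) (Num 1))))) (R(i := 0)) f
     (1 + expr_time (Bin Less (Reg i) e) + (N - 0) * ((T + 4) + 1 + expr_time (Bin Less (Reg i) e))) S (J N)"
  proof (rule okS_While)
    fix k R f assume k: "k < N" and J: "J k R f"
    have "okS (Seq c (Assign i (Bin Add (Reg i) (Num 1)))) R f (T + (1 + expr_time (Bin Add (Reg i) (Num 1)))) S (J (k + 1))"
    proof (rule okS_Seq[OF step])
      show "k < N" by fact
      show "Inv k R f" "R i = k" using J unfolding J_def by auto
      fix R' f'
      assume a: "R' i = k \<and> Inv (k + 1) (R'(i := k + 1)) f' \<and> cells_in_use (R', memory n f') \<le> S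
         \<and> cells_in_use (R'(i := k + 1), memory n f') \<le> S"
      have e: "ev R' f' (Bin Add (Reg i) (Num 1)) = k + 1"
        using a NW[of k] NW[of "k + 1"] k by (simp add: eval.simps)
      show "okS (Assign i (Bin Add (Reg i) (Num 1))) R' f' (1 + expr_time (Bin Add (Reg i) (Num 1))) S (J (k + 1))"
        by (rule okS_Assign) (use e a in \<open>simp_all add: J_def\<close>)
    qed
    then show "okS (Seq c (Assign i (Bin Add (Reg i) (Num 1)))) R f (T + 4) S (J (k + 1))"
      by (rule okS_mono) auto
  next
    fix k R f assume "k \<le> N" and J: "J k R f"
    then show "ev R f (Bin Less (Reg i) e) = of_bool (k < N)"
      using bound[of k R f] NW[of k] by (simp add: ev_Less ev_Reg J_def)
  next
    show "J 0 (R(i := 0)) f" unfolding J_def using init cells by simp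
  qed (auto simp: J_def)
  then have w: "okS (While (Bin Less (Reg i) e) (Seq c (Assign i (Bin Add (Reg i) (Num 1))))) (R(i := 0)) f
     (3 + expr_time e + N * (T + 7 + expr_time e)) S (J N)"
    by (rule okS_mono) (auto simp: algebra_simps)
  have e0: "ev R f (Num 0) = 0" by (simp add: eval.simps)
  have "okS (For i e c) R f ((1 + expr_time (Num 0)) + (3 + expr_time e + N * (T + 7 + expr_time e))) S (J N)"
    unfolding For_def
    by (rule okS_Seq[OF okS_Assign[where Q = "\<lambda>R' f'. R' = R(i := 0) \<and> f' = f"]])
      (use w e0 cells in auto)
  then show ?thesis by (rule okS_mono) (auto simp: algebra_simps J_def)
qed

text \<open>Not an instance of \<open>okS_For\<close>: \<open>ok\<close> lets every round have its
  own peak, while \<open>okS_For\<close> asks for one \<open>S\<close> that serves all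
  rounds.\<close>

lemma ok_For:
  fixes N :: nat
  assumes step: "\<And>k R f. k < N \<Longrightarrow> Inv k R f \<Longrightarrow> R i = k \<Longrightarrow> ok c R f T
      (\<lambda>R' f'. Inv (k + 1) (R'(i := k + 1)) f')"
    and "i \<notin> written c"
    and bound: "\<And>k R f. k \<le> N \<Longrightarrow> Inv k R f \<Longrightarrow> R i = k \<Longrightarrow> ev R f e = N"
    and "N \<le> PB" and init: "Inv 0 (R(i := 0)) f"
  shows "ok (For i e c) R f (10 + expr_time e + N * (T + 10 + expr_time e))
     (\<lambda>R' f'. Inv N R' f' \<and> R' i = N)"
proof -
  have NW: "k \<le> N \<Longrightarrow> k < W" for k using less_W[of k] assms(4) by linarith
  have [simp]: "1 mod W = 1" "0 mod W = 0" using PB_bounds by auto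
  have "ok (While (Bin Less (Reg i) e) (Seq c (Assign i (Bin Add (Reg i) (Num 1))))) R f
     (1 + expr_time (Bin Less (Reg i) e) + (N - k) * ((T + 4) + 1 + expr_time (Bin Less (Reg i) e)))
     (\<lambda>R' f'. Inv N R' f' \<and> R' i = N)" if "k \<le> N" "Inv k R f" "R i = k" for k R f
    using that
  proof (induction "N - k" arbitrary: k R f)
    case 0
    then have "k = N" by simp
    then have "exec W \<epsilon> G (While (Bin Less (Reg i) e) (Seq c (Assign i (Bin Add (Reg i) (Num 1))))) (R, memory n f)
      (1 + expr_time (Bin Less (Reg i) e)) (cells_in_use (R, memory n f)) (R, memory n f)"
      using bound[of N R f] 0 NW[of N] by (intro exec_While_false) (simp add: ev_Less ev_Reg)
    then show ?case using 0 \<open>k = N\<close> by (intro okI) auto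
  next
    case (Suc d)
    then have k: "k < N" by simp
    have "ok (Seq c (Assign i (Bin Add (Reg i) (Num 1)))) R f (T + (1 + expr_time (Bin Add (Reg i) (Num 1))))
       (\<lambda>R' f'. Inv (k + 1) R' f' \<and> R' i = k + 1)"
    proof (rule ok_Seq[OF step])
      show "k < N" "Inv k R f" "R i = k" using k Suc by auto
      fix R' f'
      assume a: "Inv (k + 1) (R'(i := k + 1)) f'" "\<And>r. r \<notin> written c \<Longrightarrow> R' r = R r"
      have "R' i = k" using a(2) assms(2) Suc by auto
      then show "ok (Assign i (Bin Add (Reg i) (Num 1))) R' f' (1 + expr_time (Bin Add (Reg i) (Num 1)))
         (\<lambda>R' f'. Inv (k + 1) R' f' \<and> R' i = k + 1)"
        using a NW[of k] NW[of "k + 1"] k by (intro ok_loop_free) (auto simp: eval.simps)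
    qed
    then obtain t p R' f' where 1: "exec W \<epsilon> G (Seq c (Assign i (Bin Add (Reg i) (Num 1)))) (R, memory n f) t p (R', memory n f')"
      "t \<le> T + 4" "\<forall>r. r \<notin> insert i (written c) \<longrightarrow> R' r = R r" "Inv (k + 1) R' f'" "R' i = k + 1"
      unfolding ok_def by auto
    have "d = N - (k + 1)" "k + 1 \<le> N" using Suc.hyps(2) k by auto
    from Suc.hyps(1)[OF this 1(4,5)] obtain t2 p2 R2 f2 where
      2: "exec W \<epsilon> G (While (Bin Less (Reg i) e) (Seq c (Assign i (Bin Add (Reg i) (Num 1))))) (R', memory n f') t2 p2 (R2, memory n f2)"
       "t2 \<le> 1 + expr_time (Bin Less (Reg i) e) + (N - (k + 1)) * ((T + 4) + 1 + expr_time (Bin Less (Reg i) e))"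
       "\<forall>r. r \<notin> insert i (written c) \<longrightarrow> R2 r = R' r" "Inv N R2 f2" "R2 i = N" unfolding ok_def written.simps by auto
    let ?b = "Bin Less (Reg i) e"
    have "N - k = Suc (N - (k + 1))" using k by simp
    then have tm: "1 + expr_time ?b + t + t2 \<le> 1 + expr_time ?b + (N - k) * ((T + 4) + 1 + expr_time ?b)"
      using 1(2) 2(2) by simp
    have ex: "exec W \<epsilon> G (While ?b (Seq c (Assign i (Bin Add (Reg i) (Num 1))))) (R, memory n f)
        (1 + expr_time ?b + t + t2) (max p p2) (R2, memory n f2)"
      using bound[of k R f] k Suc.prems 1 2 NW[of k]
      by (intro exec_While_true) (auto simp: ev_Less ev_Reg)
    show ?case by (rule okI[OF ex tm]) (use 1(3) 2(3-5) in auto)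
  qed
  from this[of 0 "R(i := 0)" f] init
  have w: "ok (While (Bin Less (Reg i) e) (Seq c (Assign i (Bin Add (Reg i) (Num 1))))) (R(i := 0)) f
     (3 + expr_time e + N * (T + 7 + expr_time e)) (\<lambda>R' f'. Inv N R' f' \<and> R' i = N)"
    by (auto elim!: ok_mono simp: algebra_simps)
  have e0: "ev R f (Num 0) = 0" by (simp add: eval.simps)
  have "ok (For i e c) R f ((1 + expr_time (Num 0)) + (3 + expr_time e + N * (T + 7 + expr_time e)))
       (\<lambda>R' f'. Inv N R' f' \<and> R' i = N)"
    unfolding For_def
    by (rule ok_Seq[OF ok_loop_free[where Q = "\<lambda>R' f'. R' = R(i := 0) \<and> f' = f"]])
      (use w e0 in auto)
  then show ?thesis by (rule ok_mono) (auto simp: algebra_simps)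
qed

end

section \<open>The tables of the data structure\<close>

text \<open>
  Table 0 is the adjacency matrix, table 16 the codegrees restricted to slots, and table 7 the
  triangle counts. Table 3 holds the slots of each vertex as an array, table 4 their number, and
  table 2 the membership bits. Heavy vertices are listed in table 5, counted in 10 and marked in 6.
  All edges inserted during the phase are logged in tables 8 and 9 (one end point in each, possibly
  with repetitions), counted in 11. Table 12 holds the capacity minus one, so that zero memory means
  capacity one; table 13 the number of updates left in the phase. Tables 14 and 15 hold the edges
  while rebuilding. One-dimensional tables use the second index 0.
\<close>

definition slots :: "tables \<Rightarrow> nat \<Rightarrow> nat set" where
  "slots f w = f 3 w ` {..<f 4 w 0}"

definition heavy :: "tables \<Rightarrow> nat set" where
  "heavy f = (\<lambda>i. f 5 i 0) ` {..<f 10 0 0}"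

text \<open>The diagonal is 0 by convention, which agrees with the updates: a new neighbour
  \<open>x\<close> of \<open>w\<close> is paired with earlier neighbours only, so no entry
  \<open>(x, x)\<close> is ever written.\<close>

definition codeg :: "nat \<Rightarrow> nat set set \<Rightarrow> (nat \<Rightarrow> nat set) \<Rightarrow> nat \<Rightarrow> nat \<Rightarrow> nat" where
  "codeg n E S p q =
     (if p = q then 0 else card {w. w < n \<and> p \<in> S w \<and> q \<in> S w \<and> {w, p} \<in> E \<and> {w, q} \<in> E})"

text \<open>A triangle at \<open>v\<close> is represented by its opposite edge. With singletons
  excluded from \<open>E\<close>, no edge that is counted contains \<open>v\<close>.\<close>

definition tri :: "nat set set \<Rightarrow> (nat \<Rightarrow> nat set) \<Rightarrow> nat \<Rightarrow> nat" where
  "tri E S v = card {e \<in> E. (\<forall>x\<in>e. {v, x} \<in> E) \<and> \<not> e \<subseteq> S v}"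

definition edge_set :: "nat \<Rightarrow> nat set set \<Rightarrow> bool" where
  "edge_set n E \<longleftrightarrow> (\<forall>e\<in>E. \<exists>u v. e = {u, v} \<and> u \<noteq> v \<and> u < n \<and> v < n)"

text \<open>The change of the pairs centred at \<open>w\<close> when \<open>x\<close> becomes a
  neighbour of \<open>w\<close>; an edge causes one such change for each end point. \<open>E\<close>
  is the graph without the edge, for insertion as well as for deletion.\<close>

definition codeg_diff :: "nat set set \<Rightarrow> (nat \<Rightarrow> nat set) \<Rightarrow> nat \<Rightarrow> nat \<Rightarrow> nat \<Rightarrow> nat \<Rightarrow> nat" where
  "codeg_diff E S w x p q = of_bool (x \<in> S w \<and>
     ((p = x \<and> q \<in> S w \<and> {w, q} \<in> E) \<or> (q = x \<and> p \<in> S w \<and> {w, p} \<in> E)))"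

text \<open>At an end point, a new triangle is named by its third vertex \<open>z\<close>, and the
  opposite edge joins \<open>z\<close> to the other end. Elsewhere \<open>{a, b}\<close> itself is
  the opposite edge, so the count changes by at most one.\<close>

definition tri_diff :: "nat set set \<Rightarrow> (nat \<Rightarrow> nat set) \<Rightarrow> nat \<Rightarrow> nat \<Rightarrow> nat \<Rightarrow> nat" where
  "tri_diff E S a b v =
     (if v = a then card {z. {a, z} \<in> E \<and> {b, z} \<in> E \<and> \<not> (b \<in> S a \<and> z \<in> S a)}
      else if v = b then card {z. {b, z} \<in> E \<and> {a, z} \<in> E \<and> \<not> (a \<in> S b \<and> z \<in> S b)}
      else of_bool ({v, a} \<in> E \<and> {v, b} \<in> E \<and> \<not> (a \<in> S v \<and> b \<in> S v)))"

section \<open>Effect of one edge on codegrees and triangle counts\<close>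

lemma edge_setD:
  assumes "edge_set n E" "{u, v} \<in> E"
  shows "u \<noteq> v" "u < n" "v < n"
  using assms unfolding edge_set_def by (metis doubleton_eq_iff)+

lemma edge_set_singleton: "edge_set n E \<Longrightarrow> {u} \<notin> E"
  using edge_setD(1)[of n E u u] by auto

lemma finite_edge_set: assumes "edge_set n E" shows "finite E"
proof (rule finite_subset)
  show "E \<subseteq> Set.Pow {..<n}" using assms unfolding edge_set_def by fastforce
qed simp

text \<open>Only \<open>a\<close> and \<open>b\<close> can become new common neighbours:
  \<open>a\<close> for pairs containing \<open>b\<close>, and \<open>b\<close> for pairs containing
  \<open>a\<close>. They were none before because \<open>{a, b}\<close> was not an edge.\<close>

lemma codeg_insert:
  assumes E: "edge_set n E" and ab: "a \<noteq> b" "a < n" "b < n" "{a, b} \<notin> E"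
    and S: "\<And>w. w \<notin> S w"
  shows "codeg n (insert {a, b} E) S p q =
    codeg n E S p q + (codeg_diff E S a b p q + codeg_diff E S b a p q)"
proof (cases "p = q")
  case True
  have "{b, a} \<notin> E" using ab by (simp add: insert_commute)
  with True ab show ?thesis by (auto simp: codeg_def codeg_diff_def)
next
  case False
  define A where "A = {w. w < n \<and> p \<in> S w \<and> q \<in> S w \<and> {w, p} \<in> E \<and> {w, q} \<in> E}"
  define P where "P w x \<longleftrightarrow> x \<in> S w \<and>
     ((p = x \<and> q \<in> S w \<and> {w, q} \<in> E) \<or> (q = x \<and> p \<in> S w \<and> {w, p} \<in> E))" for w x
  have ba: "{b, a} \<notin> E" using ab by (simp add: insert_commute)
  have "{w. w < n \<and> p \<in> S w \<and> q \<in> S w \<and> {w, p} \<in> insert {a, b} E \<and> {w, q} \<in> insert {a, b} E} =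
     A \<union> (if P a b then {a} else {}) \<union> (if P b a then {b} else {})"
    unfolding A_def P_def using ab False S ba by (auto simp: doubleton_eq_iff insert_commute)
  moreover have "finite A" unfolding A_def by simp
  moreover have "P a b \<Longrightarrow> a \<notin> A" "P b a \<Longrightarrow> b \<notin> A" unfolding A_def P_def using ab ba by auto
  ultimately have "card {w. w < n \<and> p \<in> S w \<and> q \<in> S w \<and> {w, p} \<in> insert {a, b} E \<and> {w, q} \<in> insert {a, b} E}
     = card A + (of_bool (P a b) + of_bool (P b a))"
    using ab(1) by (auto simp: card_insert_if)
  then show ?thesis using False unfolding codeg_def codeg_diff_def A_def P_def by simp
qed

text \<open>A new triangle at \<open>a\<close> uses the edge \<open>{a, b}\<close>, so its opposite
  edge is \<open>{b, z}\<close> for a common neighbour \<open>z\<close>, and \<open>z\<close> is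
  determined by that edge.\<close>

lemma tri_insert_end:
  assumes E: "edge_set n E" and ab: "a \<noteq> b" "{a, b} \<notin> E"
  shows "card {e \<in> insert {a, b} E. (\<forall>x\<in>e. {a, x} \<in> insert {a, b} E) \<and> \<not> e \<subseteq> T} =
    card {e \<in> E. (\<forall>x\<in>e. {a, x} \<in> E) \<and> \<not> e \<subseteq> T} +
    card {z. {a, z} \<in> E \<and> {b, z} \<in> E \<and> \<not> (b \<in> T \<and> z \<in> T)}"
proof -
  define A where "A = {e \<in> E. (\<forall>x\<in>e. {a, x} \<in> E) \<and> \<not> e \<subseteq> T}"
  define Z where "Z = {z. {a, z} \<in> E \<and> {b, z} \<in> E \<and> \<not> (b \<in> T \<and> z \<in> T)}"
  have sing: "{u} \<notin> E" for u using edge_set_singleton[OF E] .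
  have eq: "{e \<in> insert {a, b} E. (\<forall>x\<in>e. {a, x} \<in> insert {a, b} E) \<and> \<not> e \<subseteq> T} = A \<union> (\<lambda>z. {b, z}) ` Z"
    (is "?L = _")
  proof
    show "?L \<subseteq> A \<union> (\<lambda>z. {b, z}) ` Z"
    proof
      fix e assume e: "e \<in> ?L"
      \<comment> \<open>\<open>{a, b}\<close> itself is not opposite to \<open>a\<close>: that would
        make \<open>{a}\<close> an edge.\<close>
      have "e \<noteq> {a, b}"
      proof
        assume "e = {a, b}"
        then have "{a, a} \<in> insert {a, b} E" using e by blast
        then show False using sing ab by auto
      qed
      then have eE: "e \<in> E" using e by auto
      show "e \<in> A \<union> (\<lambda>z. {b, z}) ` Z"
      proof (cases "b \<in> e")
        case True
        then obtain z where z: "e = {b, z}" "z \<noteq> b"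
          using eE E unfolding edge_set_def by (metis insertE insert_commute singletonD)
        then have "{a, z} \<in> insert {a, b} E" using e by auto
        then have "{a, z} \<in> E" using z ab by (auto simp: doubleton_eq_iff)
        then have "z \<in> Z" unfolding Z_def using e z eE by auto
        then show ?thesis using z by auto
      next
        case False
        then have "\<forall>x\<in>e. {a, x} \<noteq> {a, b}" by (auto simp: doubleton_eq_iff)
        then have "e \<in> A" unfolding A_def using e eE by auto
        then show ?thesis by simp
      qed
    qed
    show "A \<union> (\<lambda>z. {b, z}) ` Z \<subseteq> ?L" unfolding A_def Z_def by auto
  qed
  have "A \<inter> (\<lambda>z. {b, z}) ` Z = {}" unfolding A_def using ab by auto
  moreover have "finite A" unfolding A_def using finite_edge_set[OF E] by simp
  moreover have "finite Z"
  proof (rule finite_subset)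
    show "Z \<subseteq> {..<n}" unfolding Z_def using edge_setD[OF E] by auto
  qed simp
  moreover have "inj_on (\<lambda>z. {b, z}) Z" by (auto simp: inj_on_def doubleton_eq_iff)
  ultimately show ?thesis unfolding eq A_def[symmetric] Z_def[symmetric]
    by (simp add: card_Un_disjoint card_image)
qed

lemma tri_insert:
  assumes E: "edge_set n E" and ab: "a \<noteq> b" "{a, b} \<notin> E"
  shows "tri (insert {a, b} E) S v = tri E S v + tri_diff E S a b v"
proof -
  consider "v = a" | "v = b" "v \<noteq> a" | "v \<noteq> a" "v \<noteq> b" by blast
  then show ?thesis
  proof cases
    case 1
    then show ?thesis unfolding tri_def tri_diff_def using tri_insert_end[OF E ab] by simp
  next
    case 2
    have "{b, a} \<notin> E" "b \<noteq> a" using ab by (auto simp: insert_commute)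
    from tri_insert_end[OF E this(2,1)] 2 show ?thesis
      unfolding tri_def tri_diff_def by (simp add: insert_commute)
  next
    case 3
    then have "{v, x} \<in> insert {a, b} E \<longleftrightarrow> {v, x} \<in> E" for x by (auto simp: doubleton_eq_iff)
    then have "{e \<in> insert {a, b} E. (\<forall>x\<in>e. {v, x} \<in> insert {a, b} E) \<and> \<not> e \<subseteq> S v} =
      {e \<in> E. (\<forall>x\<in>e. {v, x} \<in> E) \<and> \<not> e \<subseteq> S v} \<union>
      (if {v, a} \<in> E \<and> {v, b} \<in> E \<and> \<not> (a \<in> S v \<and> b \<in> S v) then {{a, b}} else {})"
      by auto
    moreover have "{a, b} \<notin> {e \<in> E. (\<forall>x\<in>e. {v, x} \<in> E) \<and> \<not> e \<subseteq> S v}" using ab by simp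
    moreover have "finite {e \<in> E. (\<forall>x\<in>e. {v, x} \<in> E) \<and> \<not> e \<subseteq> S v}" using finite_edge_set[OF E] by simp
    ultimately show ?thesis unfolding tri_def tri_diff_def using 3 by (simp add: card_insert_if)
  qed
qed

text \<open>A common neighbour that the codegree misses lacks a slot for \<open>a\<close> or for
  \<open>b\<close>, and by \<open>cov\<close> it belongs to \<open>H\<close>. So the full codegree
  of any pair is a table entry plus the result of a scan of \<open>H\<close>.\<close>

lemma card_codeg_split:
  assumes E: "edge_set n E" and ab: "a \<noteq> b"
    and cov: "\<And>w x. {w, x} \<in> E \<Longrightarrow> x \<in> S w \<or> w \<in> H"
  shows "card {z. {a, z} \<in> E \<and> {b, z} \<in> E} = codeg n E S a b +
    card {z \<in> H. {z, a} \<in> E \<and> {z, b} \<in> E \<and> \<not> (a \<in> S z \<and> b \<in> S z)}"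
proof -
  have "{z. {a, z} \<in> E \<and> {b, z} \<in> E} =
     {w. w < n \<and> a \<in> S w \<and> b \<in> S w \<and> {w, a} \<in> E \<and> {w, b} \<in> E} \<union>
     {z \<in> H. {z, a} \<in> E \<and> {z, b} \<in> E \<and> \<not> (a \<in> S z \<and> b \<in> S z)}"
    unfolding insert_commute[of a _ "{}"] insert_commute[of b _ "{}"]
    using edge_setD[OF E] cov by blast
  moreover have "finite {z. {a, z} \<in> E \<and> {b, z} \<in> E}"
    by (rule finite_subset[of _ "{..<n}"]) (use edge_setD[OF E] in auto)
  ultimately show ?thesis unfolding codeg_def using ab
    by (simp, subst card_Un_disjoint) auto
qed

text \<open>Slots are consulted along edges only. Hence a slot can be assigned before its edge is
  inserted, and slots left over from deleted edges do not falsify the counts.\<close>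

lemma codeg_cong:
  assumes "\<And>w x. {w, x} \<in> E \<Longrightarrow> x \<in> S w \<longleftrightarrow> x \<in> S' w"
  shows "codeg n E S p q = codeg n E S' p q"
  unfolding codeg_def using assms by (metis (mono_tags, lifting))

lemma tri_cong:
  assumes "\<And>w x. {w, x} \<in> E \<Longrightarrow> x \<in> S w \<longleftrightarrow> x \<in> S' w"
  shows "tri E S v = tri E S' v"
proof -
  have "{e \<in> E. (\<forall>x\<in>e. {v, x} \<in> E) \<and> \<not> e \<subseteq> S v} = {e \<in> E. (\<forall>x\<in>e. {v, x} \<in> E) \<and> \<not> e \<subseteq> S' v}"
    using assms by blast
  then show ?thesis unfolding tri_def by simp
qed

text \<open>Arrays are zero beyond their lengths, so that the lengths bound the number of nonzero
  cells. Heavy vertices have all \<open>cap\<close> slots filled, which limits how many there are.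
  The bits of tables 2 and 6 repeat the arrays to make membership a single access.\<close>

definition slots_inv :: "nat \<Rightarrow> nat \<Rightarrow> tables \<Rightarrow> bool" where
  "slots_inv n cap f \<longleftrightarrow>
     (\<forall>w x. f 2 w x = of_bool (x \<in> slots f w)) \<and>
     (\<forall>w. inj_on (f 3 w) {..<f 4 w 0}) \<and>
     (\<forall>w i. f 3 w i \<noteq> 0 \<longrightarrow> i < f 4 w 0) \<and>
     (\<forall>w. f 4 w 0 \<le> cap) \<and>
     (\<forall>w. slots f w \<subseteq> {..<n} - {w}) \<and>
     (\<forall>w. f 4 w 0 \<noteq> 0 \<longrightarrow> w < n) \<and>
     inj_on (\<lambda>i. f 5 i 0) {..<f 10 0 0} \<and>
     (\<forall>i. f 5 i 0 \<noteq> 0 \<longrightarrow> i < f 10 0 0) \<and>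
     heavy f \<subseteq> {..<n} \<and>
     (\<forall>w. f 6 w 0 = of_bool (w \<in> heavy f)) \<and>
     (\<forall>w\<in>heavy f. f 4 w 0 = cap) \<and>
     cap = Suc (f 12 0 0)"

text \<open>Without vertex queries the triangle table stays zero; this spares updates the scan of
  the heavy vertices and is what lowers the update time from
  \<open>m powr max \<epsilon> (1 - \<epsilon>)\<close> to \<open>m powr \<epsilon>\<close>. The
  last conjunct makes scanning the heavy vertices complete.\<close>

definition counts_inv :: "bool \<Rightarrow> nat \<Rightarrow> nat set set \<Rightarrow> tables \<Rightarrow> bool" where
  "counts_inv vq n E f \<longleftrightarrow>
     (\<forall>p q. f 0 p q = of_bool ({p, q} \<in> E)) \<and>
     (\<forall>p q. f 16 p q = codeg n E (slots f) p q) \<and>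
     (\<forall>v. f 7 v 0 = (if vq then tri E (slots f) v else 0)) \<and>
     (\<forall>w x. {w, x} \<in> E \<longrightarrow> x \<in> slots f w \<or> w \<in> heavy f)"

definition flat :: "nat \<Rightarrow> tables \<Rightarrow> bool" where
  "flat n f \<longleftrightarrow> (\<forall>j p q. 4 \<le> j \<longrightarrow> j < 16 \<longrightarrow> q \<noteq> 0 \<longrightarrow> f j p q = 0) \<and>
     (\<forall>j p q. 10 \<le> j \<longrightarrow> j < 14 \<longrightarrow> p \<noteq> 0 \<longrightarrow> f j p q = 0) \<and>
     (\<forall>j p q. j = 1 \<or> 16 < j \<longrightarrow> f j p q = 0) \<and>
     (\<forall>p. f 14 p 0 < n \<and> f 15 p 0 < n)"

text \<open>The log may also contain edges deleted since. It mentions every vertex with slots, so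
  emptying the rows of logged vertices empties all rows, and it pays for the slots: an insertion
  adds one log entry and at most one slot at each end.\<close>

definition log_inv :: "nat \<Rightarrow> nat set set \<Rightarrow> tables \<Rightarrow> bool" where
  "log_inv n E f \<longleftrightarrow>
     (\<forall>i. f 8 i 0 \<noteq> 0 \<or> f 9 i 0 \<noteq> 0 \<longrightarrow> i < f 11 0 0) \<and>
     (\<forall>i. f 8 i 0 < n \<and> f 9 i 0 < n) \<and>
     (\<forall>e\<in>E. \<exists>i<f 11 0 0. e = {f 8 i 0, f 9 i 0}) \<and>
     (\<forall>w. f 4 w 0 \<noteq> 0 \<longrightarrow> (\<exists>i<f 11 0 0. w = f 8 i 0 \<or> w = f 9 i 0)) \<and>
     (\<Sum>w<n. f 4 w 0) \<le> 2 * f 11 0 0"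

definition ds_inv :: "bool \<Rightarrow> nat \<Rightarrow> nat \<Rightarrow> nat set set \<Rightarrow> tables \<Rightarrow> bool" where
  "ds_inv vq n cap E f \<longleftrightarrow> edge_set n E \<and> slots_inv n cap f \<and> counts_inv vq n E f \<and> flat n f \<and> log_inv n E f"

section \<open>Programs that maintain the count tables\<close>

abbreviation zero :: expr where "zero \<equiv> Num 0"
abbreviation one :: expr where "one \<equiv> Num 1"

text \<open>The operator is a parameter so that insertion (\<open>Add\<close>) and deletion
  (\<open>Sub\<close>) run the same programs.\<close>

definition add_table :: "binop \<Rightarrow> tables \<Rightarrow> nat \<Rightarrow> (nat \<Rightarrow> nat \<Rightarrow> nat) \<Rightarrow> tables" where
  "add_table bop f j D = (\<lambda>j' p q. if j' = j then apply_bin bop (f j p q) (D p q) else f j' p q)"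

definition codeg_step :: "binop \<Rightarrow> nat \<Rightarrow> nat \<Rightarrow> com" where
  "codeg_step bop w x = Seq (Assign 6 (At 3 (Reg w) (Reg 5)))
     (If (At 0 (Reg w) (Reg 6))
       (Seq (Put 16 (Reg x) (Reg 6) (Bin bop (At 16 (Reg x) (Reg 6)) one))
            (Put 16 (Reg 6) (Reg x) (Bin bop (At 16 (Reg 6) (Reg x)) one)))
       Skip)"

definition codeg_prog :: "binop \<Rightarrow> nat \<Rightarrow> nat \<Rightarrow> com" where
  "codeg_prog bop w x = If (At 2 (Reg w) (Reg x)) (For 5 (At 4 (Reg w) zero) (codeg_step bop w x)) Skip"

text \<open>Serves queries (\<open>None\<close>) and updates (\<open>Some bop\<close>): register 7
  counts the heavy common neighbours that the codegree misses, and an update also adjusts their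
  triangle counts. Comparing a sum of two bits with 2 expresses a conjunction or its
  negation.\<close>

definition heavy_step :: "binop option \<Rightarrow> com" where
  "heavy_step opt = Seq (Assign 9 (At 5 (Reg 5) zero))
     (If (Bin Eq (Bin Add (At 0 (Reg 9) (Reg 1)) (At 0 (Reg 9) (Reg 2))) (Num 2))
       (If (Bin Less (Bin Add (At 2 (Reg 9) (Reg 1)) (At 2 (Reg 9) (Reg 2))) (Num 2))
         (Seq (Assign 7 (Bin Add (Reg 7) one))
           (case opt of None \<Rightarrow> Skip | Some bop \<Rightarrow> Put 7 (Reg 9) zero (Bin bop (At 7 (Reg 9) zero) one)))
         Skip)
       Skip)"

definition heavy_prog :: "binop option \<Rightarrow> com" where
  "heavy_prog opt = For 5 (At 10 zero zero) (heavy_step opt)"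

definition tri_end_step :: "nat \<Rightarrow> nat \<Rightarrow> com" where
  "tri_end_step w x = Seq (Assign 6 (At 3 (Reg w) (Reg 5)))
     (If (Bin Eq (Bin Add (At 0 (Reg w) (Reg 6)) (At 0 (Reg x) (Reg 6))) (Num 2))
       (Assign 8 (Bin Sub (Reg 8) one)) Skip)"

text \<open>The new triangles at \<open>w\<close> are counted from above: all common neighbours,
  minus those whose opposite edge lies within the slots of \<open>w\<close>. The loop thus runs over
  the slots and not over the whole neighbourhood.\<close>

definition tri_end :: "binop \<Rightarrow> nat \<Rightarrow> nat \<Rightarrow> com" where
  "tri_end bop w x = Seq (Assign 8 (Reg 7))
     (Seq (If (At 2 (Reg w) (Reg x)) (For 5 (At 4 (Reg w) zero) (tri_end_step w x)) Skip)
       (Put 7 (Reg w) zero (Bin bop (At 7 (Reg w) zero) (Reg 8))))"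

text \<open>Register 7 starts with the codegree over slots, and the scan of the heavy vertices
  completes it to the full codegree, from which the counts at both end points are computed.\<close>

definition tri_prog :: "binop \<Rightarrow> com" where
  "tri_prog bop = Seq (Assign 7 (At 16 (Reg 1) (Reg 2)))
     (Seq (heavy_prog (Some bop)) (Seq (tri_end bop 1 2) (tri_end bop 2 1)))"

lemma inj_on_lessThan_new:
  fixes g :: "nat \<Rightarrow> 'a"
  assumes "inj_on g {..<N}" "k < N"
  shows "g k \<notin> g ` {..<k}"
proof
  assume "g k \<in> g ` {..<k}"
  then obtain i where i: "i < k" "g k = g i" by auto
  then have "k = i" using inj_onD[OF assms(1) i(2)] assms(2) by simp
  then show False using i by simp
qed

section \<open>Correctness of the scanning loops\<close>

context ram
begin

text \<open>Leaves room above \<open>PB\<close>, since tables in the middle of an update may have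
  been increased without satisfying the invariants yet.\<close>

definition bounded :: "tables \<Rightarrow> bool" where
  "bounded f \<longleftrightarrow> (\<forall>j p q. f j p q \<le> 10 * PB)"

lemma leW: "x < n \<Longrightarrow> x < W" "x < n \<Longrightarrow> x \<le> PB"  "x \<le> 10 * PB \<Longrightarrow> x < W" "x \<le> 10 * PB \<Longrightarrow> Suc x < W"
  "x \<le> n \<Longrightarrow> x < W" "x \<le> n \<Longrightarrow> x \<le> PB"
  using PB_bounds by linarith+

lemma ev_bin:
  assumes "bop = Add \<or> bop = Sub" "ev R f e1 + ev R f e2 < W"
  shows "ev R f (Bin bop e1 e2) = apply_bin bop (ev R f e1) (ev R f e2)"
  using assms by (auto simp: ev_Add ev_Sub)

lemma W_small: "0 < W" "Suc 0 < W" "1 < W" "0 \<le> PB"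
  using PB_bounds by auto

lemmas evs = ev_Num ev_Reg ev_Add ev_Sub ev_Less ev_Eq ev_At sem_Put ev_bin

lemma ev_both:
  assumes "ev R f e1 = of_bool P" "ev R f e2 = of_bool Q"
  shows "ev R f (Bin Eq (Bin Add e1 e2) (Num 2)) = of_bool (P \<and> Q)"
    "ev R f (Bin Less (Bin Add e1 e2) (Num 2)) = of_bool (\<not> (P \<and> Q))"
proof -
  have "of_bool P + of_bool Q < W" "2 < W" using PB_bounds by (auto simp: of_bool_def)
  then have "ev R f (Bin Add e1 e2) = of_bool P + of_bool Q" "ev R f (Num 2) = 2"
    using assms by (simp_all add: ev_Add ev_Num)
  then show "ev R f (Bin Eq (Bin Add e1 e2) (Num 2)) = of_bool (P \<and> Q)"
    "ev R f (Bin Less (Bin Add e1 e2) (Num 2)) = of_bool (\<not> (P \<and> Q))"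
    by (auto simp: ev_Eq ev_Less)
qed

text \<open>Truncated subtraction obeys \<open>x - y - z = x - (y + z)\<close> too, so additions and
  subtractions share one correctness proof. That nothing is cut off follows later, from what the
  edge has contributed.\<close>

lemma apply_bin_add:
  assumes "bop = Add \<or> bop = Sub"
  shows "apply_bin bop (apply_bin bop x y) z = apply_bin bop x (y + z)" "apply_bin bop x 0 = x"
    "apply_bin bop x y \<le> x + y"
  using assms by auto

text \<open>Assumption \<open>a\<close> says that the edge between \<open>R w\<close> and
  \<open>R x\<close> is absent from the table while the loop runs. So no neighbour found by the scan
  equals \<open>R x\<close>, and the two entries written in a round are distinct.\<close>

lemma ok_codeg_prog:
  assumes bop: "bop = Add \<or> bop = Sub"
    and regs: "w \<notin> {0, 5, 6}" "x \<notin> {0, 5, 6}" "R 0 = n" "R w < n" "R x < n"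
    and b: "bounded f" and len: "f 4 (R w) 0 \<le> n"
    and inj: "inj_on (f 3 (R w)) {..<f 4 (R w) 0}"
    and s: "slots f (R w) \<subseteq> {..<n}"
    and a: "f 0 (R w) (R x) = 0"
  shows "ok (codeg_prog bop w x) R f (300 * (f 4 (R w) 0 + 1)) (\<lambda>R' f'. f' = add_table bop f 16 (\<lambda>p q.
     of_bool (f 2 (R w) (R x) \<noteq> 0 \<and>
       ((p = R x \<and> q \<in> slots f (R w) \<and> f 0 (R w) q \<noteq> 0) \<or> (q = R x \<and> p \<in> slots f (R w) \<and> f 0 (R w) p \<noteq> 0)))))"
    (is "ok _ _ _ _ ?Q")
proof -
  let ?w = "R w" and ?x = "R x"
  let ?N = "f 4 ?w 0"
  have bd: "f j p q \<le> 10 * PB" for j p q using b unfolding bounded_def by blast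
  have bdW: "f j p q < W" "Suc (f j p q) < W" for j p q using bd leW by blast+
  have rW: "?w < W" "?x < W" "?w \<le> PB" "?x \<le> PB" using regs leW by auto
  define P where "P k p q \<longleftrightarrow> (p = ?x \<and> q \<in> f 3 ?w ` {..<k} \<and> f 0 ?w q \<noteq> 0) \<or>
      (q = ?x \<and> p \<in> f 3 ?w ` {..<k} \<and> f 0 ?w p \<noteq> 0)" for k :: nat and p q
  define g where "g k = add_table bop f 16 (\<lambda>p q. of_bool (P k p q))" for k :: nat
  have ab: "apply_bin bop y (of_bool P) \<le> Suc y" for y P
    using bop by auto
  have gb: "g k j p q \<le> 10 * PB + 1" for k j p q
    using bd[of j p q] ab[of "f j p q" "P k p q"] unfolding g_def add_table_def by auto
  have gW: "g k j p q < W" "Suc (g k j p q) < W" for k j p q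
    using gb[of k j p q] PB_bounds by linarith+
  have yn: "f 3 ?w k < n" if "k < ?N" for k using that s unfolding slots_def by auto
  have loop: "ok (For 5 (At 4 (Reg w) zero) (codeg_step bop w x)) R f
     (10 + expr_time (At 4 (Reg w) zero) + ?N * (200 + 10 + expr_time (At 4 (Reg w) zero)))
     (\<lambda>R' f'. (f' = g ?N \<and> (\<forall>r. r \<notin> {5, 6} \<longrightarrow> R' r = R r)) \<and> R' 5 = ?N)"
  proof (rule ok_For)
    fix k R' f'
    assume k: "k < ?N" and I: "f' = g k \<and> (\<forall>r. r \<notin> {5, 6} \<longrightarrow> R' r = R r)" and R5: "R' 5 = k"
    let ?y = "f 3 ?w k"
    have kn: "k < n" "k < W" using k len leW by auto
    have y: "?y < n" "?y < W" "?y \<le> PB" using yn[OF k] leW by auto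
    have R': "R' 0 = n" "R' w = ?w" "R' x = ?x" using I regs by auto
    \<comment> \<open>Slots are distinct, so no pair is changed in two rounds.\<close>
    have ynew: "?y \<notin> f 3 ?w ` {..<k}" using inj_on_lessThan_new[OF inj k] .
    have yx: "?y \<noteq> ?x" if "f 0 ?w ?y \<noteq> 0" using that a by auto
    have "upd (upd (g k) 16 ?x ?y (apply_bin bop (g k 16 ?x ?y) 1)) 16 ?y ?x (apply_bin bop (g k 16 ?y ?x) 1) = g (Suc k)"
      if "f 0 ?w ?y \<noteq> 0"
    proof (intro ext)
      fix j p q
      have P: "P (Suc k) p q \<longleftrightarrow> P k p q \<or> (p = ?x \<and> q = ?y) \<or> (q = ?x \<and> p = ?y)"
        "\<not> P k ?x ?y" "\<not> P k ?y ?x"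
        using that yx[OF that] ynew a unfolding P_def by (auto simp: lessThan_Suc)
      show "upd (upd (g k) 16 ?x ?y (apply_bin bop (g k 16 ?x ?y) 1)) 16 ?y ?x (apply_bin bop (g k 16 ?y ?x) 1) j p q = g (Suc k) j p q"
        using P yx[OF that] unfolding g_def upd_apply add_table_def by (simp add: apply_bin_add[OF bop])
    qed
    moreover have "g k = g (Suc k)" if "f 0 ?w ?y = 0"
    proof -
      have "P k = P (Suc k)" unfolding P_def using that by (intro ext) (auto simp: lessThan_Suc)
      then show ?thesis by (simp only: g_def)
    qed
    moreover have [simp]: "g k 3 ?w k = ?y" "g k 0 ?w ?y = f 0 ?w ?y" unfolding g_def add_table_def by auto
    ultimately show "ok (codeg_step bop w x) R' f' 200
        (\<lambda>R' f'. f' = g (k + 1) \<and> (\<forall>r. r \<notin> {5, 6} \<longrightarrow> (R'(5 := k + 1)) r = R r))"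
      using I regs R' R5 kn y rW bop yx
      by (intro ok_loop_free[where R' = "R'(6 := ?y)" and f' = "g (Suc k)"])
        (simp_all add: codeg_step_def evs W_small gW bdW upd_apply)
  next
    fix k R' f'
    assume k: "k \<le> ?N" and I: "f' = g k \<and> (\<forall>r. r \<notin> {5, 6} \<longrightarrow> R' r = R r)" and R5: "R' 5 = k"
    have R': "R' 0 = n" "R' w = ?w" "R' x = ?x" using I regs by auto
    have [simp]: "g k 4 ?w 0 = ?N" unfolding g_def add_table_def by simp
    show "ev R' f' (At 4 (Reg w) zero) = ?N" using I R' rW regs n_pos bdW
      by (simp add: evs W_small)
  qed (use len PB_bounds in \<open>auto simp: codeg_step_def g_def add_table_def P_def fun_eq_iff apply_bin_add[OF bop]\<close>)
  have eb: "ev R f (At 2 (Reg w) (Reg x)) = f 2 ?w ?x" using regs rW bdW by (simp add: evs)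
  have "ok (codeg_prog bop w x) R f (1 + expr_time (At 2 (Reg w) (Reg x)) +
     (10 + expr_time (At 4 (Reg w) zero) + ?N * (200 + 10 + expr_time (At 4 (Reg w) zero)))) ?Q"
    unfolding codeg_prog_def
  proof (rule ok_If)
    assume e: "ev R f (At 2 (Reg w) (Reg x)) \<noteq> 0"
    show "ok (For 5 (At 4 (Reg w) zero) (codeg_step bop w x)) R f
       (10 + expr_time (At 4 (Reg w) zero) + ?N * (200 + 10 + expr_time (At 4 (Reg w) zero))) ?Q"
      by (intro ok_mono[OF loop]) (use e in \<open>auto simp: eb g_def P_def slots_def add_table_def fun_eq_iff\<close>)
  next
    assume e: "ev R f (At 2 (Reg w) (Reg x)) = 0"
    then show "ok Skip R f (10 + expr_time (At 4 (Reg w) zero) + ?N * (200 + 10 + expr_time (At 4 (Reg w) zero))) ?Q"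
      unfolding eb
      by (intro ok_loop_free) (auto simp: fun_eq_iff apply_bin_add[OF bop] add_table_def)
  qed
  then show ?thesis by (rule ok_mono) auto
qed

lemma ok_heavy_prog:
  assumes bop: "opt = Some Add \<or> opt = Some Sub \<or> opt = None"
    and regs: "R 0 = n" "R 1 < n" "R 2 < n" "R 7 \<le> n"
    and b: "bounded f" and len: "f 10 0 0 \<le> n"
    and inj: "inj_on (\<lambda>i. f 5 i 0) {..<f 10 0 0}"
    and h: "heavy f \<subseteq> {..<n}"
    and A: "\<And>p q. f 0 p q = of_bool (A p q)" and B: "\<And>p q. f 2 p q = of_bool (B p q)"
    and C: "\<And>v. C v \<longleftrightarrow> A v (R 1) \<and> A v (R 2) \<and> \<not> (B v (R 1) \<and> B v (R 2))"
  shows "ok (heavy_prog opt) R f (300 * (f 10 0 0 + 1)) (\<lambda>R' f'.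
     f' = (case opt of None \<Rightarrow> f | Some bop \<Rightarrow> add_table bop f 7 (\<lambda>v q. of_bool (q = 0 \<and> v \<in> heavy f \<and> C v))) \<and>
     R' 7 = R 7 + card {v \<in> heavy f. C v})"
proof -
  let ?N = "f 10 0 0"
  define g where "g k = (case opt of None \<Rightarrow> f | Some bop \<Rightarrow> add_table bop f 7
     (\<lambda>v q. of_bool (q = 0 \<and> v \<in> (\<lambda>i. f 5 i 0) ` {..<k} \<and> C v)))" for k :: nat
  define c where "c k = card {v \<in> (\<lambda>i. f 5 i 0) ` {..<k}. C v}" for k :: nat
  have bd: "f j p q \<le> 10 * PB" for j p q using b unfolding bounded_def by blast
  have bdW: "f j p q < W" "Suc (f j p q) < W" for j p q using bd leW by blast+
  have ab: "bop = Add \<or> bop = Sub \<Longrightarrow> apply_bin bop y (of_bool P) \<le> Suc y" for y P bop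
    by auto
  have gb: "g k j p q \<le> 10 * PB + 1" for k j p q
    using bd[of j p q] bop unfolding g_def add_table_def
    by (auto intro!: order_trans[OF ab])
  have gW: "g k j p q < W" "Suc (g k j p q) < W" for k j p q
    using gb[of k j p q] PB_bounds by linarith+
  have ck: "c k \<le> n" if "k \<le> ?N" for k
  proof -
    have "c k \<le> card ((\<lambda>i. f 5 i 0) ` {..<k})" unfolding c_def by (intro card_mono) auto
    also have "\<dots> \<le> k" using card_image_le[of "{..<k}" "\<lambda>i. f 5 i 0"] by simp
    finally show ?thesis using that len by simp
  qed
  have loop: "ok (heavy_prog opt) R f (10 + expr_time (At 10 zero zero) + ?N * (200 + 10 + expr_time (At 10 zero zero)))
     (\<lambda>R' f'. (f' = g ?N \<and> R' 7 = R 7 + c ?N \<and> (\<forall>r. r \<notin> {5, 7, 9} \<longrightarrow> R' r = R r)) \<and> R' 5 = ?N)"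
    unfolding heavy_prog_def
  proof (rule ok_For)
    fix k R' f'
    assume k: "k < ?N" and I: "f' = g k \<and> R' 7 = R 7 + c k \<and> (\<forall>r. r \<notin> {5, 7, 9} \<longrightarrow> R' r = R r)" and R5: "R' 5 = k"
    let ?v = "f 5 k 0"
    have kn: "k < n" "k < W" "k \<le> PB" using k len leW by auto
    have v: "?v < n" "?v < W" "?v \<le> PB" using h k leW unfolding heavy_def by auto
    have R': "R' 0 = n" "R' 1 = R 1" "R' (Suc 0) = R 1" "R' 2 = R 2" using I regs by auto
    have RW: "R 1 < W" "R 2 < W" "R (Suc 0) < W" "R (Suc 0) < n" using regs leW by auto
    have qW: "R 7 + c k < W" "Suc (R 7 + c k) < W" using ck[of k] k regs PB_bounds by linarith+
    have vnew: "?v \<notin> (\<lambda>i. f 5 i 0) ` {..<k}" using inj_on_lessThan_new[OF inj k] .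
    have [simp]: "g k 5 k 0 = ?v" "g k 0 ?v y = of_bool (A ?v y)" "g k 2 ?v y = of_bool (B ?v y)" for y
      using bop A B unfolding g_def add_table_def by auto
    have gT: "(case opt of None \<Rightarrow> g k | Some bop \<Rightarrow> upd (g k) 7 ?v 0 (apply_bin bop (g k 7 ?v 0) 1)) = g (Suc k)"
      if "C ?v"
      using that bop vnew unfolding g_def
      by (auto simp: fun_eq_iff upd_apply add_table_def lessThan_Suc)
    have gF: "g k = g (Suc k)" if "\<not> C ?v"
    proof -
      have "(v \<in> (\<lambda>i. f 5 i 0) ` {..<k} \<and> C v) = (v \<in> (\<lambda>i. f 5 i 0) ` {..<Suc k} \<and> C v)" for v
        using that by (auto simp: lessThan_Suc)
      then show ?thesis by (simp only: g_def)
    qed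
    have cS: "c (Suc k) = c k + of_bool (C ?v)"
    proof -
      have "{v \<in> (\<lambda>i. f 5 i 0) ` {..<Suc k}. C v} = (if C ?v then insert ?v {v \<in> (\<lambda>i. f 5 i 0) ` {..<k}. C v}
         else {v \<in> (\<lambda>i. f 5 i 0) ` {..<k}. C v})" by (auto simp: lessThan_Suc)
      then show ?thesis using vnew unfolding c_def by simp
    qed
    let ?R = "if C ?v then R'(9 := ?v, 7 := R' 7 + 1) else R'(9 := ?v)"
    let ?R9 = "R'(9 := ?v)"
    have e9: "ev R' (g k) (At 5 (Reg 5) zero) = ?v"
      using R' R5 kn n_pos bdW by (simp add: evs W_small)
    have eA: "ev ?R9 (g k) (At 0 (Reg 9) (Reg 1)) = of_bool (A ?v (R 1))"
      "ev ?R9 (g k) (At 0 (Reg 9) (Reg 2)) = of_bool (A ?v (R 2))"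
      "ev ?R9 (g k) (At 2 (Reg 9) (Reg 1)) = of_bool (B ?v (R 1))"
      "ev ?R9 (g k) (At 2 (Reg 9) (Reg 2)) = of_bool (B ?v (R 2))"
      using R' v RW gW W_small regs by (simp_all add: evs)
    have e7: "ev ?R9 (g k) (Bin Add (Reg 7) one) = R' 7 + 1"
      using I qW W_small by (simp add: evs)
    have eP: "sem W \<epsilon> G (Put 7 (Reg 9) zero (Bin bop (At 7 (Reg 9) zero) one)) (R'(9 := ?v, 7 := R' 7 + 1), memory n (g k))
      = (R'(9 := ?v, 7 := R' 7 + 1), memory n (upd (g k) 7 ?v 0 (apply_bin bop (g k 7 ?v 0) 1)))"
      if "bop = Add \<or> bop = Sub" for bop
      using R' v RW gW W_small n_pos that by (simp add: evs)
    have "sem W \<epsilon> G (heavy_step opt) (R', memory n f') = (?R, memory n (g (Suc k)))"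
    proof (cases "C ?v")
      case True
      then have "sem W \<epsilon> G (heavy_step opt) (R', memory n f') = sem W \<epsilon> G (case opt of None \<Rightarrow> Skip | Some bop \<Rightarrow> Put 7 (Reg 9) zero (Bin bop (At 7 (Reg 9) zero) one))
          (R'(9 := ?v, 7 := R' 7 + 1), memory n (g k))"
        using I C unfolding heavy_step_def sem.simps fst_conv snd_conv
        by (simp only: e9 ev_both[OF eA(1,2)] ev_both[OF eA(3,4)] e7) (simp add: e7[simplified])
      also have "\<dots> = (?R, memory n (g (Suc k)))"
        using bop eP gT[OF True] True by (auto split: option.splits)
      finally show ?thesis .
    next
      case False
      then show ?thesis
        using I C gF unfolding heavy_step_def sem.simps fst_conv snd_conv
        by (simp only: e9 ev_both[OF eA(1,2)] ev_both[OF eA(3,4)] e7) auto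
    qed
    then show "ok (heavy_step opt) R' f' 200
        (\<lambda>R' f'. f' = g (k + 1) \<and> (R'(5 := k + 1)) 7 = R 7 + c (k + 1) \<and> (\<forall>r. r \<notin> {5, 7, 9} \<longrightarrow> (R'(5 := k + 1)) r = R r))"
      using I cS by (intro ok_loop_free[where R' = ?R and f' = "g (Suc k)"])
        (auto simp: heavy_step_def split: option.split)
  next
    fix k R' f'
    assume k: "k \<le> ?N" and I: "f' = g k \<and> R' 7 = R 7 + c k \<and> (\<forall>r. r \<notin> {5, 7, 9} \<longrightarrow> R' r = R r)" and R5: "R' 5 = k"
    have R': "R' 0 = n" using I regs by auto
    have [simp]: "g k 10 0 0 = ?N" using bop unfolding g_def add_table_def by auto
    show "ev R' f' (At 10 zero zero) = ?N" using I R' regs n_pos bdW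
      by (simp add: evs W_small)
  next
    show "?N \<le> PB" using len PB_bounds by simp
    show "f = g 0 \<and> (R(5 := 0)) 7 = R 7 + c 0 \<and> (\<forall>r. r \<notin> {5, 7, 9} \<longrightarrow> (R(5 := 0)) r = R r)"
      using bop by (auto simp: g_def c_def add_table_def fun_eq_iff)
    show "5 \<notin> written (heavy_step opt)" by (auto simp: heavy_step_def split: option.splits)
  qed
  show ?thesis unfolding heavy_def
    by (rule ok_mono[OF loop]) (auto simp: g_def c_def)
qed

text \<open>Counting down one at a time agrees with subtracting the cardinality at the end, even
  with truncated subtraction; this keeps the loop invariant free of side conditions.\<close>

lemma ok_tri_end:
  assumes bop: "bop = Add \<or> bop = Sub"
    and regs: "w \<notin> {0, 5, 6, 7, 8}" "x \<notin> {0, 5, 6, 7, 8}" "R 0 = n" "R w < n" "R x < n" "R 7 \<le> n"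
    and b: "bounded f" and len: "f 4 (R w) 0 \<le> n"
    and inj: "inj_on (f 3 (R w)) {..<f 4 (R w) 0}"
    and s: "slots f (R w) \<subseteq> {..<n}"
    and A: "\<And>p q. f 0 p q = of_bool (A p q)"
  shows "ok (tri_end bop w x) R f (300 * (f 4 (R w) 0 + 1)) (\<lambda>R' f'. f' = upd f 7 (R w) 0
    (apply_bin bop (f 7 (R w) 0)
      (R 7 - (if f 2 (R w) (R x) \<noteq> 0 then card {y \<in> slots f (R w). A (R w) y \<and> A (R x) y} else 0))))"
    (is "ok _ _ _ _ ?Q")
proof -
  let ?w = "R w" and ?x = "R x"
  let ?N = "f 4 ?w 0"
  have bd: "f j p q \<le> 10 * PB" for j p q using b unfolding bounded_def by blast
  have bdW: "f j p q < W" "Suc (f j p q) < W" for j p q using bd leW by blast+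
  have rW: "?w < W" "?x < W" "?w \<le> PB" "?x \<le> PB" using regs leW by auto
  define c where "c k = card {y \<in> f 3 ?w ` {..<k}. A ?w y \<and> A ?x y}" for k :: nat
  define R8 where "R8 = R(8 := R 7)"
  have R8: "R8 0 = n" "R8 w = ?w" "R8 x = ?x" "R8 8 = R 7" unfolding R8_def using regs by auto
  have loop: "ok (For 5 (At 4 (Reg w) zero) (tri_end_step w x)) R8 f
     (10 + expr_time (At 4 (Reg w) zero) + ?N * (200 + 10 + expr_time (At 4 (Reg w) zero)))
     (\<lambda>R' f'. (f' = f \<and> R' 8 = R 7 - c ?N \<and> (\<forall>r. r \<notin> {5, 6, 8} \<longrightarrow> R' r = R r)) \<and> R' 5 = ?N)"
  proof (rule ok_For)
    fix k R' f'
    assume k: "k < ?N" and I: "f' = f \<and> R' 8 = R 7 - c k \<and> (\<forall>r. r \<notin> {5, 6, 8} \<longrightarrow> R' r = R r)" and R5: "R' 5 = k"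
    let ?y = "f 3 ?w k"
    have kn: "k < n" "k < W" using k len leW by auto
    have y: "?y < n" "?y < W" "?y \<le> PB" using s k leW unfolding slots_def by auto
    have R': "R' 0 = n" "R' w = ?w" "R' x = ?x" using I regs by auto
    have ynew: "?y \<notin> f 3 ?w ` {..<k}" using inj_on_lessThan_new[OF inj k] .
    have cS: "c (Suc k) = c k + of_bool (A ?w ?y \<and> A ?x ?y)"
    proof -
      have "{y \<in> f 3 ?w ` {..<Suc k}. A ?w y \<and> A ?x y} = (if A ?w ?y \<and> A ?x ?y
         then insert ?y {y \<in> f 3 ?w ` {..<k}. A ?w y \<and> A ?x y} else {y \<in> f 3 ?w ` {..<k}. A ?w y \<and> A ?x y})"
        by (auto simp: lessThan_Suc)
      then show ?thesis using ynew unfolding c_def by simp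
    qed
    let ?R6 = "R'(6 := ?y)"
    have e6: "ev R' f (At 3 (Reg w) (Reg 5)) = ?y"
      using R' R5 kn bdW rW by (simp add: evs)
    have eA: "ev ?R6 f (At 0 (Reg w) (Reg 6)) = of_bool (A ?w ?y)"
        "ev ?R6 f (At 0 (Reg x) (Reg 6)) = of_bool (A ?x ?y)"
      using R' y rW W_small regs A by (simp_all add: evs)
    have "R 7 < W" using regs leW by auto
    then have "R' 8 < W" using I by (auto intro: le_less_trans)
    then have e8: "ev ?R6 f (Bin Sub (Reg 8) one) = R' 8 - 1"
      using I W_small by (simp add: evs)
    let ?R = "if A ?w ?y \<and> A ?x ?y then ?R6(8 := R' 8 - 1) else ?R6"
    have "sem W \<epsilon> G (tri_end_step w x) (R', memory n f') = (?R, memory n f)"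
      using I unfolding tri_end_step_def sem.simps fst_conv snd_conv
      by (simp only: e6 ev_both[OF eA] e8) auto
    then show "ok (tri_end_step w x) R' f' 200
        (\<lambda>R' f'. f' = f \<and> (R'(5 := k + 1)) 8 = R 7 - c (k + 1) \<and> (\<forall>r. r \<notin> {5, 6, 8} \<longrightarrow> (R'(5 := k + 1)) r = R r))"
      using I cS by (intro ok_loop_free[where R' = ?R and f' = f]) (auto simp: tri_end_step_def)
  next
    fix k R' f'
    assume k: "k \<le> ?N" and I: "f' = f \<and> R' 8 = R 7 - c k \<and> (\<forall>r. r \<notin> {5, 6, 8} \<longrightarrow> R' r = R r)" and R5: "R' 5 = k"
    have R': "R' 0 = n" "R' w = ?w" "R' x = ?x" using I regs by auto
    show "ev R' f' (At 4 (Reg w) zero) = ?N" using I R' rW regs n_pos bdW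
      by (simp add: evs W_small)
  qed (use len PB_bounds in \<open>auto simp: tri_end_step_def c_def R8_def\<close>)
  have eb: "ev R8 f (At 2 (Reg w) (Reg x)) = f 2 ?w ?x" using R8 regs rW bdW by (simp add: evs)
  let ?c = "if f 2 ?w ?x \<noteq> 0 then card {y \<in> slots f ?w. A ?w y \<and> A ?x y} else 0"
  have mid: "ok (If (At 2 (Reg w) (Reg x)) (For 5 (At 4 (Reg w) zero) (tri_end_step w x)) Skip) R8 f
     (1 + expr_time (At 2 (Reg w) (Reg x)) +
     (10 + expr_time (At 4 (Reg w) zero) + ?N * (200 + 10 + expr_time (At 4 (Reg w) zero))))
     (\<lambda>R' f'. f' = f \<and> R' 8 = R 7 - ?c \<and> (\<forall>r. r \<notin> {5, 6, 8} \<longrightarrow> R' r = R r))"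
  proof (rule ok_If)
    assume e: "ev R8 f (At 2 (Reg w) (Reg x)) \<noteq> 0"
    show "ok (For 5 (At 4 (Reg w) zero) (tri_end_step w x)) R8 f
       (10 + expr_time (At 4 (Reg w) zero) + ?N * (200 + 10 + expr_time (At 4 (Reg w) zero)))
       (\<lambda>R' f'. f' = f \<and> R' 8 = R 7 - ?c \<and> (\<forall>r. r \<notin> {5, 6, 8} \<longrightarrow> R' r = R r))"
      by (intro ok_mono[OF loop]) (use e in \<open>auto simp: eb c_def slots_def\<close>)
  next
    assume e: "ev R8 f (At 2 (Reg w) (Reg x)) = 0"
    then show "ok Skip R8 f (10 + expr_time (At 4 (Reg w) zero) + ?N * (200 + 10 + expr_time (At 4 (Reg w) zero)))
      (\<lambda>R' f'. f' = f \<and> R' 8 = R 7 - ?c \<and> (\<forall>r. r \<notin> {5, 6, 8} \<longrightarrow> R' r = R r))"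
      unfolding eb
      by (intro ok_loop_free) (auto simp: R8_def)
  qed
  have "R 7 < W" using regs leW by auto
  then have first: "ok (Assign 8 (Reg 7)) R f 10 (\<lambda>R' f'. R' = R8 \<and> f' = f)"
    by (intro ok_loop_free[where f' = f and R' = R8]) (auto simp: R8_def evs)
  have last: "ok (Put 7 (Reg w) zero (Bin bop (At 7 (Reg w) zero) (Reg 8))) R' f 40 ?Q"
    if "R' 8 = R 7 - ?c \<and> (\<forall>r. r \<notin> {5, 6, 8} \<longrightarrow> R' r = R r)" for R'
  proof -
    have R': "R' 0 = n" "R' w = ?w" "R' 8 = R 7 - ?c" using that regs by auto
    have le: "R' 8 \<le> n" "f 7 ?w 0 + R' 8 < W" "R' 8 < W"
      using that regs bd[of 7 ?w 0] PB_bounds by auto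
    show ?thesis
      by (intro ok_loop_free[where R' = R' and f' = "upd f 7 ?w 0 (apply_bin bop (f 7 ?w 0) (R' 8))"])
        (use R' le rW n_pos bdW W_small bop in \<open>auto simp: evs simp del: R'(3)\<close>)
  qed
  have "ok (tri_end bop w x) R f (10 + ((1 + expr_time (At 2 (Reg w) (Reg x)) +
     (10 + expr_time (At 4 (Reg w) zero) + ?N * (200 + 10 + expr_time (At 4 (Reg w) zero)))) + 40)) ?Q"
    unfolding tri_end_def
    by (rule ok_Seq[OF first], rule ok_Seq[where ?Q1.0 = "\<lambda>R' f'. f' = f \<and> R' 8 = R 7 - ?c \<and> (\<forall>r. r \<notin> {5, 6, 8} \<longrightarrow> R' r = R r)"])
      (use mid last in auto)
  then show ?thesis by (rule ok_mono) auto
qed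

end

section \<open>Inserting and deleting an edge\<close>

definition counts_prog :: "bool \<Rightarrow> binop \<Rightarrow> com" where
  "counts_prog vq bop = Seq (if vq then tri_prog bop else Skip) (Seq (codeg_prog bop 1 2) (codeg_prog bop 2 1))"

definition slot_prog :: "nat \<Rightarrow> nat \<Rightarrow> com" where
  "slot_prog w x = If (At 2 (Reg w) (Reg x)) Skip
     (If (Bin Less (At 12 zero zero) (At 4 (Reg w) zero))
       (If (At 6 (Reg w) zero) Skip
         (Seq (Put 5 (At 10 zero zero) zero (Reg w))
           (Seq (Put 10 zero zero (Bin Add (At 10 zero zero) one)) (Put 6 (Reg w) zero one))))
       (Seq (Put 3 (Reg w) (At 4 (Reg w) zero) (Reg x))
         (Seq (Put 2 (Reg w) (Reg x) one) (Put 4 (Reg w) zero (Bin Add (At 4 (Reg w) zero) one)))))"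

definition slot_result :: "tables \<Rightarrow> nat \<Rightarrow> nat \<Rightarrow> tables" where
  "slot_result f w x =
    (if f 2 w x \<noteq> 0 then f
     else if f 12 0 0 < f 4 w 0 then
       (if f 6 w 0 \<noteq> 0 then f else upd (upd (upd f 5 (f 10 0 0) 0 w) 10 0 0 (f 10 0 0 + 1)) 6 w 0 1)
     else upd (upd (upd f 3 w (f 4 w 0) x) 2 w x 1) 4 w 0 (f 4 w 0 + 1))"

definition log_prog :: com where
  "log_prog = Seq (Put 8 (At 11 zero zero) zero (Reg 1))
     (Seq (Put 9 (At 11 zero zero) zero (Reg 2)) (Put 11 zero zero (Bin Add (At 11 zero zero) one)))"

text \<open>\<open>Adj\<close> shows the graph after the update, whereas counting for an insertion
  looks at the graph without the edge, and rebuilding passes through graphs with part of the edges;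
  hence an adjacency table of its own.\<close>

definition adj_prog :: "expr \<Rightarrow> com" where
  "adj_prog e = Seq (Put 0 (Reg 1) (Reg 2) e) (Put 0 (Reg 2) (Reg 1) e)"

text \<open>Slots come before counting, so that the contribution of the edge is computed with the
  slots that a later deletion finds. The adjacency bit is set last here and cleared first in
  \<open>del_edge\<close>; counting always sees the graph without the edge.\<close>

definition add_edge :: "bool \<Rightarrow> com" where
  "add_edge vq = Seq (Seq (slot_prog 1 2) (slot_prog 2 1)) (Seq log_prog (Seq (counts_prog vq Add) (adj_prog one)))"

definition del_edge :: "bool \<Rightarrow> com" where
  "del_edge vq = Seq (adj_prog zero) (counts_prog vq Sub)"

lemma written_simps [simp]:
  "written (codeg_prog bop w x) = {5, 6}" "written (heavy_prog opt) = {5, 7, 9}"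
  "written (tri_end bop w x) = {5, 6, 8}" "written (tri_prog bop) = {5, 6, 7, 8, 9}"
  "written (slot_prog w x) = {}" "written log_prog = {}" "written (adj_prog e) = {}"
  by (auto simp: codeg_prog_def codeg_step_def heavy_prog_def heavy_step_def tri_end_def tri_end_step_def
      tri_prog_def slot_prog_def log_prog_def adj_prog_def split: option.splits)

lemma written_counts: "written (counts_prog vq bop) \<subseteq> {5, 6, 7, 8, 9}"
  "written (add_edge vq) \<subseteq> {5, 6, 7, 8, 9}" "written (del_edge vq) \<subseteq> {5, 6, 7, 8, 9}"
  by (auto simp: counts_prog_def add_edge_def del_edge_def)

lemma slots_invD:
  assumes "slots_inv n cap f"
  shows "\<And>w x. f 2 w x = of_bool (x \<in> slots f w)" "\<And>w. inj_on (f 3 w) {..<f 4 w 0}"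
    "\<And>w i. f 3 w i \<noteq> 0 \<Longrightarrow> i < f 4 w 0" "\<And>w. f 4 w 0 \<le> cap"
    "\<And>w. slots f w \<subseteq> {..<n} - {w}" "\<And>w. f 4 w 0 \<noteq> 0 \<Longrightarrow> w < n"
    "inj_on (\<lambda>i. f 5 i 0) {..<f 10 0 0}" "\<And>i. f 5 i 0 \<noteq> 0 \<Longrightarrow> i < f 10 0 0"
    "heavy f \<subseteq> {..<n}" "\<And>w. f 6 w 0 = of_bool (w \<in> heavy f)"
    "\<And>w. w \<in> heavy f \<Longrightarrow> f 4 w 0 = cap" "cap = Suc (f 12 0 0)"
  using assms unfolding slots_inv_def by blast+

lemma slots_inv_card:
  assumes "slots_inv n cap f"
  shows "card (slots f w) = f 4 w 0" "card (heavy f) = f 10 0 0" "f 4 w 0 \<le> n" "f 10 0 0 \<le> n"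
proof -
  show *: "card (slots f w) = f 4 w 0" "card (heavy f) = f 10 0 0"
    unfolding slots_def heavy_def using slots_invD(2,7)[OF assms] by (simp_all add: card_image)
  have "card (slots f w) \<le> card {..<n}"
    by (rule card_mono) (use slots_invD(5)[OF assms, of w] in auto)
  then show "f 4 w 0 \<le> n" using * by simp
  have "card (heavy f) \<le> card {..<n}"
    by (rule card_mono) (use slots_invD(9)[OF assms] in auto)
  then show "f 10 0 0 \<le> n" using * by simp
qed

text \<open>The next slot is a column index of table 3 and has to be below \<open>n\<close>. It is,
  because \<open>x\<close> is a vertex still missing from the slots.\<close>

lemma slots_inv_room:
  assumes "slots_inv n cap f" "x < n" "x \<noteq> w" "x \<notin> slots f w"
  shows "f 4 w 0 < n"
proof -
  have "slots f w \<subset> {..<n}" using slots_invD(5)[OF assms(1), of w] assms by auto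
  then have "card (slots f w) < card {..<n}" by (intro psubset_card_mono) auto
  then show ?thesis using slots_inv_card[OF assms(1)] by simp
qed

lemma codeg_le: "codeg n E S p q \<le> n"
proof -
  have "card {w. w < n \<and> P w} \<le> n" for P
    using card_mono[of "{..<n}" "{w. w < n \<and> P w}"] by auto
  then show ?thesis unfolding codeg_def by simp
qed

lemma finite_card_common:
  assumes "edge_set n E"
  shows "finite {z. {a, z} \<in> E \<and> P z}" "card {z. {a, z} \<in> E \<and> P z} \<le> n"
proof -
  have sub: "{z. {a, z} \<in> E \<and> P z} \<subseteq> {..<n}" using edge_setD[OF assms] by auto
  then show "finite {z. {a, z} \<in> E \<and> P z}" by (rule finite_subset) simp
  show "card {z. {a, z} \<in> E \<and> P z} \<le> n" using card_mono[OF _ sub] by simp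
qed

text \<open>Connects \<open>tri_diff\<close> with the subtraction made by \<open>tri_end\<close>: a
  pair \<open>b\<close>, \<open>z\<close> can lie within the slots only if \<open>b\<close>
  does.\<close>

lemma card_common_diff:
  assumes "edge_set n E"
  shows "card {z. {a, z} \<in> E \<and> {b, z} \<in> E \<and> \<not> (b \<in> S \<and> z \<in> S)} =
    card {z. {a, z} \<in> E \<and> {b, z} \<in> E} - (if b \<in> S then card {z \<in> S. {a, z} \<in> E \<and> {b, z} \<in> E} else 0)"
proof (cases "b \<in> S")
  case True
  have "{z. {a, z} \<in> E \<and> {b, z} \<in> E \<and> \<not> (b \<in> S \<and> z \<in> S)} =
    {z. {a, z} \<in> E \<and> {b, z} \<in> E} - {z \<in> S. {a, z} \<in> E \<and> {b, z} \<in> E}" using True by auto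
  moreover have "{z \<in> S. {a, z} \<in> E \<and> {b, z} \<in> E} \<subseteq> {z. {a, z} \<in> E \<and> {b, z} \<in> E}" by auto
  moreover have "finite {z. {a, z} \<in> E \<and> {b, z} \<in> E}" using finite_card_common(1)[OF assms] .
  ultimately show ?thesis using True by (simp add: card_Diff_subset finite_subset)
qed simp

section \<open>Updating the counts for one edge\<close>

context ram
begin

definition small :: "tables \<Rightarrow> bool" where
  "small f \<longleftrightarrow> (\<forall>j p q. f j p q \<le> PB)"

lemma small_bounded: assumes "small f" shows "bounded f"
  unfolding bounded_def
proof (intro allI)
  fix j p q
  show "f j p q \<le> 10 * PB" using assms[unfolded small_def, rule_format, of j p q] by linarith
qed

lemma ok_tri_prog:
  assumes bop: "bop = Add \<or> bop = Sub"
    and regs: "R 0 = n" "R 1 = a" "R 2 = b" and ab: "a < n" "b < n" "a \<noteq> b" "{a, b} \<notin> E"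
    and E: "edge_set n E" and b: "small f" and S: "slots_inv n cap f"
    and A: "\<And>p q. f 0 p q = of_bool ({p, q} \<in> E)"
    and C: "f 16 a b = codeg n E (slots f) a b"
    and cov: "\<And>w x. {w, x} \<in> E \<Longrightarrow> x \<in> slots f w \<or> w \<in> heavy f"
  shows "ok (tri_prog bop) R f (1000 * (cap + f 10 0 0 + 1))
    (\<lambda>R' f'. f' = add_table bop f 7 (\<lambda>v q. if q = 0 then tri_diff E (slots f) a b v else 0))"
proof -
  note SD = slots_invD[OF S] and card = slots_inv_card[OF S]
  define Cn where "Cn v \<longleftrightarrow> {v, a} \<in> E \<and> {v, b} \<in> E \<and> \<not> (a \<in> slots f v \<and> b \<in> slots f v)" for v
  define q where "q = card {z. {a, z} \<in> E \<and> {b, z} \<in> E}"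
  have qn: "q \<le> n" unfolding q_def by (rule finite_card_common[OF E])
  \<comment> \<open>The full codegree, obtained without scanning a neighbourhood.\<close>
  have qeq: "q = codeg n E (slots f) a b + card {v \<in> heavy f. Cn v}"
    unfolding q_def Cn_def by (rule card_codeg_split[OF E ab(3) cov])
  define f1 where "f1 = add_table bop f 7 (\<lambda>v q. of_bool (q = 0 \<and> v \<in> heavy f \<and> Cn v))"
  define ca where "ca = card {z. {a, z} \<in> E \<and> {b, z} \<in> E \<and> \<not> (b \<in> slots f a \<and> z \<in> slots f a)}"
  define cb where "cb = card {z. {b, z} \<in> E \<and> {a, z} \<in> E \<and> \<not> (a \<in> slots f b \<and> z \<in> slots f b)}"
  define f2 where "f2 = upd f1 7 a 0 (apply_bin bop (f1 7 a 0) ca)"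
  define f3 where "f3 = upd f2 7 b 0 (apply_bin bop (f2 7 b 0) cb)"
  have le: "ca \<le> n" "cb \<le> n" unfolding ca_def cb_def by (rule finite_card_common[OF E])+
  have bd: "f j p q \<le> PB" for j p q using b unfolding small_def by blast
  have ap: "apply_bin bop x y \<le> x + y" for x y using bop by auto
  have f1b: "f1 j p q \<le> PB + 1" for j p q
  proof (cases "j = 7")
    case True
    then have "f1 j p q \<le> f 7 p q + of_bool (q = 0 \<and> p \<in> heavy f \<and> Cn p)"
      unfolding f1_def add_table_def using ap by simp
    also have "\<dots> \<le> PB + 1" by (intro add_mono bd) simp
    finally show ?thesis .
  next
    case False
    then show ?thesis using bd[of j p q] unfolding f1_def add_table_def by simp
  qed
  have f2b: "f2 j p q \<le> 2 * PB + 1" for j p q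
    using f1b[of j p q] ap[of "f1 7 a 0" ca] f1b[of 7 a 0] le PB_bounds
    unfolding f2_def upd_apply by auto
  have b1: "bounded f1" unfolding bounded_def
  proof (intro allI)
    fix j p q show "f1 j p q \<le> 10 * PB" using f1b[of j p q] PB_bounds by linarith
  qed
  have b2: "bounded f2" unfolding bounded_def
  proof (intro allI)
    fix j p q show "f2 j p q \<le> 10 * PB" using f2b[of j p q] PB_bounds by linarith
  qed
  have same: "f1 j = f j" "f2 j = f j" if "j \<noteq> 7" for j
    using that unfolding f2_def f1_def add_table_def by (auto simp: fun_eq_iff upd_apply)
  have sl: "slots f1 = slots f" "slots f2 = slots f"
    unfolding slots_def using same by auto
  have W: "a < W" "b < W" "a \<le> PB" "b \<le> PB" "f 16 a b < W" using ab leW C codeg_le[of n E "slots f" a b] by auto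
  have s1: "ok (Assign 7 (At 16 (Reg 1) (Reg 2))) R f 20 (\<lambda>R' f'. R' = R(7 := codeg n E (slots f) a b) \<and> f' = f)"
    by (rule ok_loop_free[where R' = "R(7 := codeg n E (slots f) a b)" and f' = f])
      (use W ab C regs in \<open>auto simp: evs\<close>)
  have s2: "ok (heavy_prog (Some bop)) (R(7 := codeg n E (slots f) a b)) f (300 * (f 10 0 0 + 1))
    (\<lambda>R' f'. f' = f1 \<and> R' 7 = q)"
    by (rule ok_mono[OF ok_heavy_prog[where A = "\<lambda>p q. {p, q} \<in> E" and B = "\<lambda>w x. x \<in> slots f w" and C = Cn]])
      (use bop regs ab small_bounded[OF b] SD card A codeg_le[of n E "slots f" a b] in
        \<open>auto simp: Cn_def f1_def qeq\<close>)
  have s3: "ok (tri_end bop 1 2) R' f1 (300 * (cap + 1)) (\<lambda>R' f'. f' = f2)"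
    if "R' 7 = q" "R' 0 = n" "R' 1 = a" "R' 2 = b" for R'
  proof (rule ok_mono[OF ok_tri_end[where A = "\<lambda>p q. {p, q} \<in> E"]])
    show "slots f1 (R' 1) \<subseteq> {..<n}" using SD(5)[of a] that sl by auto
    have ca: "q - (if b \<in> slots f a then card {y \<in> slots f a. {a, y} \<in> E \<and> {b, y} \<in> E} else 0) = ca"
      unfolding ca_def q_def card_common_diff[OF E] ..
    fix R'' f'
    assume "f' = upd f1 7 (R' 1) 0 (apply_bin bop (f1 7 (R' 1) 0) (R' 7 -
       (if f1 2 (R' 1) (R' 2) \<noteq> 0 then card {y \<in> slots f1 (R' 1). {R' 1, y} \<in> E \<and> {R' 2, y} \<in> E} else 0)))"
    then show "f' = f2" unfolding f2_def ca[symmetric] using that SD(1)[of a b] by (simp add: sl same)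
  qed (use that ab qn b1 same SD(2,4)[of a] card A bop in auto)
  have s4: "ok (tri_end bop 2 1) R' f2 (300 * (cap + 1)) (\<lambda>R' f'. f' = f3)"
    if "R' 7 = q" "R' 0 = n" "R' 1 = a" "R' 2 = b" for R'
  proof (rule ok_mono[OF ok_tri_end[where A = "\<lambda>p q. {p, q} \<in> E"]])
    show "slots f2 (R' 2) \<subseteq> {..<n}" using SD(5)[of b] that sl by auto
    have q': "q = card {z. {b, z} \<in> E \<and> {a, z} \<in> E}" unfolding q_def by (simp add: conj_commute)
    have cb: "q - (if a \<in> slots f b then card {y \<in> slots f b. {b, y} \<in> E \<and> {a, y} \<in> E} else 0) = cb"
      unfolding cb_def q' card_common_diff[OF E] ..
    fix R'' f'
    assume "f' = upd f2 7 (R' 2) 0 (apply_bin bop (f2 7 (R' 2) 0) (R' 7 -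
       (if f2 2 (R' 2) (R' 1) \<noteq> 0 then card {y \<in> slots f2 (R' 2). {R' 2, y} \<in> E \<and> {R' 1, y} \<in> E} else 0)))"
    then show "f' = f3" unfolding f3_def cb[symmetric] using that SD(1)[of b a] by (simp add: sl same)
  qed (use that ab qn b2 same SD(2,4)[of b] card A bop in auto)
  have "ok (tri_prog bop) R f (20 + (300 * (f 10 0 0 + 1) + (300 * (cap + 1) + 300 * (cap + 1)))) (\<lambda>R' f'. f' = f3)"
    unfolding tri_prog_def
  proof (rule ok_Seq[OF s1], elim conjE, hypsubst, rule ok_Seq[OF s2], elim conjE, hypsubst)
    fix R'
    assume R': "\<And>r. r \<notin> written (heavy_prog (Some bop)) \<Longrightarrow> R' r = (R(7 := codeg n E (slots f) a b)) r"
      and q: "q = R' 7"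
    have R'': "R' 7 = q" "R' 0 = n" "R' 1 = a" "R' 2 = b" using R' q regs by auto
    show "ok (Seq (tri_end bop 1 2) (tri_end bop 2 1)) R' f1 (300 * (cap + 1) + 300 * (cap + 1)) (\<lambda>R' f'. f' = f3)"
      by (rule ok_Seq[OF s3[OF R'']], hypsubst, rule s4) (use R'' in auto)
  qed
  moreover have "f3 = add_table bop f 7 (\<lambda>v q. if q = 0 then tri_diff E (slots f) a b v else 0)"
  proof (intro ext)
    fix j p q
    \<comment> \<open>The scan leaves the counts of the end points alone; these are handled by
      \<open>tri_end\<close>.\<close>
    have "\<not> Cn a" "\<not> Cn b" using edge_set_singleton[OF E] unfolding Cn_def by auto
    \<comment> \<open>Away from the end points only such a \<open>p\<close> changes its count, so
      the scan of the heavy vertices reaches all of them.\<close>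
    moreover have "p \<in> heavy f" if "Cn p" using that cov unfolding Cn_def by blast
    ultimately show "f3 j p q = add_table bop f 7 (\<lambda>v q. if q = 0 then tri_diff E (slots f) a b v else 0) j p q"
      using ab(3) apply_bin_add[OF bop]
      unfolding f3_def f2_def f1_def add_table_def upd_apply tri_diff_def ca_def[symmetric] cb_def[symmetric]
        Cn_def[symmetric] by auto
  qed
  ultimately show ?thesis by (elim ok_mono) auto
qed

lemma ok_counts_prog:
  assumes bop: "bop = Add \<or> bop = Sub"
    and regs: "R 0 = n" "R 1 = a" "R 2 = b" and ab: "a < n" "b < n" "a \<noteq> b" "{a, b} \<notin> E"
    and E: "edge_set n E" and b: "small f" and S: "slots_inv n cap f"
    and A: "\<And>p q. f 0 p q = of_bool ({p, q} \<in> E)"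
    and C: "f 16 a b = codeg n E (slots f) a b"
    and cov: "\<And>w x. {w, x} \<in> E \<Longrightarrow> x \<in> slots f w \<or> w \<in> heavy f"
  shows "ok (counts_prog vq bop) R f (2000 * (cap + (if vq then f 10 0 0 else 0) + 1))
    (\<lambda>R' f'. f' = (\<lambda>j p q.
      if j = 16 then apply_bin bop (f 16 p q) (codeg_diff E (slots f) a b p q + codeg_diff E (slots f) b a p q)
      else if j = 7 \<and> q = 0 \<and> vq then apply_bin bop (f 7 p q) (tri_diff E (slots f) a b p) else f j p q))"
proof -
  note SD = slots_invD[OF S] and card = slots_inv_card[OF S]
  define f1 where "f1 = (if vq then add_table bop f 7 (\<lambda>v q. if q = 0 then tri_diff E (slots f) a b v else 0) else f)"
  define f2 where "f2 = add_table bop f1 16 (codeg_diff E (slots f) a b)"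
  define f3 where "f3 = add_table bop f2 16 (codeg_diff E (slots f) b a)"
  have bd: "f j p q \<le> PB" for j p q using b unfolding small_def by blast
  have ap: "apply_bin bop x y \<le> x + y" for x y using bop by auto
  have td: "tri_diff E (slots f) a b v \<le> PB" for v
  proof -
    have c: "card {z. {x, z} \<in> E \<and> P z} \<le> PB" for x P
      by (rule order_trans[OF finite_card_common(2)[OF E] PB_bounds(1)])
    consider "v = a" | "v \<noteq> a" "v = b" | "v \<noteq> a" "v \<noteq> b" by blast
    then show ?thesis
    proof cases
      case 1
      then show ?thesis unfolding tri_diff_def if_P[OF 1] by (intro c)
    next
      case 2
      show ?thesis unfolding tri_diff_def if_not_P[OF 2(1)] if_P[OF 2(2)] by (rule c)
    next
      case 3
      then show ?thesis unfolding tri_diff_def using PB_bounds by simp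
    qed
  qed
  have f1b: "f1 j p q \<le> 2 * PB" for j p q
  proof (cases "vq \<and> j = 7")
    case True
    then have "f1 j p q \<le> f 7 p q + (if q = 0 then tri_diff E (slots f) a b p else 0)"
      unfolding f1_def add_table_def using ap by simp
    also have "\<dots> \<le> PB + PB" by (intro add_mono bd) (use td in auto)
    finally show ?thesis by simp
  next
    case False
    then show ?thesis using bd[of j p q] unfolding f1_def add_table_def by auto
  qed
  have f2b: "f2 j p q \<le> 2 * PB + 1" for j p q
  proof (cases "j = 16")
    case True
    then have "f2 j p q \<le> f1 16 p q + codeg_diff E (slots f) a b p q"
      unfolding f2_def add_table_def using ap by simp
    also have "\<dots> \<le> 2 * PB + 1" by (intro add_mono f1b) (auto simp: codeg_diff_def)
    finally show ?thesis by simp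
  next
    case False
    then show ?thesis using f1b[of j p q] unfolding f2_def add_table_def by auto
  qed
  have b1: "bounded f1" unfolding bounded_def
  proof (intro allI)
    fix j p q show "f1 j p q \<le> 10 * PB" using f1b[of j p q] PB_bounds by linarith
  qed
  have b2: "bounded f2" unfolding bounded_def
  proof (intro allI)
    fix j p q show "f2 j p q \<le> 10 * PB" using f2b[of j p q] PB_bounds by linarith
  qed
  have same: "f1 j = f j" "f2 j = f j" if "j \<noteq> 7" "j \<noteq> 16" for j
    using that unfolding f2_def f1_def add_table_def by (auto simp: fun_eq_iff upd_apply)
  have sl: "slots f1 = slots f" "slots f2 = slots f"
    unfolding slots_def using same by auto
  have ba: "{b, a} \<notin> E" using ab by (simp add: insert_commute)
  have sub: "x < n" if "x \<in> slots f w" for w x using that SD(5)[of w] by auto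
  have s1: "ok (if vq then tri_prog bop else Skip) R f (1000 * (cap + (if vq then f 10 0 0 else 0) + 1)) (\<lambda>R' f'. f' = f1)"
  proof (cases vq)
    case True
    then show ?thesis using ok_tri_prog[OF assms] unfolding f1_def by simp
  next
    case False
    then show ?thesis unfolding f1_def by (auto intro: ok_loop_free)
  qed
  have s2: "ok (codeg_prog bop 1 2) R' f1 (300 * (cap + 1)) (\<lambda>R' f'. f' = f2)"
    if "R' 0 = n" "R' 1 = a" "R' 2 = b" for R'
    by (rule ok_mono[OF ok_codeg_prog])
      (use that ab b1 bop SD(1,2,4) sub card(3) A in \<open>auto simp: sl same f2_def codeg_diff_def add_table_def fun_eq_iff\<close>)
  have s3: "ok (codeg_prog bop 2 1) R' f2 (300 * (cap + 1)) (\<lambda>R' f'. f' = f3)"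
    if "R' 0 = n" "R' 1 = a" "R' 2 = b" for R'
    by (rule ok_mono[OF ok_codeg_prog])
      (use that ab ba b2 bop SD(1,2,4) sub card(3) A in \<open>auto simp: sl same f3_def codeg_diff_def add_table_def fun_eq_iff\<close>)
  have "ok (counts_prog vq bop) R f
     (1000 * (cap + (if vq then f 10 0 0 else 0) + 1) + (300 * (cap + 1) + 300 * (cap + 1))) (\<lambda>R' f'. f' = f3)"
    unfolding counts_prog_def
  proof (rule ok_Seq[OF s1], hypsubst)
    fix R' assume R': "\<And>r. r \<notin> written (if vq then tri_prog bop else Skip) \<Longrightarrow> R' r = R r"
    have R'': "R' 0 = n" "R' 1 = a" "R' 2 = b" using R' regs by (auto split: if_splits)
    show "ok (Seq (codeg_prog bop 1 2) (codeg_prog bop 2 1)) R' f1 (300 * (cap + 1) + 300 * (cap + 1)) (\<lambda>R' f'. f' = f3)"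
      by (rule ok_Seq[OF s2[OF R'']], hypsubst, rule s3) (use R'' in auto)
  qed
  moreover have "f3 = (\<lambda>j p q.
      if j = 16 then apply_bin bop (f 16 p q) (codeg_diff E (slots f) a b p q + codeg_diff E (slots f) b a p q)
      else if j = 7 \<and> q = 0 \<and> vq then apply_bin bop (f 7 p q) (tri_diff E (slots f) a b p) else f j p q)"
    unfolding f3_def f2_def f1_def add_table_def using apply_bin_add[OF bop] by (auto simp: fun_eq_iff)
  ultimately show ?thesis by (elim ok_mono) auto
qed

lemma ok_adj_prog:
  assumes regs: "R 0 = n" "R 1 = a" "R 2 = b" and ab: "a < n" "b < n" "a \<noteq> b" and v: "v \<le> 1"
  shows "ok (adj_prog (Num v)) R f 100
     (\<lambda>R' f'. f' = (\<lambda>j p q. if j = 0 \<and> {p, q} = {a, b} then v else f j p q))"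
proof (rule ok_loop_free[where R' = R and f' = "upd (upd f 0 a b v) 0 b a v"])
  have W: "a < W" "b < W" "a \<le> PB" "b \<le> PB" "v < W" using ab leW v W_small by auto
  then show "sem W \<epsilon> G (adj_prog (Num v)) (R, memory n f) = (R, memory n (upd (upd f 0 a b v) 0 b a v))"
    unfolding adj_prog_def using regs ab by (simp add: evs)
  show "upd (upd f 0 a b v) 0 b a v = (\<lambda>j p q. if j = 0 \<and> {p, q} = {a, b} then v else f j p q)"
    by (auto simp: fun_eq_iff upd_apply doubleton_eq_iff)
qed (auto simp: adj_prog_def)

lemma ok_log_prog:
  assumes regs: "R 0 = n" "R 1 = a" "R 2 = b" and ab: "a < n" "b < n" and v: "f 11 0 0 \<le> PB"
  shows "ok log_prog R f 200
     (\<lambda>R' f'. f' = upd (upd (upd f 8 (f 11 0 0) 0 a) 9 (f 11 0 0) 0 b) 11 0 0 (f 11 0 0 + 1))"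
proof (rule ok_loop_free[where R' = R and f' = "upd (upd (upd f 8 (f 11 0 0) 0 a) 9 (f 11 0 0) 0 b) 11 0 0 (f 11 0 0 + 1)"])
  have W: "a < W" "b < W" "a \<le> PB" "b \<le> PB" "f 11 0 0 < W" "Suc (f 11 0 0) < W" using ab leW v W_small PB_bounds by auto
  then show "sem W \<epsilon> G log_prog (R, memory n f) = (R, memory n (upd (upd (upd f 8 (f 11 0 0) 0 a) 9 (f 11 0 0) 0 b) 11 0 0 (f 11 0 0 + 1)))"
    unfolding log_prog_def using regs ab n_pos W_small v by (simp add: evs upd_apply)
qed (auto simp: log_prog_def)

lemma ok_slot_prog:
  assumes regs: "R 0 = n" "R w = a" "R x = b" and ab: "a < n" "b < n" "a \<noteq> b"
    and b: "small f" and S: "slots_inv n cap f"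
  shows "ok (slot_prog w x) R f 400 (\<lambda>R' f'. f' = slot_result f a b)"
proof (rule ok_loop_free[where R' = R and f' = "slot_result f a b"])
  note SD = slots_invD[OF S] and card = slots_inv_card[OF S]
  have bd: "f j p q \<le> PB" for j p q using b unfolding small_def by blast
  have bdW: "f j p q < W" "Suc (f j p q) < W" for j p q using bd[of j p q] PB_bounds by linarith+
  have W: "a < W" "b < W" "a \<le> PB" "b \<le> PB" using ab leW by auto
  have room: "f 4 a 0 < n" if "f 2 a b = 0" using that SD(1)[of a b] slots_inv_room[OF S ab(2), of a] ab by auto
  show "sem W \<epsilon> G (slot_prog w x) (R, memory n f) = (R, memory n (slot_result f a b))"
    unfolding slot_prog_def slot_result_def using regs ab n_pos W W_small room bd bdW
    by (simp add: evs upd_apply)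
qed (auto simp: slot_prog_def)

end

lemma written_small:
  assumes "r < 5 \<or> 9 < r"
  shows "r \<notin> written (counts_prog vq bop)" "r \<notin> written (add_edge vq)" "r \<notin> written (del_edge vq)"
proof -
  have "r \<notin> {5, 6, 7, 8, 9}" using assms by auto
  then show "r \<notin> written (counts_prog vq bop)" "r \<notin> written (add_edge vq)" "r \<notin> written (del_edge vq)"
    using written_counts by blast+
qed

lemma card_edge_set_le:
  assumes "edge_set n E"
  shows "card E \<le> n * n"
proof -
  have "E \<subseteq> (\<lambda>(u, v). {u, v}) ` ({..<n} \<times> {..<n})" using assms unfolding edge_set_def by fastforce
  then have "card E \<le> card ((\<lambda>(u, v). {u, v}) ` ({..<n} \<times> {..<n}))" by (intro card_mono) auto
  also have "\<dots> \<le> card ({..<n} \<times> {..<n})" by (rule card_image_le) auto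
  finally show ?thesis by simp
qed

lemma tri_le:
  assumes "edge_set n E"
  shows "tri E S v \<le> card E"
  unfolding tri_def using finite_edge_set[OF assms] by (intro card_mono) auto

section \<open>Preservation of the slot invariants\<close>

lemma slots_inv_cong:
  assumes "slots_inv n cap f" "\<And>j. j \<in> {2, 3, 4, 5, 6, 10, 12} \<Longrightarrow> f' j = f j"
  shows "slots_inv n cap f'" "slots f' = slots f" "heavy f' = heavy f"
proof -
  have e: "f' 2 = f 2" "f' 3 = f 3" "f' 4 = f 4" "f' 5 = f 5" "f' 6 = f 6" "f' 10 = f 10" "f' 12 = f 12"
    using assms(2) by auto
  show s: "slots f' = slots f" "heavy f' = heavy f" unfolding slots_def heavy_def e by auto
  show "slots_inv n cap f'" using assms(1) unfolding slots_inv_def s e .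
qed

lemma slots_inv_append:
  assumes S: "slots_inv n cap f" and ab: "a < n" "b < n" "a \<noteq> b"
    and c: "f 2 a b = 0" "f 4 a 0 \<le> f 12 0 0"
    and f': "f' = upd (upd (upd f 3 a (f 4 a 0) b) 2 a b 1) 4 a 0 (f 4 a 0 + 1)"
  shows "slots_inv n cap f'" "slots f' w = (if w = a then insert b (slots f a) else slots f w)" "heavy f' = heavy f"
proof -
  note SD = slots_invD[OF S]
  have tabs: "f' 3 w i = (if w = a \<and> i = f 4 a 0 then b else f 3 w i)"
    "f' 2 w i = (if w = a \<and> i = b then 1 else f 2 w i)"
    "f' 4 w 0 = (if w = a then f 4 a 0 + 1 else f 4 w 0)" "f' 5 = f 5" "f' 6 = f 6" "f' 10 = f 10" "f' 12 = f 12" for w i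
    unfolding f' by (auto simp: upd_apply fun_eq_iff)
  show sl: "slots f' w = (if w = a then insert b (slots f a) else slots f w)" for w
    unfolding slots_def using tabs by (auto simp: lessThan_Suc)
  show h: "heavy f' = heavy f" unfolding heavy_def using tabs by auto
  have b: "b \<notin> slots f a" using SD(1)[of a b] c by auto
  have "inj_on (f' 3 w) {..<f' 4 w 0}" for w
  proof (cases "w = a")
    case True
    have "f' 3 a ` {..<f 4 a 0} = slots f a" unfolding slots_def using tabs(1) by (auto intro!: image_cong)
    moreover have "inj_on (f' 3 a) {..<f 4 a 0}" using SD(2)[of a] tabs(1) by (auto simp: inj_on_def)
    ultimately have "inj_on (f' 3 a) {..<Suc (f 4 a 0)}" using b tabs(1)[of a "f 4 a 0"] by (simp add: lessThan_Suc)
    then show ?thesis using True tabs(3)[of a] by simp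
  next
    case False
    then have "f' 3 w = f 3 w" using tabs(1) by (auto simp: fun_eq_iff)
    then show ?thesis using SD(2)[of w] tabs(3) False by simp
  qed
  moreover have "f' 2 w x = of_bool (x \<in> slots f' w)" for w x using SD(1)[of w x] tabs(2) sl by auto
  moreover have "\<forall>w i. f' 3 w i \<noteq> 0 \<longrightarrow> i < f' 4 w 0"
    using SD(3) tabs(1,3) by (metis less_Suc_eq Suc_eq_plus1)
  moreover have "f' 4 w 0 \<le> cap" for w using SD(4)[of w] SD(12) c tabs(3) by auto
  moreover have "slots f' w \<subseteq> {..<n} - {w}" for w using SD(5)[of w] sl ab by auto
  moreover have "f' 4 w 0 \<noteq> 0 \<longrightarrow> w < n" for w using SD(6)[of w] tabs(3) ab by auto
  \<comment> \<open>\<open>a\<close> had a free slot, so it is not heavy.\<close>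
  moreover have "\<forall>w\<in>heavy f. f' 4 w 0 = cap" using SD(11,12) c tabs(3) by fastforce
  ultimately show "slots_inv n cap f'"
    unfolding slots_inv_def h tabs(4-7) using SD(7-10,12) by blast
qed

lemma slots_inv_heavy:
  assumes S: "slots_inv n cap f" and ab: "a < n"
    and c: "f 12 0 0 < f 4 a 0" "f 6 a 0 = 0"
    and f': "f' = upd (upd (upd f 5 (f 10 0 0) 0 a) 10 0 0 (f 10 0 0 + 1)) 6 a 0 1"
  shows "slots_inv n cap f'" "slots f' = slots f" "heavy f' = insert a (heavy f)"
proof -
  note SD = slots_invD[OF S]
  have tabs: "f' 5 i 0 = (if i = f 10 0 0 then a else f 5 i 0)"
    "f' 6 w 0 = (if w = a then 1 else f 6 w 0)"
    "f' 10 0 0 = f 10 0 0 + 1" "f' 2 = f 2" "f' 3 = f 3" "f' 4 = f 4" "f' 12 = f 12" for w i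
    unfolding f' by (auto simp: upd_apply fun_eq_iff)
  show sl: "slots f' = slots f" unfolding slots_def using tabs by auto
  show h: "heavy f' = insert a (heavy f)" unfolding heavy_def using tabs by (auto simp: lessThan_Suc)
  have na: "a \<notin> heavy f" using SD(10)[of a] c by auto
  have "(\<lambda>i. f' 5 i 0) ` {..<f 10 0 0} = heavy f" unfolding heavy_def using tabs(1) by (auto intro!: image_cong)
  moreover have "inj_on (\<lambda>i. f' 5 i 0) {..<f 10 0 0}" using SD(7) tabs(1) by (auto simp: inj_on_def)
  ultimately have "inj_on (\<lambda>i. f' 5 i 0) {..<f' 10 0 0}" using na tabs(1)[of "f 10 0 0"] tabs(3)
    by (simp add: lessThan_Suc)
  moreover have "\<forall>i. f' 5 i 0 \<noteq> 0 \<longrightarrow> i < f' 10 0 0"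
    using SD(8) tabs(1,3) by (metis less_Suc_eq Suc_eq_plus1)
  moreover have "heavy f' \<subseteq> {..<n}" using h SD(9) ab by auto
  moreover have "f' 6 w 0 = of_bool (w \<in> heavy f')" for w using SD(10)[of w] tabs(2) h by auto
  \<comment> \<open>The new heavy vertex is full: \<open>c\<close> bounds its length from below and
    \<open>cap\<close> from above.\<close>
  moreover have "\<forall>w\<in>heavy f'. f 4 w 0 = cap" using SD(11,12) SD(4)[of a] c h by fastforce
  ultimately show "slots_inv n cap f'"
    unfolding slots_inv_def sl tabs(4-7) using SD(1-6,12) by blast
qed

text \<open>Slots and heavy vertices only increase, and the only slot that can be new is the one for
  \<open>b\<close> at \<open>a\<close>. These facts hide which branch was taken.\<close>

lemma slot_result_inv:
  assumes S: "slots_inv n cap f" and ab: "a < n" "b < n" "a \<noteq> b" and f': "f' = slot_result f a b"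
  shows "slots_inv n cap f'" "b \<in> slots f' a \<or> a \<in> heavy f'" "heavy f \<subseteq> heavy f'"
    "slots f w \<subseteq> slots f' w" "slots f' w \<subseteq> slots f w \<union> (if w = a then {b} else {})"
    "j \<notin> {2, 3, 4, 5, 6, 10} \<Longrightarrow> f' j = f j" "f' 10 0 0 \<le> f 10 0 0 + 1" "f' 4 w 0 \<le> f 4 w 0 + of_bool (w = a)"
    "flat n f \<Longrightarrow> flat n f'"
proof -
  note SD = slots_invD[OF S]
  have "slots_inv n cap f' \<and> (b \<in> slots f' a \<or> a \<in> heavy f') \<and> heavy f \<subseteq> heavy f' \<and>
    (\<forall>w. slots f w \<subseteq> slots f' w \<and> slots f' w \<subseteq> slots f w \<union> (if w = a then {b} else {}))"
  proof -
    consider "f 2 a b \<noteq> 0" | "f 2 a b = 0" "f 12 0 0 < f 4 a 0" "f 6 a 0 \<noteq> 0"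
      | "f 2 a b = 0" "f 12 0 0 < f 4 a 0" "f 6 a 0 = 0" | "f 2 a b = 0" "f 4 a 0 \<le> f 12 0 0" by linarith
    then show ?thesis
    proof cases
      case 1
      then have "f' = f" using f' unfolding slot_result_def by simp
      then show ?thesis using S SD(1)[of a b] 1 by auto
    next
      case 2
      then have "f' = f" using f' unfolding slot_result_def by simp
      then show ?thesis using S SD(10)[of a] 2 by auto
    next
      case 3
      then have "f' = upd (upd (upd f 5 (f 10 0 0) 0 a) 10 0 0 (f 10 0 0 + 1)) 6 a 0 1"
        using f' unfolding slot_result_def by simp
      from slots_inv_heavy[OF S ab(1) 3(2,3) this] show ?thesis by auto
    next
      case 4
      then have "f' = upd (upd (upd f 3 a (f 4 a 0) b) 2 a b 1) 4 a 0 (f 4 a 0 + 1)"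
        using f' unfolding slot_result_def by simp
      from slots_inv_append[OF S ab 4 this] show ?thesis by auto
    qed
  qed
  then show "slots_inv n cap f'" "b \<in> slots f' a \<or> a \<in> heavy f'" "heavy f \<subseteq> heavy f'"
    "slots f w \<subseteq> slots f' w" "slots f' w \<subseteq> slots f w \<union> (if w = a then {b} else {})" by blast+
  show "j \<notin> {2, 3, 4, 5, 6, 10} \<Longrightarrow> f' j = f j" "f' 10 0 0 \<le> f 10 0 0 + 1" "f' 4 w 0 \<le> f 4 w 0 + of_bool (w = a)"
    unfolding f' slot_result_def by (auto simp: upd_apply fun_eq_iff)
  show "flat n f \<Longrightarrow> flat n f'" unfolding f' slot_result_def flat_def by (auto simp: upd_apply)
qed

lemma counts_inv_cong:
  assumes "counts_inv vq n E f" "\<And>j. j \<in> {0, 7, 16} \<Longrightarrow> f' j = f j"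
    "\<And>w x. {w, x} \<in> E \<Longrightarrow> x \<in> slots f' w \<longleftrightarrow> x \<in> slots f w" "heavy f \<subseteq> heavy f'"
  shows "counts_inv vq n E f'"
proof -
  have e: "f' 0 = f 0" "f' 7 = f 7" "f' 16 = f 16" using assms(2) by auto
  have "codeg n E (slots f') p q = codeg n E (slots f) p q" for p q by (rule codeg_cong[OF assms(3)])
  moreover have "tri E (slots f') v = tri E (slots f) v" for v by (rule tri_cong[OF assms(3)])
  moreover have "x \<in> slots f' w \<or> w \<in> heavy f'" if "{w, x} \<in> E" for w x
    using assms(1,3,4) that unfolding counts_inv_def by blast
  ultimately show ?thesis using assms(1) unfolding counts_inv_def e by simp
qed

lemma log_invD:
  assumes "log_inv n E f"
  shows "\<And>i. f 8 i 0 \<noteq> 0 \<or> f 9 i 0 \<noteq> 0 \<Longrightarrow> i < f 11 0 0" "\<And>i. f 8 i 0 < n" "\<And>i. f 9 i 0 < n"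
    "\<And>e. e \<in> E \<Longrightarrow> \<exists>i<f 11 0 0. e = {f 8 i 0, f 9 i 0}"
    "\<And>w. f 4 w 0 \<noteq> 0 \<Longrightarrow> \<exists>i<f 11 0 0. w = f 8 i 0 \<or> w = f 9 i 0"
    "(\<Sum>w<n. f 4 w 0) \<le> 2 * f 11 0 0"
proof -
  note a = assms[unfolded log_inv_def]
  show "\<And>i. f 8 i 0 \<noteq> 0 \<or> f 9 i 0 \<noteq> 0 \<Longrightarrow> i < f 11 0 0" by (rule a[THEN conjunct1, rule_format])
  show "\<And>i. f 8 i 0 < n" "\<And>i. f 9 i 0 < n" using a[THEN conjunct2, THEN conjunct1] by simp_all
  show "\<And>e. e \<in> E \<Longrightarrow> \<exists>i<f 11 0 0. e = {f 8 i 0, f 9 i 0}"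
    by (rule a[THEN conjunct2, THEN conjunct2, THEN conjunct1, rule_format])
  show "\<And>w. f 4 w 0 \<noteq> 0 \<Longrightarrow> \<exists>i<f 11 0 0. w = f 8 i 0 \<or> w = f 9 i 0"
    by (rule a[THEN conjunct2, THEN conjunct2, THEN conjunct2, THEN conjunct1, rule_format])
  show "(\<Sum>w<n. f 4 w 0) \<le> 2 * f 11 0 0" using a by blast
qed

lemma flatD:
  assumes "flat n f"
  shows "\<And>j p q. 4 \<le> j \<Longrightarrow> j < 16 \<Longrightarrow> q \<noteq> 0 \<Longrightarrow> f j p q = 0"
    "\<And>j p q. 10 \<le> j \<Longrightarrow> j < 14 \<Longrightarrow> p \<noteq> 0 \<Longrightarrow> f j p q = 0"
    "\<And>j p q. j = 1 \<or> 16 < j \<Longrightarrow> f j p q = 0" "\<And>p. f 14 p 0 < n" "\<And>p. f 15 p 0 < n"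
  proof -
  note a = assms[unfolded flat_def]
  show "\<And>j p q. 4 \<le> j \<Longrightarrow> j < 16 \<Longrightarrow> q \<noteq> 0 \<Longrightarrow> f j p q = 0" by (rule a[THEN conjunct1, rule_format])
  show "\<And>j p q. 10 \<le> j \<Longrightarrow> j < 14 \<Longrightarrow> p \<noteq> 0 \<Longrightarrow> f j p q = 0"
    by (rule a[THEN conjunct2, THEN conjunct1, rule_format])
  show "\<And>j p q. j = 1 \<or> 16 < j \<Longrightarrow> f j p q = 0"
    by (rule a[THEN conjunct2, THEN conjunct2, THEN conjunct1, rule_format])
  show "\<And>p. f 14 p 0 < n" "\<And>p. f 15 p 0 < n" using a by simp_all
qed

context ram
begin

text \<open>By the invariants, bits are at most 1, vertices, lengths and codegrees at most
  \<open>n\<close>, and triangle counts at most \<open>n * n\<close>. Only the scalars 11 to 13 call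
  for separate bounds.\<close>

lemma smallI:
  assumes E: "edge_set n E" and S: "slots_inv n cap f" and C: "counts_inv vq n E f" and F: "flat n f"
    and l: "\<And>i. f 8 i 0 < n \<and> f 9 i 0 < n" and s: "f 11 0 0 \<le> PB" "f 12 0 0 \<le> PB" "f 13 0 0 \<le> PB"
  shows "small f"
  unfolding small_def
proof (intro allI)
  fix j p q :: nat
  note SD = slots_invD[OF S] and card = slots_inv_card[OF S]
  note flat = flatD(1)[OF F] and flat' = flatD(2)[OF F] and flat'' = flatD(3)[OF F]
  have nPB: "x \<le> PB" if "x \<le> n" for x using that PB_bounds by linarith
  have CD: "f 0 p q \<le> 1" "f 16 p q \<le> n" "f 7 p 0 \<le> n * n"
    using C codeg_le[of n E "slots f" p q] order_trans[OF tri_le[OF E] card_edge_set_le[OF E], of "slots f" p]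
    unfolding counts_inv_def by auto
  have t3: "f 3 p q \<le> n"
  proof (cases "f 3 p q = 0")
    case False
    then have "f 3 p q \<in> slots f p" using SD(3)[of p q] unfolding slots_def by auto
    then show ?thesis using SD(5)[of p] by auto
  qed simp
  have t5: "f 5 p 0 \<le> n"
  proof (cases "f 5 p 0 = 0")
    case False
    then have "f 5 p 0 \<in> heavy f" using SD(8)[of p] unfolding heavy_def by auto
    then show ?thesis using SD(9) by auto
  qed simp
  have t14: "f 14 p 0 \<le> n" "f 15 p 0 \<le> n" using flatD(4,5)[OF F, of p] by auto
  have t8: "f 8 p 0 \<le> n" "f 9 p 0 \<le> n" using l[of p] by auto
  have t26: "f 2 p q \<le> 1" "f 6 p 0 \<le> 1" using SD(1,10) by auto
  have q0: "f j p q \<le> PB" if "4 \<le> j" "j < 16" "f j p 0 \<le> PB" for j using flat[OF that(1,2), of q p] that(3) by (cases "q = 0") auto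
  have p0: "f j p 0 \<le> PB" if "10 \<le> j" "j < 14" "f j 0 0 \<le> PB" for j using flat'[OF that(1,2), of p 0] that(3) by (cases "p = 0") auto
  have range: "j \<in> {0, 1, 2, 3, 4, 5, 6, 7, 8, 9, 10, 11, 12, 13, 14, 15, 16} \<or> 16 < j"
    by (cases "16 < j") (auto simp: not_less eval_nat_numeral le_Suc_eq)
  consider "j = 0" | "j = 1 \<or> 16 < j" | "j = 2" | "j = 3" | "j = 4" | "j = 5" | "j = 6" | "j = 7" | "j = 8" | "j = 9" | "j = 10" | "j = 11" | "j = 12" | "j = 13" | "j = 14" | "j = 15" | "j = 16" using range by blast
  then show "f j p q \<le> PB"
  proof cases
    case 1
    then show ?thesis using CD(1) PB_bounds(3) by simp
  next
    case 2
    then show ?thesis using flat''[of j p q] by simp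
  next
    case 3
    then show ?thesis using t26(1) PB_bounds(3) by simp
  next
    case 4
    then show ?thesis using nPB[OF t3] by simp
  next
    case 5
    then show ?thesis using q0[of 4] nPB[OF card(3)] by simp
  next
    case 6
    then show ?thesis using q0[of 5] nPB[OF t5] by simp
  next
    case 7
    then show ?thesis using q0[of 6] t26(2) PB_bounds(3) by simp
  next
    case 8
    then show ?thesis using q0[of 7] CD(3) PB_bounds(2) by simp
  next
    case 9
    then show ?thesis using q0[of 8] nPB[OF t8(1)] by simp
  next
    case 10
    then show ?thesis using q0[of 9] nPB[OF t8(2)] by simp
  next
    case 11
    then show ?thesis using q0[of 10] p0[of 10] nPB[OF card(4)] by simp
  next
    case 12
    then show ?thesis using q0[of 11] p0[of 11] s by simp
  next
    case 13
    then show ?thesis using q0[of 12] p0[of 12] s by simp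
  next
    case 14
    then show ?thesis using q0[of 13] p0[of 13] s by simp
  next
    case 15
    then show ?thesis using q0[of 14] nPB[OF t14(1)] by simp
  next
    case 16
    then show ?thesis using q0[of 15] nPB[OF t14(2)] by simp
  next
    case 17
    then show ?thesis using nPB[OF CD(2)] by simp
  qed
qed

text \<open>Deletion undoes an insertion into \<open>E0\<close> under the present slots: the
  insertion formulas tell exactly what the tables contain on account of the edge. Slots and log are
  left as they are.\<close>

lemma ok_del_edge:
  assumes I: "ds_inv vq n cap E f" and b: "small f" and regs: "R 0 = n" "R 1 = u" "R 2 = v" and e: "{u, v} \<in> E"
  shows "ok (del_edge vq) R f (3000 * (cap + (if vq then f 10 0 0 else 0) + 1))
    (\<lambda>R' f'. ds_inv vq n cap (E - {{u, v}}) f' \<and> (\<forall>j. j \<notin> {0, 7, 16} \<longrightarrow> f' j = f j))"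
proof -
  have E: "edge_set n E" and S: "slots_inv n cap f" and C: "counts_inv vq n E f" and F: "flat n f" and L: "log_inv n E f"
    using I unfolding ds_inv_def by auto
  note SD = slots_invD[OF S]
  define E0 where "E0 = E - {{u, v}}"
  have E0: "edge_set n E0" "{u, v} \<notin> E0" "E = insert {u, v} E0" using E e unfolding edge_set_def E0_def by auto
  have uv: "u < n" "v < n" "u \<noteq> v" using edge_setD[OF E e] by auto
  define f1 where "f1 = (\<lambda>j p q. if j = 0 \<and> {p, q} = {u, v} then 0 else f j p q)"
  have same1: "f1 j = f j" if "j \<noteq> 0" for j using that unfolding f1_def by auto
  have S1: "slots_inv n cap f1" "slots f1 = slots f" "heavy f1 = heavy f"
    by (rule slots_inv_cong[OF S]; use same1 in auto)+
  have irr: "w \<notin> slots f w" for w using SD(5)[of w] by auto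
  have A1: "f1 0 p q = of_bool ({p, q} \<in> E0)" for p q using C unfolding f1_def counts_inv_def E0_def by auto
  have cd: "codeg n E (slots f) p q = codeg n E0 (slots f) p q + (codeg_diff E0 (slots f) u v p q + codeg_diff E0 (slots f) v u p q)" for p q
    unfolding E0(3) by (rule codeg_insert[OF E0(1) uv(3,1,2) E0(2)]) (rule irr)
  have td: "tri E (slots f) w = tri E0 (slots f) w + tri_diff E0 (slots f) u v w" for w
    unfolding E0(3) by (rule tri_insert[OF E0(1) uv(3) E0(2)])
  \<comment> \<open>The edge does not contribute to the codegree of its own end points, because no
    vertex has a slot for itself; so the entry is right for \<open>E0\<close> already.\<close>
  have C1: "f1 16 u v = codeg n E0 (slots f1) u v"
    using C cd[of u v] irr uv unfolding counts_inv_def S1 same1[of 16, simplified] by (auto simp: codeg_diff_def)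
  have cov: "x \<in> slots f w \<or> w \<in> heavy f" if "{w, x} \<in> E0" for w x
    using C that unfolding counts_inv_def E0_def by auto
  have b1: "small f1" using b unfolding small_def f1_def by auto
  define f2 where "f2 = (\<lambda>j p q.
      if j = 16 then apply_bin Sub (f1 16 p q) (codeg_diff E0 (slots f1) u v p q + codeg_diff E0 (slots f1) v u p q)
      else if j = 7 \<and> q = 0 \<and> vq then apply_bin Sub (f1 7 p q) (tri_diff E0 (slots f1) u v p) else f1 j p q)"
  have s1: "ok (adj_prog zero) R f 100 (\<lambda>R' f'. f' = f1)"
    unfolding f1_def by (rule ok_adj_prog) (use regs uv in auto)
  have s2: "ok (counts_prog vq Sub) R' f1 (2000 * (cap + (if vq then f1 10 0 0 else 0) + 1)) (\<lambda>R' f'. f' = f2)"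
    if "R' 0 = n" "R' 1 = u" "R' 2 = v" for R' unfolding f2_def
    by (rule ok_counts_prog) (use that uv E0 b1 S1 A1 C1 cov in auto)
  have "ok (del_edge vq) R f (100 + 2000 * (cap + (if vq then f1 10 0 0 else 0) + 1)) (\<lambda>R' f'. f' = f2)"
    unfolding del_edge_def by (rule ok_Seq[OF s1], hypsubst, rule s2) (use regs in auto)
  moreover have same2: "f2 j = f j" if "j \<notin> {0, 7, 16}" for j using that same1[of j] unfolding f2_def by auto
  moreover have "ds_inv vq n cap E0 f2"
  proof -
    have S2: "slots_inv n cap f2" "slots f2 = slots f" "heavy f2 = heavy f"
      by (rule slots_inv_cong[OF S]; use same2 in auto)+
    have "f2 0 p q = of_bool ({p, q} \<in> E0)" for p q using A1 unfolding f2_def by auto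
    \<comment> \<open>By \<open>cd\<close> the entry contains the amount subtracted, so truncated
      subtraction is exact.\<close>
    moreover have "f2 16 p q = codeg n E0 (slots f) p q" for p q
      using cd[of p q] C S1(2) unfolding f2_def counts_inv_def same1[of 16, simplified] by simp
    moreover have "f2 7 w 0 = (if vq then tri E0 (slots f) w else 0)" for w
      using td[of w] C S1(2) unfolding f2_def counts_inv_def same1[of 7, simplified] by simp
    ultimately have "counts_inv vq n E0 f2" unfolding counts_inv_def S2 using cov by blast
    moreover have "flat n f2" using F unfolding flat_def f2_def f1_def by auto
    moreover have "log_inv n E0 f2" using L
      unfolding log_inv_def same2[of 4, simplified] same2[of 8, simplified] same2[of 9, simplified] same2[of 11, simplified] E0(3) by auto
    ultimately show ?thesis using E0(1) S2(1) unfolding ds_inv_def by blast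
  qed
  ultimately show ?thesis unfolding E0_def same1[of 10, simplified] by (elim ok_mono) auto
qed

lemma ok_add_edge:
  assumes I: "ds_inv vq n cap E f" and b: "f 11 0 0 < PB" "cap \<le> PB" "f 13 0 0 \<le> PB"
    and regs: "R 0 = n" "R 1 = u" "R 2 = v" and uv: "u < n" "v < n" "u \<noteq> v" and e: "{u, v} \<notin> E"
  shows "ok (add_edge vq) R f (9000 * (cap + (if vq then f 10 0 0 else 0) + 1))
    (\<lambda>R' f'. ds_inv vq n cap (insert {u, v} E) f' \<and> f' 11 0 0 = f 11 0 0 + 1 \<and> (\<forall>j. j \<in> {12, 13, 14, 15} \<longrightarrow> f' j = f j))"
proof -
  have E: "edge_set n E" and S: "slots_inv n cap f" and C: "counts_inv vq n E f" and F: "flat n f" and L: "log_inv n E f"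
    using I unfolding ds_inv_def by auto
  have log: "f 8 i 0 < n \<and> f 9 i 0 < n" for i using log_invD(2,3)[OF L] by simp
  have capb: "f 12 0 0 \<le> PB" using slots_invD(12)[OF S] b by simp
  have sm: "small f" using smallI[OF E S C F log] b capb by simp
  have vu: "{v, u} \<notin> E" using e by (simp add: insert_commute)
  define f1 where "f1 = slot_result f u v"
  note R1 = slot_result_inv[OF S uv f1_def]
  \<comment> \<open>The new slot belongs to a pair that is not an edge yet, so the counts do not
    notice it.\<close>
  have C1: "counts_inv vq n E f1"
  proof (rule counts_inv_cong[OF C])
    show "\<And>j. j \<in> {0, 7, 16} \<Longrightarrow> f1 j = f j" using R1(6) by auto
    fix w x assume "{w, x} \<in> E"
    then have "\<not> (w = u \<and> x = v)" using e by auto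
    then show "x \<in> slots f1 w \<longleftrightarrow> x \<in> slots f w" using R1(4)[of w] R1(5)[of w] by (auto split: if_splits)
  qed (rule R1(3))
  have F1: "flat n f1" using R1(9) F .
  have same1: "f1 j = f j" if "j \<notin> {2, 3, 4, 5, 6, 10}" for j using R1(6) that .
  have log1: "f1 8 i 0 < n \<and> f1 9 i 0 < n" for i using log same1 by simp
  have sm1: "small f1" using smallI[OF E R1(1) C1 F1 log1] b capb same1 by simp
  define f2 where "f2 = slot_result f1 v u"
  note R2 = slot_result_inv[OF R1(1) uv(2,1) uv(3)[symmetric] f2_def]
  have C2: "counts_inv vq n E f2"
  proof (rule counts_inv_cong[OF C1])
    show "\<And>j. j \<in> {0, 7, 16} \<Longrightarrow> f2 j = f1 j" using R2(6) by auto
    fix w x assume "{w, x} \<in> E"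
    then have "\<not> (w = v \<and> x = u)" using vu by auto
    then show "x \<in> slots f2 w \<longleftrightarrow> x \<in> slots f1 w" using R2(4)[of w] R2(5)[of w] by (auto split: if_splits)
  qed (rule R2(3))
  have F2: "flat n f2" using R2(9) F1 .
  have same2: "f2 j = f j" if "j \<notin> {2, 3, 4, 5, 6, 10}" for j using R2(6)[OF that] same1[OF that] by simp
  have heavy2: "f2 10 0 0 \<le> f 10 0 0 + 2" using R1(7) R2(7) by simp
  have len2: "f2 4 w 0 \<le> f 4 w 0 + (of_bool (w = u) + of_bool (w = v))" for w using R1(8)[of w] R2(8)[of w] by simp
  let ?l = "f 11 0 0"
  define f3 where "f3 = upd (upd (upd f2 8 (f2 11 0 0) 0 u) 9 (f2 11 0 0) 0 v) 11 0 0 (f2 11 0 0 + 1)"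
  have l2: "f2 11 0 0 = ?l" using same2[of 11] by simp
  have same3: "f3 j = f2 j" if "j \<notin> {8, 9, 11}" for j using that unfolding f3_def by (auto simp: upd_apply fun_eq_iff)
  have S3: "slots_inv n cap f3" "slots f3 = slots f2" "heavy f3 = heavy f2"
    by (rule slots_inv_cong[OF R2(1)]; use same3 in auto)+
  have C3: "counts_inv vq n E f3"
    by (rule counts_inv_cong[OF C2]) (use same3 S3 in auto)
  have F3: "flat n f3" using F2 unfolding f3_def flat_def by (auto simp: upd_apply)
  have l3: "f3 8 i 0 = (if i = ?l then u else f 8 i 0)" "f3 9 i 0 = (if i = ?l then v else f 9 i 0)" "f3 11 0 0 = ?l + 1" for i
    using same2[of 8] same2[of 9] unfolding f3_def l2 by (auto simp: upd_apply)
  have log3: "f3 8 i 0 < n \<and> f3 9 i 0 < n" for i using log uv l3 by simp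
  have same3': "f3 j = f j" if "j \<in> {12, 13, 14, 15}" for j using that same3[of j] same2[of j] by auto
  have sm3: "small f3" using smallI[OF E S3(1) C3 F3 log3] b capb same3' l3 by simp
  define f4 where "f4 = (\<lambda>j p q.
      if j = 16 then apply_bin Add (f3 16 p q) (codeg_diff E (slots f3) u v p q + codeg_diff E (slots f3) v u p q)
      else if j = 7 \<and> q = 0 \<and> vq then apply_bin Add (f3 7 p q) (tri_diff E (slots f3) u v p) else f3 j p q)"
  define f5 where "f5 = (\<lambda>j p q. if j = 0 \<and> {p, q} = {u, v} then 1 else f4 j p q)"
  have s12: "ok (Seq (slot_prog 1 2) (slot_prog 2 1)) R f (400 + 400) (\<lambda>R' f'. f' = f2)"
    unfolding f2_def f1_def
    by (rule ok_Seq[OF ok_slot_prog[OF regs uv sm S]], hypsubst,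
        rule ok_slot_prog[OF _ _ _ uv(2,1) uv(3)[symmetric] sm1[unfolded f1_def] R1(1)[unfolded f1_def]]) (use regs in auto)
  have s3: "ok log_prog R' f2 200 (\<lambda>R' f'. f' = f3)" if "R' 0 = n" "R' 1 = u" "R' 2 = v" for R'
    unfolding f3_def by (rule ok_log_prog) (use that uv b l2 in auto)
  have s4: "ok (counts_prog vq Add) R' f3 (2000 * (cap + (if vq then f3 10 0 0 else 0) + 1)) (\<lambda>R' f'. f' = f4)"
    if "R' 0 = n" "R' 1 = u" "R' 2 = v" for R' unfolding f4_def
    by (rule ok_counts_prog) (use that uv E e sm3 S3(1) C3 in \<open>auto simp: counts_inv_def\<close>)
  have s5: "ok (adj_prog one) R' f4 100 (\<lambda>R' f'. f' = f5)" if "R' 0 = n" "R' 1 = u" "R' 2 = v" for R'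
    unfolding f5_def by (rule ok_adj_prog) (use that uv in auto)
  have "ok (add_edge vq) R f ((400 + 400) + (200 + (2000 * (cap + (if vq then f3 10 0 0 else 0) + 1) + 100))) (\<lambda>R' f'. f' = f5)"
    unfolding add_edge_def
  proof (rule ok_Seq[OF s12], hypsubst)
    fix R1 assume "\<And>r. r \<notin> written (Seq (slot_prog 1 2) (slot_prog 2 1)) \<Longrightarrow> R1 r = R r"
    then have r1: "R1 0 = n" "R1 1 = u" "R1 2 = v" using regs by auto
    show "ok (Seq log_prog (Seq (counts_prog vq Add) (adj_prog one))) R1 f2
       (200 + (2000 * (cap + (if vq then f3 10 0 0 else 0) + 1) + 100)) (\<lambda>R' f'. f' = f5)"
    proof (rule ok_Seq[OF s3[OF r1]], hypsubst)
      fix R2 assume "\<And>r. r \<notin> written log_prog \<Longrightarrow> R2 r = R1 r"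
      then have r2: "R2 0 = n" "R2 1 = u" "R2 2 = v" using r1 by auto
      show "ok (Seq (counts_prog vq Add) (adj_prog one)) R2 f3
         (2000 * (cap + (if vq then f3 10 0 0 else 0) + 1) + 100) (\<lambda>R' f'. f' = f5)"
      proof (rule ok_Seq[OF s4[OF r2]], hypsubst)
        fix R3 assume R3: "\<And>r. r \<notin> written (counts_prog vq Add) \<Longrightarrow> R3 r = R2 r"
        have "R3 r = R2 r" if "r < 5" for r by (rule R3) (use written_small(1) that in blast)
        then have "R3 0 = n" "R3 1 = u" "R3 2 = v" using r2 by auto
        then show "ok (adj_prog one) R3 f4 100 (\<lambda>R' f'. f' = f5)" by (rule s5)
      qed
    qed
  qed
  moreover have same5: "f5 j = f3 j" if "j \<notin> {0, 7, 16}" for j using that unfolding f5_def f4_def by auto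
  moreover have "ds_inv vq n cap (insert {u, v} E) f5"
  proof -
    have S5: "slots_inv n cap f5" "slots f5 = slots f3" "heavy f5 = heavy f3"
      by (rule slots_inv_cong[OF S3(1)]; use same5 in auto)+
    have irr: "w \<notin> slots f3 w" for w using slots_invD(5)[OF S3(1), of w] by auto
    have "f5 0 p q = of_bool ({p, q} \<in> insert {u, v} E)" for p q
      using C3 unfolding f5_def f4_def counts_inv_def by simp
    moreover have "f5 16 p q = codeg n (insert {u, v} E) (slots f5) p q" for p q
      using C3 codeg_insert[OF E uv(3,1,2) e irr] unfolding f5_def f4_def counts_inv_def S5[unfolded f5_def f4_def] by simp
    moreover have "f5 7 w 0 = (if vq then tri (insert {u, v} E) (slots f5) w else 0)" for w
      using C3 tri_insert[OF E uv(3) e] unfolding f5_def f4_def counts_inv_def S5[unfolded f5_def f4_def] by simp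
    moreover have "x \<in> slots f5 w \<or> w \<in> heavy f5" if "{w, x} \<in> insert {u, v} E" for w x
    proof (cases "{w, x} \<in> E")
      case True
      then show ?thesis using C3 unfolding S5 counts_inv_def by blast
    next
      case False
      then have "(w = u \<and> x = v) \<or> (w = v \<and> x = u)" using that by (auto simp: doubleton_eq_iff)
      \<comment> \<open>What the first end point has obtained is kept while the second is
        served.\<close>
      then show ?thesis using R1(2) R2(2,3) R2(4)[of u] unfolding S5 S3 by blast
    qed
    ultimately have C5: "counts_inv vq n (insert {u, v} E) f5" unfolding counts_inv_def by blast
    have F5: "flat n f5" using F3 unfolding flat_def f5_def f4_def by auto
    have t5: "f5 8 = f3 8" "f5 9 = f3 9" "f5 11 = f3 11" "f5 4 = f2 4" using same5 same3 by auto
    have L5: "log_inv n (insert {u, v} E) f5"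
      unfolding log_inv_def t5
    proof (intro conjI allI impI ballI)
      fix i assume "f3 8 i 0 \<noteq> 0 \<or> f3 9 i 0 \<noteq> 0"
      then show "i < f3 11 0 0" using log_invD(1)[OF L, of i] l3 by (auto split: if_splits)
    next
      fix i show "f3 8 i 0 < n" "f3 9 i 0 < n" using log3 by auto
    next
      fix e assume "e \<in> insert {u, v} E"
      then consider "e = {u, v}" | "e \<in> E" by blast
      then show "\<exists>i<f3 11 0 0. e = {f3 8 i 0, f3 9 i 0}"
      proof cases
        case 1
        then show ?thesis using l3 by (intro exI[of _ ?l]) auto
      next
        case 2
        then obtain i where "i < ?l" "e = {f 8 i 0, f 9 i 0}" using log_invD(4)[OF L] by blast
        then show ?thesis using l3 by (intro exI[of _ i]) auto
      qed
    next
      fix w assume w: "f2 4 w 0 \<noteq> 0"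
      show "\<exists>i<f3 11 0 0. w = f3 8 i 0 \<or> w = f3 9 i 0"
      proof (cases "f 4 w 0 = 0")
        case True
        then have "w = u \<or> w = v" using len2[of w] w by (auto simp: of_bool_def split: if_splits)
        then show ?thesis using l3 by (intro exI[of _ ?l]) auto
      next
        case False
        then obtain i where "i < ?l" "w = f 8 i 0 \<or> w = f 9 i 0" using log_invD(5)[OF L] by blast
        then show ?thesis using l3 by (intro exI[of _ i]) auto
      qed
    next
      \<comment> \<open>At most one new slot at each end, against one new log entry, which counts
        twice.\<close>
      have "(\<Sum>w<n. f2 4 w 0) \<le> (\<Sum>w<n. f 4 w 0 + (of_bool (w = u) + of_bool (w = v)))"
        by (intro sum_mono) (rule len2)
      also have "\<dots> = (\<Sum>w<n. f 4 w 0) + 2"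
        using uv by (simp add: sum.distrib of_bool_def sum.delta)
      also have "\<dots> \<le> 2 * f3 11 0 0" using log_invD(6)[OF L] l3 by simp
      finally show "(\<Sum>w<n. f2 4 w 0) \<le> 2 * f3 11 0 0" .
    qed
    have "edge_set n (insert {u, v} E)" using E uv unfolding edge_set_def by auto
    then show ?thesis using S5(1) C5 F5 L5 unfolding ds_inv_def by blast
  qed
  \<comment> \<open>Both end points may have become heavy; the constant 9000 absorbs the longer
    scan.\<close>
  moreover have "f3 10 0 0 \<le> f 10 0 0 + 2" using heavy2 same3[of 10] by simp
  ultimately show ?thesis using same3' l3(3) by (elim ok_mono) auto
qed

end

section \<open>Cells in use\<close>

definition support :: "tables \<Rightarrow> nat \<Rightarrow> (nat \<times> nat) set" where
  "support f j = {(p, q). f j p q \<noteq> 0}"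

definition tables_le :: "nat \<Rightarrow> tables \<Rightarrow> bool" where
  "tables_le Z f \<longleftrightarrow> (\<forall>j. finite (support f j) \<and> card (support f j) \<le> Z)"

lemma tables_le_mono:
  assumes "tables_le Z f" "\<And>j p q. f' j p q \<noteq> 0 \<Longrightarrow> f j p q \<noteq> 0"
  shows "tables_le Z f'"
  unfolding tables_le_def
proof (intro allI)
  fix j
  have sub: "support f' j \<subseteq> support f j" using assms(2) unfolding support_def by blast
  then show "finite (support f' j) \<and> card (support f' j) \<le> Z"
    using assms(1) card_mono[OF _ sub] finite_subset[OF sub] unfolding tables_le_def by (meson order_trans)
qed

lemma tables_le_weaken: "tables_le Z f \<Longrightarrow> Z \<le> Z' \<Longrightarrow> tables_le Z' f"
  unfolding tables_le_def by (meson order_trans)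

text \<open>Nonzero registers are among 0 to 11, and memory consists of 32 interleaved tables; hence
  the constants.\<close>

lemma cells_le:
  assumes "0 < n" "tables_le Z f" "\<And>r. 12 \<le> r \<Longrightarrow> R r = 0"
  shows "finite_state (R, memory n f)" "cells_in_use (R, memory n f) \<le> 12 + 32 * Z"
proof -
  have R: "{r. R r \<noteq> 0} \<subseteq> {..<12}" using assms(3) by (metis (mono_tags) lessThan_iff mem_Collect_eq not_le subsetI)
  have M: "{a. memory n f a \<noteq> 0} \<subseteq> (\<Union>j<32. (\<lambda>(p, q). address n j p q) ` support f j)"
  proof
    fix a assume a: "a \<in> {a. memory n f a \<noteq> 0}"
    let ?p = "a div 32 div n" and ?q = "a div 32 mod n"
    have "a = address n (a mod 32) ?p ?q" using address_eq_iff[of ?q n "a mod 32" a ?p] assms(1) by simp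
    moreover have "(?p, ?q) \<in> support f (a mod 32)" using a unfolding support_def memory_def by simp
    ultimately show "a \<in> (\<Union>j<32. (\<lambda>(p, q). address n j p q) ` support f j)"
      by (intro UN_I[of "a mod 32"]) (auto intro!: image_eqI[of _ _ "(?p, ?q)"])
  qed
  have fin: "finite (\<Union>j<32. (\<lambda>(p, q). address n j p q) ` support f j)"
    using assms(2) unfolding tables_le_def by auto
  have "card {a. memory n f a \<noteq> 0} \<le> card (\<Union>j<32. (\<lambda>(p, q). address n j p q) ` support f j)"
    by (rule card_mono[OF fin M])
  also have "\<dots> \<le> (\<Sum>j<32. card ((\<lambda>(p, q). address n j p q) ` support f j))" by (rule card_UN_le) simp
  also have "\<dots> \<le> (\<Sum>j<(32::nat). Z)"
  proof (rule sum_mono)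
    fix j
    show "card ((\<lambda>(p, q). address n j p q) ` support f j) \<le> Z"
      using assms(2) card_image_le[of "support f j"] unfolding tables_le_def by (meson order_trans)
  qed
  finally have "card {a. memory n f a \<noteq> 0} \<le> 32 * Z" by simp
  moreover have "card {r. R r \<noteq> 0} \<le> 12" using card_mono[OF _ R] by simp
  ultimately show "cells_in_use (R, memory n f) \<le> 12 + 32 * Z" unfolding cells_in_use_def by simp
  show "finite_state (R, memory n f)" unfolding finite_state_def
    using finite_subset[OF R] finite_subset[OF M fin] by simp
qed

lemma card_edge_pairs:
  assumes "finite E"
  shows "finite {(p, q). {p, q} \<in> E}" "card {(p, q). {p, q} \<in> E} \<le> 2 * card E"
proof -
  have eq: "{(p, q). {p, q} \<in> E} = (\<Union>e\<in>E. {(p, q). {p, q} = e})" by auto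
  have c: "finite {(p, q). {p, q} = e} \<and> card {(p, q). {p, q} = e} \<le> 2" for e :: "'a set"
  proof (cases "\<exists>p q. e = {p, q}")
    case True
    then obtain p q where "e = {p, q}" by blast
    then have sub: "{(p, q). {p, q} = e} \<subseteq> {(p, q), (q, p)}" by (auto simp: doubleton_eq_iff)
    have "card {(p, q), (q, p)} \<le> 2" using card_length[of "[(p, q), (q, p)]"] by simp
    then show ?thesis using order_trans[OF card_mono[OF _ sub]] finite_subset[OF sub] by simp
  next
    case False
    then have "{(p, q). {p, q} = e} = {}" by auto
    then show ?thesis by simp
  qed
  show "finite {(p, q). {p, q} \<in> E}" unfolding eq using assms c by auto
  have "card {(p, q). {p, q} \<in> E} \<le> (\<Sum>e\<in>E. card {(p, q). {p, q} = e})" unfolding eq by (rule card_UN_le[OF assms])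
  also have "\<dots> \<le> (\<Sum>e\<in>E. 2)" by (rule sum_mono) (use c in blast)
  finally show "card {(p, q). {p, q} \<in> E} \<le> 2 * card E" by simp
qed

text \<open>A nonzero codegree has a witness \<open>w\<close> whose slots contain both vertices, so
  the support lies in the union of the sets \<open>slots f w \<times> slots f w\<close>. Slot tables
  and heavy vertices are charged to the slots, the log tables to the length of the log, and tables
  14 and 15 to \<open>J\<close>.\<close>

lemma ds_inv_tables_le:
  assumes I: "ds_inv vq n cap E f" and J: "\<And>p. f 14 p 0 \<noteq> 0 \<or> f 15 p 0 \<noteq> 0 \<Longrightarrow> p < J"
    and s: "(\<Sum>w<n. f 4 w 0) \<le> s"
  shows "tables_le (min (n * n) (2 * card E + cap * s) + f 11 0 0 + J + 1) f"
proof -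
  have E: "edge_set n E" and S: "slots_inv n cap f" and C: "counts_inv vq n E f" and F: "flat n f" and L: "log_inv n E f"
    using I unfolding ds_inv_def by auto
  note SD = slots_invD[OF S] and card = slots_inv_card[OF S]
  let ?Z = "min (n * n) (2 * card E + cap * s)"
  define B where "B = (SIGMA w:{..<n}. {..<f 4 w 0})"
  have finB: "finite B" unfolding B_def by simp
  have cap: "1 \<le> cap" using SD(12) by simp
  have sum_le: "(\<Sum>w<n. f 4 w 0) \<le> cap * s" using s cap by (metis le_trans mult_le_mono nat_mult_1)
  have cB: "card B \<le> ?Z"
  proof -
    have "card B = (\<Sum>w<n. f 4 w 0)" unfolding B_def by simp
    moreover have "B \<subseteq> {..<n} \<times> {..<n}" unfolding B_def using card(3) by (auto intro: less_le_trans)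
    then have "card B \<le> card ({..<n} \<times> {..<n})" by (intro card_mono) auto
    ultimately show ?thesis using sum_le by simp
  qed
  have fh: "finite (heavy f)" unfolding heavy_def by simp
  \<comment> \<open>As \<open>cap\<close> is positive, a heavy vertex has a first slot, to which it
    is charged.\<close>
  have hB: "(\<lambda>w. (w, 0)) ` heavy f \<subseteq> B" unfolding B_def using SD(9,11) cap by fastforce
  have ch: "card (heavy f) \<le> ?Z"
  proof -
    have "card (heavy f) = card ((\<lambda>w. (w, 0::nat)) ` heavy f)" by (subst card_image) (auto simp: inj_on_def)
    also have "\<dots> \<le> card B" by (rule card_mono[OF finB hB])
    finally show ?thesis using cB by simp
  qed
  have row: "finite A \<Longrightarrow> card ((\<lambda>i. (i, 0::nat)) ` A) \<le> card A" for A :: "nat set" by (rule card_image_le)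
  have bound: "finite (support f j) \<and> card (support f j) \<le> ?Z + f 11 0 0 + J + 1"
    if "support f j \<subseteq> X" "finite X" "card X \<le> ?Z \<or> card X \<le> f 11 0 0 \<or> card X \<le> J \<or> card X \<le> 1" for j X
  proof
    show "finite (support f j)" using finite_subset[OF that(1,2)] .
    show "card (support f j) \<le> ?Z + f 11 0 0 + J + 1" using card_mono[OF that(2,1)] that(3) by linarith
  qed
  have flat: "q = 0" if "4 \<le> j" "j < 16" "f j p q \<noteq> 0" for j p q
    by (rule ccontr) (use flatD(1)[OF F that(1,2), of q p] that(3) in simp)
  show ?thesis unfolding tables_le_def
  proof
    fix j :: nat
    have range: "j \<in> {0, 1, 2, 3, 4, 5, 6, 7, 8, 9, 10, 11, 12, 13, 14, 15, 16} \<or> 16 < j"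
      by (cases "16 < j") (auto simp: not_less eval_nat_numeral le_Suc_eq)
    consider "j = 0" | "j = 1 \<or> 16 < j" | "j = 2" | "j = 3" | "j = 4" | "j = 5" | "j = 6" | "j = 7" | "j = 8 \<or> j = 9"
      | "j = 10 \<or> j = 11 \<or> j = 12 \<or> j = 13" | "j = 14 \<or> j = 15" | "j = 16" using range by blast
    then show "finite (support f j) \<and> card (support f j) \<le> ?Z + f 11 0 0 + J + 1"
    proof cases
      case 1
      have "support f j = {(p, q). {p, q} \<in> E}" using C 1 unfolding support_def counts_inv_def by auto
      moreover have "{(p, q). {p, q} \<in> E} \<subseteq> {..<n} \<times> {..<n}" using edge_setD[OF E] by auto
      then have "card {(p, q). {p, q} \<in> E} \<le> card ({..<n} \<times> {..<n})" by (intro card_mono) auto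
      ultimately show ?thesis using card_edge_pairs[OF finite_edge_set[OF E]] by auto
    next
      case 2
      have "f j p q = 0" for p q using flatD(3)[OF F 2] .
      then have "support f j = {}" unfolding support_def by auto
      then show ?thesis by simp
    next
      case 3
      define X where "X = (SIGMA w:{..<n}. slots f w)"
      have "card X = (\<Sum>w<n. f 4 w 0)" unfolding X_def using card(1) by (subst card_SigmaI) (auto simp: slots_def)
      moreover have "X \<subseteq> {..<n} \<times> {..<n}" unfolding X_def using SD(5) by auto
      then have "card X \<le> card ({..<n} \<times> {..<n})" by (intro card_mono) auto
      ultimately have "card X \<le> ?Z" using sum_le by simp
      moreover have "support f j \<subseteq> X"
      proof
        fix x assume "x \<in> support f j"
        then obtain w y where x: "x = (w, y)" "y \<in> slots f w" using SD(1) 3 unfolding support_def by auto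
        then have "f 4 w 0 \<noteq> 0" unfolding slots_def by auto
        then show "x \<in> X" using SD(6)[of w] x unfolding X_def by auto
      qed
      moreover have "finite X" unfolding X_def slots_def by auto
      ultimately show ?thesis by (intro bound) auto
    next
      case 4
      have "support f j \<subseteq> B"
      proof
        fix x assume "x \<in> support f j"
        then obtain w i where x: "x = (w, i)" "i < f 4 w 0" using SD(3) 4 unfolding support_def by auto
        then show "x \<in> B" using SD(6)[of w] x unfolding B_def by auto
      qed
      then show ?thesis using finB cB by (intro bound) auto
    next
      case 5
      have "support f j \<subseteq> B"
      proof
        fix x assume "x \<in> support f j"
        then obtain w i where x: "x = (w, i)" "f 4 w i \<noteq> 0" using 5 unfolding support_def by auto
        then have "i = 0" using flat[of 4] by simp
        then show "x \<in> B" using SD(6)[of w] x unfolding B_def by auto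
      qed
      then show ?thesis using finB cB by (intro bound) auto
    next
      case 6
      have "support f j \<subseteq> (\<lambda>i. (i, 0)) ` {..<f 10 0 0}"
        using flat[of 5] SD(8) 6 unfolding support_def by fastforce
      then show ?thesis using row[of "{..<f 10 0 0}"] ch card(2) by (intro bound) auto
    next
      case 7
      have "support f j \<subseteq> (\<lambda>i. (i, 0)) ` heavy f"
        using flat[of 6] SD(10) 7 unfolding support_def by fastforce
      then show ?thesis using row[of "heavy f"] ch fh by (intro bound) auto
    next
      case 8
      have "support f j \<subseteq> (\<lambda>i. (i, 0)) ` heavy f"
      proof
        fix x assume "x \<in> support f j"
        then obtain v i where x: "x = (v, i)" "f 7 v i \<noteq> 0" using 8 unfolding support_def by auto
        then have "i = 0" using flat[of 7] by simp
        with x have "tri E (slots f) v \<noteq> 0" using C unfolding counts_inv_def by (auto split: if_splits)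
        then have "{e \<in> E. (\<forall>x\<in>e. {v, x} \<in> E) \<and> \<not> e \<subseteq> slots f v} \<noteq> {}" unfolding tri_def by (metis card.empty)
        \<comment> \<open>Some opposite edge has an end that is a neighbour of \<open>v\<close>
          without a slot at \<open>v\<close>, so \<open>v\<close> is heavy.\<close>
        then have "v \<in> heavy f" using C unfolding counts_inv_def by blast
        then show "x \<in> (\<lambda>i. (i, 0)) ` heavy f" using x \<open>i = 0\<close> by auto
      qed
      then show ?thesis using row[of "heavy f"] ch fh by (intro bound) auto
    next
      case 9
      have "support f j \<subseteq> (\<lambda>i. (i, 0)) ` {..<f 11 0 0}"
      proof
        fix x assume "x \<in> support f j"
        then obtain i k where x: "x = (i, k)" "f j i k \<noteq> 0" unfolding support_def by auto
        then have "k = 0" using flat[of j] 9 by auto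
        with x have "i < f 11 0 0" using log_invD(1)[OF L, of i] 9 by auto
        then show "x \<in> (\<lambda>i. (i, 0)) ` {..<f 11 0 0}" using x \<open>k = 0\<close> by auto
      qed
      then show ?thesis using row[of "{..<f 11 0 0}"] by (intro bound) auto
    next
      case 10
      then have j: "10 \<le> j" "j < 14" by auto
      have "support f j \<subseteq> {(0, 0)}"
      proof
        fix x assume "x \<in> support f j"
        then obtain i k where x: "x = (i, k)" "f j i k \<noteq> 0" unfolding support_def by auto
        then have "k = 0" using flat[of j] j by auto
        moreover have "i = 0" using flatD(2)[OF F j, of i k] x by auto
        ultimately show "x \<in> {(0, 0)}" using x by simp
      qed
      then show ?thesis by (intro bound) auto
    next
      case 11
      have "support f j \<subseteq> (\<lambda>i. (i, 0)) ` {..<J}"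
      proof
        fix x assume "x \<in> support f j"
        then obtain i k where x: "x = (i, k)" "f j i k \<noteq> 0" unfolding support_def by auto
        then have "k = 0" using flat[of j] 11 by auto
        with x have "i < J" using J[of i] 11 by auto
        then show "x \<in> (\<lambda>i. (i, 0)) ` {..<J}" using x \<open>k = 0\<close> by auto
      qed
      then show ?thesis using row[of "{..<J}"] by (intro bound) auto
    next
      case 12
      have f16: "f 16 p q = codeg n E (slots f) p q" for p q using C unfolding counts_inv_def by blast
      define X where "X = (\<Union>w<n. slots f w \<times> slots f w)"
      have "support f j \<subseteq> X"
      proof
        fix x assume "x \<in> support f j"
        then obtain p q where x: "x = (p, q)" "codeg n E (slots f) p q \<noteq> 0" using 12 f16 unfolding support_def by auto
        then have "{w. w < n \<and> p \<in> slots f w \<and> q \<in> slots f w \<and> {w, p} \<in> E \<and> {w, q} \<in> E} \<noteq> {}"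
          unfolding codeg_def by (metis card.empty)
        then show "x \<in> X" using x unfolding X_def by blast
      qed
      moreover have finX: "finite X" unfolding X_def slots_def by auto
      moreover have "card X \<le> n * n"
      proof -
        have "X \<subseteq> {..<n} \<times> {..<n}" unfolding X_def using SD(5) by fastforce
        then have "card X \<le> card ({..<n} \<times> {..<n})" by (intro card_mono) auto
        then show ?thesis by simp
      qed
      moreover have "card X \<le> cap * s"
      proof -
        have "card X \<le> (\<Sum>w<n. card (slots f w \<times> slots f w))" unfolding X_def by (rule card_UN_le) simp
        also have "\<dots> = (\<Sum>w<n. f 4 w 0 * f 4 w 0)" using card(1) by (simp add: card_cartesian_product)
        also have "\<dots> \<le> (\<Sum>w<n. cap * f 4 w 0)" by (intro sum_mono mult_right_mono SD(4)) simp
        also have "\<dots> = cap * (\<Sum>w<n. f 4 w 0)" by (simp add: sum_distrib_left)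
        also have "\<dots> \<le> cap * s" using s by simp
        finally show ?thesis .
      qed
      ultimately show ?thesis by (intro bound) auto
    qed
  qed
qed

section \<open>Rebuilding\<close>

definition clear_step :: "nat \<Rightarrow> com" where
  "clear_step w = Seq (Put 2 (Reg w) (At 3 (Reg w) (Reg 5)) zero) (Put 3 (Reg w) (Reg 5) zero)"

definition clear_slots :: "nat \<Rightarrow> com" where
  "clear_slots w = Seq (For 5 (At 4 (Reg w) zero) (clear_step w)) (Put 4 (Reg w) zero zero)"

context ram
begin

text \<open>The slot array tells which bits of the row are set, so the row is cleared in time
  proportional to the number of slots and not to \<open>n\<close>. Apart from smallness, the
  assumptions on tables concern this row only, as other rows may have been cleared before.\<close>

lemma ok_clear_slots:
  assumes regs: "w \<notin> {0, 5}" "R 0 = n" "R w < n"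
    and b: "small f" and len: "f 4 (R w) 0 \<le> n" and s: "slots f (R w) \<subseteq> {..<n}"
    and t2: "\<And>x. f 2 (R w) x \<noteq> 0 \<Longrightarrow> x \<in> slots f (R w)"
    and t3: "\<And>i. f 3 (R w) i \<noteq> 0 \<Longrightarrow> i < f 4 (R w) 0"
    and t4: "\<And>i. i \<noteq> 0 \<Longrightarrow> f 4 (R w) i = 0"
  shows "ok (clear_slots w) R f (200 * (f 4 (R w) 0 + 1))
    (\<lambda>R' f'. f' = (\<lambda>j p q. if j \<in> {2, 3, 4} \<and> p = R w then 0 else f j p q))"
proof -
  let ?w = "R w" let ?N = "f 4 ?w 0"
  have bd: "f j p q \<le> PB" for j p q using b unfolding small_def by blast
  have bdW: "f j p q < W" for j p q using bd[of j p q] PB_bounds by linarith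
  have rW: "?w < W" "?w \<le> PB" using regs leW by auto
  define g where "g k = (\<lambda>j p q. if (j = 2 \<and> p = ?w \<and> q \<in> f 3 ?w ` {..<k}) \<or> (j = 3 \<and> p = ?w \<and> q < k) then 0 else f j p q)" for k :: nat
  have gW: "g k j p q < W" for k j p q using bdW[of j p q] W_small unfolding g_def by auto
  have loop: "ok (For 5 (At 4 (Reg w) zero) (clear_step w)) R f
     (10 + expr_time (At 4 (Reg w) zero) + ?N * (100 + 10 + expr_time (At 4 (Reg w) zero)))
     (\<lambda>R' f'. (f' = g ?N \<and> (\<forall>r. r \<noteq> 5 \<longrightarrow> R' r = R r)) \<and> R' 5 = ?N)"
  proof (rule ok_For)
    fix k R' f'
    assume k: "k < ?N" and I: "f' = g k \<and> (\<forall>r. r \<noteq> 5 \<longrightarrow> R' r = R r)" and R5: "R' 5 = k"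
    let ?y = "f 3 ?w k"
    have kn: "k < n" "k < W" using k len leW by auto
    have y: "?y < n" "?y < W" using s k leW unfolding slots_def by auto
    have R': "R' 0 = n" "R' w = ?w" using I regs by auto
    have [simp]: "g k 3 ?w k = ?y" unfolding g_def by simp
    have "upd (upd (g k) 2 ?w ?y 0) 3 ?w k 0 = g (Suc k)"
      unfolding g_def by (auto simp: fun_eq_iff upd_apply lessThan_Suc less_Suc_eq)
    then have "sem W \<epsilon> G (clear_step w) (R', memory n f') = (R', memory n (g (Suc k)))"
      using I R' R5 kn y rW regs W_small unfolding clear_step_def by (simp add: evs)
    then show "ok (clear_step w) R' f' 100
        (\<lambda>R' f'. f' = g (k + 1) \<and> (\<forall>r. r \<noteq> 5 \<longrightarrow> (R'(5 := k + 1)) r = R r))"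
      using I by (intro ok_loop_free[where R' = R' and f' = "g (Suc k)"]) (auto simp: clear_step_def)
  next
    fix k R' f'
    assume k: "k \<le> ?N" and I: "f' = g k \<and> (\<forall>r. r \<noteq> 5 \<longrightarrow> R' r = R r)" and R5: "R' 5 = k"
    have R': "R' 0 = n" "R' w = ?w" using I regs by auto
    have [simp]: "g k 4 ?w 0 = ?N" unfolding g_def by simp
    show "ev R' f' (At 4 (Reg w) zero) = ?N" using I R' rW regs n_pos bdW
      by (simp add: evs W_small)
  qed (use len PB_bounds in \<open>auto simp: clear_step_def g_def\<close>)
  have "ok (clear_slots w) R f ((10 + expr_time (At 4 (Reg w) zero) + ?N * (100 + 10 + expr_time (At 4 (Reg w) zero))) + 20)
    (\<lambda>R' f'. f' = upd (g ?N) 4 ?w 0 0)"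
    unfolding clear_slots_def
  proof (rule ok_Seq[OF loop])
    fix R' f' assume I: "(f' = g ?N \<and> (\<forall>r. r \<noteq> 5 \<longrightarrow> R' r = R r)) \<and> R' 5 = ?N"
    have R': "R' 0 = n" "R' w = ?w" using I regs by auto
    show "ok (Put 4 (Reg w) zero zero) R' f' 20 (\<lambda>R' f'. f' = upd (g ?N) 4 ?w 0 0)"
      by (rule ok_loop_free[where R' = R' and f' = "upd (g ?N) 4 ?w 0 0"])
        (use I R' rW n_pos W_small in \<open>auto simp: evs\<close>)
  qed
  moreover have "upd (g ?N) 4 ?w 0 0 = (\<lambda>j p q. if j \<in> {2, 3, 4} \<and> p = ?w then 0 else f j p q)"
  proof (intro ext)
    fix j p q
    show "upd (g ?N) 4 ?w 0 0 j p q = (if j \<in> {2, 3, 4} \<and> p = ?w then 0 else f j p q)"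
      using t2[of q] t3[of q] t4[of q] unfolding g_def upd_apply slots_def by auto
  qed
  ultimately show ?thesis by (elim ok_mono) auto
qed

end

text \<open>The adjacency bit tells whether a log entry still stands for an edge. Moving the edge
  clears the bit, so later copies of the entry are skipped in the same way as edges deleted before
  the rebuild.\<close>

definition move_step :: "bool \<Rightarrow> com" where
  "move_step vq = Seq (Seq (Assign 1 (At 8 (Reg 10) zero)) (Assign 2 (At 9 (Reg 10) zero)))
     (If (At 0 (Reg 1) (Reg 2))
       (Seq (del_edge vq)
         (Seq (Put 14 (Reg 11) zero (Reg 1)) (Seq (Put 15 (Reg 11) zero (Reg 2)) (Assign 11 (Bin Add (Reg 11) one)))))
       Skip)"

definition reset_step :: com where
  "reset_step = Seq (Seq (Assign 1 (At 8 (Reg 10) zero)) (Seq (Assign 2 (At 9 (Reg 10) zero))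
       (Seq (Put 8 (Reg 10) zero zero) (Put 9 (Reg 10) zero zero))))
     (Seq (clear_slots 1) (clear_slots 2))"

definition light_step :: com where
  "light_step = Seq (Put 6 (At 5 (Reg 10) zero) zero zero) (Put 5 (Reg 10) zero zero)"

text \<open>Truncated subtraction makes the stored value 0, that is capacity one, also when there is
  no edge and \<open>Pow\<close> yields 0.\<close>

definition scalars_prog :: com where
  "scalars_prog = Seq (Seq (Put 10 zero zero zero) (Put 11 zero zero zero))
     (Seq (Put 12 zero zero (Bin Sub (Pow (Reg 11)) one)) (Put 13 zero zero (Bin Div (Reg 11) (Num 2))))"

definition restore_step :: "bool \<Rightarrow> com" where
  "restore_step vq = Seq (Seq (Assign 1 (At 14 (Reg 10) zero)) (Seq (Assign 2 (At 15 (Reg 10) zero))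
       (Seq (Put 14 (Reg 10) zero zero) (Put 15 (Reg 10) zero zero))))
     (add_edge vq)"

text \<open>The loop index lives in register 10 and the number of edges in 11, out of reach of the
  edge programs, which write 5 to 9 only. Deleting the edges returns every count to zero without a
  sweep over the tables.\<close>

definition rebuild :: "bool \<Rightarrow> com" where
  "rebuild vq = Seq (Assign 11 zero) (Seq (For 10 (At 11 zero zero) (move_step vq))
     (Seq (For 10 (At 11 zero zero) reset_step)
     (Seq (For 10 (At 10 zero zero) light_step)
     (Seq scalars_prog (For 10 (Reg 11) (restore_step vq))))))"

lemma ds_inv_cong:
  assumes "ds_inv vq n cap E f" "\<And>j. j < 14 \<or> 15 < j \<Longrightarrow> f' j = f j"
    "\<And>p q. q \<noteq> 0 \<Longrightarrow> f' 14 p q = 0 \<and> f' 15 p q = 0" "\<And>p. f' 14 p 0 < n \<and> f' 15 p 0 < n"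
  shows "ds_inv vq n cap E f'"
proof -
  have E: "edge_set n E" and S: "slots_inv n cap f" and C: "counts_inv vq n E f" and F: "flat n f" and L: "log_inv n E f"
    using assms(1) unfolding ds_inv_def by auto
  have S': "slots_inv n cap f'" "slots f' = slots f" "heavy f' = heavy f"
    by (rule slots_inv_cong[OF S]; use assms(2) in auto)+
  have C': "counts_inv vq n E f'" by (rule counts_inv_cong[OF C]) (use assms(2) S' in auto)
  have t: "f' 4 = f 4" "f' 8 = f 8" "f' 9 = f 9" "f' 11 = f 11" using assms(2) by auto
  have L': "log_inv n E f'" using L unfolding log_inv_def t .
  have "flat n f'" unfolding flat_def
  proof (intro conjI allI impI)
    fix j p q :: nat assume j: "4 \<le> j" "j < 16" "q \<noteq> 0"
    show "f' j p q = 0"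
    proof (cases "j = 14 \<or> j = 15")
      case True
      then show ?thesis using assms(3)[OF j(3), of p] by auto
    next
      case False
      then have "f' j = f j" using j by (intro assms(2)) auto
      then show ?thesis using flatD(1)[OF F j, of p] by simp
    qed
  next
    fix j p q :: nat assume j: "10 \<le> j" "j < 14" "p \<noteq> 0"
    then show "f' j p q = 0" using flatD(2)[OF F j, of q] assms(2)[of j] by simp
  next
    fix j p q :: nat assume j: "j = 1 \<or> 16 < j"
    then have "f' j = f j" by (intro assms(2)) auto
    then show "f' j p q = 0" using flatD(3)[OF F j, of p q] by simp
  next
    fix p show "f' 14 p 0 < n" "f' 15 p 0 < n" using assms(4) by auto
  qed
  then show ?thesis using E S' C' L' unfolding ds_inv_def by blast
qed

text \<open>The log may contain an edge several times; only the first occurrence is moved.\<close>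

definition logged :: "nat set set \<Rightarrow> tables \<Rightarrow> nat \<Rightarrow> nat set set" where
  "logged E f k = {e \<in> E. \<exists>i<k. e = {f 8 i 0, f 9 i 0}}"

lemma logged_Suc:
  "logged E f (Suc k) = (if {f 8 k 0, f 9 k 0} \<in> E then insert {f 8 k 0, f 9 k 0} (logged E f k) else logged E f k)"
  unfolding logged_def by (auto simp: less_Suc_eq)

text \<open>\<open>R 11\<close> is both the length of the list in tables 14 and 15 and the number of
  moved edges, so the list has no repetitions. Slots and log keep their original state, as the next
  loops work through them.\<close>

definition moving :: "bool \<Rightarrow> nat \<Rightarrow> nat \<Rightarrow> nat set set \<Rightarrow> tables \<Rightarrow> nat \<Rightarrow> (nat \<Rightarrow> nat) \<Rightarrow> tables \<Rightarrow> bool" where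
  "moving vq n cap E f0 k R f \<longleftrightarrow>
     ds_inv vq n cap (E - logged E f0 k) f \<and>
     (\<forall>j. j \<notin> {0, 7, 16, 14, 15} \<longrightarrow> f j = f0 j) \<and>
     R 11 = card (logged E f0 k) \<and>
     logged E f0 k = (\<lambda>i. {f 14 i 0, f 15 i 0}) ` {..<R 11} \<and>
     (\<forall>i. f 14 i 0 \<noteq> 0 \<or> f 15 i 0 \<noteq> 0 \<longrightarrow> i < R 11) \<and>
     R 0 = n \<and> (\<forall>r. 12 \<le> r \<longrightarrow> R r = 0)"

lemma movingD:
  assumes "moving vq n cap E f0 k R f"
  shows "ds_inv vq n cap (E - logged E f0 k) f" "\<And>j. j \<notin> {0, 7, 16, 14, 15} \<Longrightarrow> f j = f0 j"
    "R 11 = card (logged E f0 k)" "logged E f0 k = (\<lambda>i. {f 14 i 0, f 15 i 0}) ` {..<R 11}"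
    "\<And>i. f 14 i 0 \<noteq> 0 \<or> f 15 i 0 \<noteq> 0 \<Longrightarrow> i < R 11" "R 0 = n" "\<And>r. 12 \<le> r \<Longrightarrow> R r = 0"
proof -
  note m = assms[unfolded moving_def]
  show "ds_inv vq n cap (E - logged E f0 k) f" by (rule m[THEN conjunct1])
  show "\<And>j. j \<notin> {0, 7, 16, 14, 15} \<Longrightarrow> f j = f0 j" by (rule m[THEN conjunct2, THEN conjunct1, rule_format])
  note m = m[THEN conjunct2, THEN conjunct2]
  show "R 11 = card (logged E f0 k)" by (rule m[THEN conjunct1])
  show "logged E f0 k = (\<lambda>i. {f 14 i 0, f 15 i 0}) ` {..<R 11}" by (rule m[THEN conjunct2, THEN conjunct1])
  note m = m[THEN conjunct2, THEN conjunct2]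
  show "\<And>i. f 14 i 0 \<noteq> 0 \<or> f 15 i 0 \<noteq> 0 \<Longrightarrow> i < R 11" by (rule m[THEN conjunct1, rule_format])
  show "R 0 = n" by (rule m[THEN conjunct2, THEN conjunct1])
  show "\<And>r. 12 \<le> r \<Longrightarrow> R r = 0" by (rule m[THEN conjunct2, THEN conjunct2, rule_format])
qed

lemma movingI:
  assumes "ds_inv vq n cap (E - logged E f0 k) f" "\<And>j. j \<notin> {0, 7, 16, 14, 15} \<Longrightarrow> f j = f0 j"
    "R 11 = card (logged E f0 k)" "logged E f0 k = (\<lambda>i. {f 14 i 0, f 15 i 0}) ` {..<R 11}"
    "\<And>i. f 14 i 0 \<noteq> 0 \<or> f 15 i 0 \<noteq> 0 \<Longrightarrow> i < R 11" "R 0 = n" "\<And>r. 12 \<le> r \<Longrightarrow> R r = 0"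
  shows "moving vq n cap E f0 k R f"
  unfolding moving_def
  by (intro conjI allI impI) (rule assms; assumption)+

context ram
begin

lemma ds_inv_small:
  assumes "ds_inv vq n cap E f" "f 11 0 0 \<le> PB" "cap \<le> PB" "f 13 0 0 \<le> PB"
  shows "small f"
proof -
  have E: "edge_set n E" and S: "slots_inv n cap f" and C: "counts_inv vq n E f" and F: "flat n f" and L: "log_inv n E f"
    using assms(1) unfolding ds_inv_def by auto
  show ?thesis by (rule smallI[OF E S C F]) (use assms slots_invD(12)[OF S] log_invD(2,3)[OF L] in auto)
qed

text \<open>The invariant bounds the tables between rounds, and the time of one body bounds what is
  added within a round. Thus the number of rounds does not enter the space.\<close>

lemma okS_For_tables:
  fixes N :: nat
  assumes step: "\<And>k R f. k < N \<Longrightarrow> Inv k R f \<Longrightarrow> R i = k \<Longrightarrow> ok c R f T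
      (\<lambda>R' f'. Inv (k + 1) (R'(i := k + 1)) f')"
    and "i \<notin> written c" "i < 12"
    and bound: "\<And>k R f. k \<le> N \<Longrightarrow> Inv k R f \<Longrightarrow> R i = k \<Longrightarrow> ev R f e = N"
    and "N \<le> PB" and init: "Inv 0 (R(i := 0)) f" and
    tab: "\<And>k R f. k \<le> N \<Longrightarrow> Inv k R f \<Longrightarrow> tables_le Z f \<and> (\<forall>r. 12 \<le> r \<longrightarrow> R r = 0)"
    and S: "12 + 32 * Z + T \<le> S"
  shows "okS (For i e c) R f (10 + expr_time e + N * (T + 10 + expr_time e)) S
     (\<lambda>R' f'. Inv N R' f' \<and> R' i = N)"
proof (rule okS_For)
  fix k R f assume k: "k < N" "Inv k R f" "R i = k"
  have t: "tables_le Z f" "\<And>r. 12 \<le> r \<Longrightarrow> R r = 0" using tab[of k R f] k by auto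
  note cl = cells_le[where R = R, OF n_pos t]
  have "okS c R f T (cells_in_use (R, memory n f) + T) (\<lambda>R' f'. Inv (k + 1) (R'(i := k + 1)) f')"
    by (rule okS_of_ok[OF step[OF k] cl(1)])
  then show "okS c R f T S (\<lambda>R' f'. R' i = k \<and> Inv (k + 1) (R'(i := k + 1)) f' \<and>
        cells_in_use (R', memory n f') \<le> S \<and> cells_in_use (R'(i := k + 1), memory n f') \<le> S)"
  proof (rule okS_mono)
    show "cells_in_use (R, memory n f) + T \<le> S" using cl(2) S by simp
    fix R' f' assume I: "Inv (k + 1) (R'(i := k + 1)) f'" and fr: "\<And>r. r \<notin> written c \<Longrightarrow> R' r = R r"
    have t': "tables_le Z f'" "\<And>r. 12 \<le> r \<Longrightarrow> (R'(i := k + 1)) r = 0"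
      using tab[OF _ I] k by auto
    have t'': "R' r = 0" if "12 \<le> r" for r using t'(2)[OF that] \<open>i < 12\<close> that by (simp split: if_splits)
    show "R' i = k \<and> Inv (k + 1) (R'(i := k + 1)) f' \<and>
        cells_in_use (R', memory n f') \<le> S \<and> cells_in_use (R'(i := k + 1), memory n f') \<le> S"
      using I fr[OF \<open>i \<notin> written c\<close>] k S
        cells_le(2)[where R = R', OF n_pos t'(1) t''] cells_le(2)[where R = "R'(i := k + 1)", OF n_pos t'] by simp
  qed simp
next
  have t: "tables_le Z f" "\<And>r. 12 \<le> r \<Longrightarrow> (R(i := 0)) r = 0" using tab[OF _ init] by auto
  have t': "R r = 0" if "12 \<le> r" for r using t(2)[OF that] \<open>i < 12\<close> that by (simp split: if_splits)
  show "cells_in_use (R, memory n f) \<le> S" "cells_in_use (R(i := 0), memory n f) \<le> S"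
    using S cells_le(2)[where R = R, OF n_pos t(1) t'] cells_le(2)[where R = "R(i := 0)", OF n_pos t] by simp_all
  show "Inv 0 (R(i := 0)) f" by (rule init)
qed (use assms in auto)

lemma ok_move_step:
  assumes M: "moving vq n cap E f0 k R f" and k: "k < f0 11 0 0" and E: "edge_set n E" and R10: "R 10 = k"
    and b: "f0 11 0 0 \<le> PB" "cap \<le> PB" "f0 13 0 0 \<le> PB" and L: "\<And>i. f0 8 i 0 < n \<and> f0 9 i 0 < n"
  shows "ok (move_step vq) R f (4000 * (cap + (if vq then f0 10 0 0 else 0) + 1))
    (\<lambda>R' f'. moving vq n cap E f0 (k + 1) (R'(10 := k + 1)) f')"
proof -
  let ?u = "f0 8 k 0" and ?v = "f0 9 k 0" and ?D = "logged E f0 k"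
  note MD = movingD[OF M]
  note I = MD(1) and same = MD(2) and R11 = MD(3) and D = MD(4) and z = MD(5) and R0 = MD(6,7)
  have sm: "small f" using ds_inv_small[OF I] b same by simp
  have bd: "f j p q \<le> PB" for j p q using sm unfolding small_def by blast
  have bdW: "f j p q < W" for j p q using bd[of j p q] PB_bounds by linarith
  have uv: "?u < n" "?v < n" using L by auto
  have uvW: "?u < W" "?v < W" "?u \<le> PB" "?v \<le> PB" using uv leW by auto
  have kb: "k \<le> PB" "k < W" using k b PB_bounds by linarith+
  have finE: "finite E" by (rule finite_edge_set[OF E])
  have Dsub: "?D \<subseteq> E" unfolding logged_def by auto
  have "card ?D \<le> card E" by (rule card_mono[OF finE Dsub])
  then have R11b: "R 11 \<le> PB" "R 11 < W" "Suc (R 11) < W"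
    using R11 card_edge_set_le[OF E] PB_bounds by linarith+
  have f89: "f 8 k 0 = ?u" "f 9 k 0 = ?v" using same[of 8] same[of 9] by auto
  let ?R = "R(1 := ?u, 2 := ?v)"
  have s1: "ok (Seq (Assign 1 (At 8 (Reg 10) zero)) (Assign 2 (At 9 (Reg 10) zero))) R f 50 (\<lambda>R' f'. R' = ?R \<and> f' = f)"
    by (rule ok_loop_free[where R' = ?R and f' = f]) (use R0 R10 kb f89 uvW n_pos W_small in \<open>auto simp: evs\<close>)
  have A: "f 0 ?u ?v = of_bool ({?u, ?v} \<in> E - ?D)" using I unfolding ds_inv_def counts_inv_def by auto
  have eA: "ev ?R f (At 0 (Reg 1) (Reg 2)) = of_bool ({?u, ?v} \<in> E - ?D)"
    unfolding A[symmetric] using R0 uvW uv bdW by (simp add: evs)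
  have s2: "ok (If (At 0 (Reg 1) (Reg 2))
       (Seq (del_edge vq)
         (Seq (Put 14 (Reg 11) zero (Reg 1)) (Seq (Put 15 (Reg 11) zero (Reg 2)) (Assign 11 (Bin Add (Reg 11) one)))))
       Skip) ?R f (1 + expr_time (At 0 (Reg 1) (Reg 2)) + (3000 * (cap + (if vq then f 10 0 0 else 0) + 1) + 100))
    (\<lambda>R' f'. moving vq n cap E f0 (k + 1) (R'(10 := k + 1)) f')"
  proof (rule ok_If)
    assume "ev ?R f (At 0 (Reg 1) (Reg 2)) \<noteq> 0"
    then have e: "{?u, ?v} \<in> E - ?D" unfolding eA by auto
    show "ok (Seq (del_edge vq)
         (Seq (Put 14 (Reg 11) zero (Reg 1)) (Seq (Put 15 (Reg 11) zero (Reg 2)) (Assign 11 (Bin Add (Reg 11) one)))))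
        ?R f (3000 * (cap + (if vq then f 10 0 0 else 0) + 1) + 100)
        (\<lambda>R' f'. moving vq n cap E f0 (k + 1) (R'(10 := k + 1)) f')"
    proof (rule ok_Seq[OF ok_del_edge[OF I sm _ _ _ e]])
      fix R1 f1
      assume 1: "ds_inv vq n cap (E - ?D - {{?u, ?v}}) f1 \<and> (\<forall>j. j \<notin> {0, 7, 16} \<longrightarrow> f1 j = f j)"
        and R1: "\<And>r. r \<notin> written (del_edge vq) \<Longrightarrow> R1 r = ?R r"
      have R1': "R1 r = ?R r" if "r < 5 \<or> 9 < r" for r by (rule R1) (rule written_small(3)[OF that])
      have r: "R1 0 = n" "R1 1 = ?u" "R1 2 = ?v" "R1 11 = R 11" "R1 10 = k" "\<And>r. 12 \<le> r \<Longrightarrow> R1 r = 0"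
        using R1' R0 R10 by auto
      let ?f2 = "upd (upd f1 14 (R 11) 0 ?u) 15 (R 11) 0 ?v"
      let ?R2 = "R1(11 := R 11 + 1)"
      have D': "logged E f0 (k + 1) = insert {?u, ?v} ?D" using e logged_Suc[of E f0 k] by auto
      have same1: "f1 14 = f 14" "f1 15 = f 15" using 1 by auto
      have same2: "?f2 j = f1 j" if "j < 14 \<or> 15 < j" for j using that by (auto simp: upd_apply fun_eq_iff)
      have fl: "flat n f" using I unfolding ds_inv_def by auto
      have I2: "ds_inv vq n cap (E - logged E f0 (k + 1)) ?f2"
      proof (rule ds_inv_cong)
        have "E - logged E f0 (k + 1) = E - ?D - {{?u, ?v}}" using D' by auto
        then show "ds_inv vq n cap (E - logged E f0 (k + 1)) f1" using 1 by simp
        show "\<And>j. j < 14 \<or> 15 < j \<Longrightarrow> ?f2 j = f1 j" by (rule same2)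
        fix p q :: nat
        show "?f2 14 p 0 < n \<and> ?f2 15 p 0 < n" using flatD(4,5)[OF fl, of p] uv same1 by (auto simp: upd_apply)
        assume "q \<noteq> 0"
        then show "?f2 14 p q = 0 \<and> ?f2 15 p q = 0" using flatD(1)[OF fl, of 14 q p] flatD(1)[OF fl, of 15 q p] same1 by (auto simp: upd_apply)
      qed
      have M2: "moving vq n cap E f0 (k + 1) (?R2(10 := k + 1)) ?f2"
        unfolding moving_def
      proof (intro conjI allI impI)
        show "ds_inv vq n cap (E - logged E f0 (k + 1)) ?f2" by (rule I2)
        fix j :: nat assume "j \<notin> {0, 7, 16, 14, 15}"
        then have "?f2 j = f1 j" "f1 j = f j" "f j = f0 j" using same2[of j] 1 same[of j] by (auto simp: upd_apply fun_eq_iff)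
        then show "?f2 j = f0 j" by simp
      next
        show "(?R2(10 := k + 1)) 11 = card (logged E f0 (k + 1))"
          using D' e R11 finite_subset[OF Dsub finE] by simp
        have "(\<lambda>i. {?f2 14 i 0, ?f2 15 i 0}) ` {..<Suc (R 11)} = insert {?u, ?v} ((\<lambda>i. {f 14 i 0, f 15 i 0}) ` {..<R 11})"
          using same1 by (auto simp: lessThan_Suc upd_apply image_iff)
        then show "logged E f0 (k + 1) = (\<lambda>i. {?f2 14 i 0, ?f2 15 i 0}) ` {..<(?R2(10 := k + 1)) 11}"
          using D' D by simp
      next
        fix i assume "?f2 14 i 0 \<noteq> 0 \<or> ?f2 15 i 0 \<noteq> 0"
        then show "i < (?R2(10 := k + 1)) 11" using z[of i] same1 by (auto simp: upd_apply split: if_splits)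
      qed (use r in auto)
      show "ok (Seq (Put 14 (Reg 11) zero (Reg 1)) (Seq (Put 15 (Reg 11) zero (Reg 2)) (Assign 11 (Bin Add (Reg 11) one))))
         R1 f1 100 (\<lambda>R' f'. moving vq n cap E f0 (k + 1) (R'(10 := k + 1)) f')"
      proof (rule ok_loop_free[where R' = ?R2 and f' = ?f2])
        show "moving vq n cap E f0 (k + 1) (?R2(10 := k + 1)) ?f2" by (rule M2)
      qed (use r R11b uvW n_pos W_small in \<open>auto simp: evs\<close>)
    qed (use R0 in auto)
  next
    assume "ev ?R f (At 0 (Reg 1) (Reg 2)) = 0"
    then have "{?u, ?v} \<notin> E - ?D" unfolding eA by auto
    \<comment> \<open>A pair outside \<open>E\<close> or an edge met before: neither enlarges the
      logged set.\<close>
    then have D': "logged E f0 (k + 1) = ?D" using logged_Suc[of E f0 k] by auto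
    have "moving vq n cap E f0 (k + 1) (?R(10 := k + 1)) f"
    proof (rule movingI, unfold D')
      show "(?R(10 := k + 1)) 11 = card ?D" using R11 by simp
      show "?D = (\<lambda>i. {f 14 i 0, f 15 i 0}) ` {..<(?R(10 := k + 1)) 11}" using D by simp
    qed (use I same R0 z in auto)
    then show "ok Skip ?R f (3000 * (cap + (if vq then f 10 0 0 else 0) + 1) + 100)
        (\<lambda>R' f'. moving vq n cap E f0 (k + 1) (R'(10 := k + 1)) f')"
      by (intro ok_loop_free) auto
  qed
  have "f 10 = f0 10" using same[of 10] by simp
  moreover have "ok (move_step vq) R f (50 + (1 + expr_time (At 0 (Reg 1) (Reg 2)) + (3000 * (cap + (if vq then f 10 0 0 else 0) + 1) + 100)))
    (\<lambda>R' f'. moving vq n cap E f0 (k + 1) (R'(10 := k + 1)) f')"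
    unfolding move_step_def by (rule ok_Seq[OF s1]) (use s2 in auto)
  ultimately show ?thesis by (elim ok_mono) auto
qed

end

text \<open>What remains true of each row while rows are being cleared, cleared ones included. The
  latter matters since a vertex occurs in the log once for every insertion at it, so its row can be
  visited repeatedly.\<close>

definition row_ok :: "nat \<Rightarrow> nat \<Rightarrow> tables \<Rightarrow> nat \<Rightarrow> bool" where
  "row_ok n cap f w \<longleftrightarrow> f 4 w 0 \<le> n \<and> f 4 w 0 \<le> cap \<and> slots f w \<subseteq> {..<n} \<and> (\<forall>x. f 2 w x \<noteq> 0 \<longrightarrow> x \<in> slots f w) \<and>
     (\<forall>i. f 3 w i \<noteq> 0 \<longrightarrow> i < f 4 w 0) \<and> (\<forall>i. i \<noteq> 0 \<longrightarrow> f 4 w i = 0)"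

lemma row_ok_cleared:
  assumes S: "slots_inv n cap f" and F: "flat n f"
    and h: "\<And>j p q. j = 2 \<or> j = 3 \<or> j = 4 \<Longrightarrow> h j p q = (if p \<in> X then 0 else f j p q)"
  shows "row_ok n cap h w"
proof (cases "w \<in> X")
  case True
  have "h 4 w i = 0" "h 2 w i = 0" "h 3 w i = 0" for i using h[of 4 w i] h[of 2 w i] h[of 3 w i] True by simp_all
  then show ?thesis unfolding row_ok_def slots_def by simp
next
  case False
  then have e: "h 4 w = f 4 w" "h 2 w = f 2 w" "h 3 w = f 3 w" using h by (auto simp: fun_eq_iff)
  have s: "slots h w = slots f w" unfolding slots_def e ..
  have "f 4 w i = 0" if "i \<noteq> 0" for i using flatD(1)[OF F, of 4 i w] that by simp
  moreover have "slots f w \<subseteq> {..<n}" using slots_invD(5)[OF S, of w] by auto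
  moreover have "x \<in> slots f w" if "f 2 w x \<noteq> 0" for x using slots_invD(1)[OF S, of w x] that by (auto split: if_splits)
  ultimately show ?thesis unfolding row_ok_def e s
    using slots_inv_card(3)[OF S, of w] slots_invD(4)[OF S, of w] slots_invD(3)[OF S] by simp
qed

definition log_verts :: "tables \<Rightarrow> nat \<Rightarrow> nat set" where
  "log_verts f k = {w. \<exists>i<k. w = f 8 i 0 \<or> w = f 9 i 0}"

text \<open>The tables after \<open>k\<close> rounds in closed form serve as the loop invariant;
  \<open>lightened\<close> does the same for the loop over the heavy vertices.\<close>

definition cleared :: "tables \<Rightarrow> nat \<Rightarrow> tables" where
  "cleared f k = (\<lambda>j p q. if (j \<in> {2, 3, 4} \<and> p \<in> log_verts f k) \<or> (j \<in> {8, 9} \<and> p < k) then 0 else f j p q)"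

definition lightened :: "tables \<Rightarrow> nat \<Rightarrow> tables" where
  "lightened f k = (\<lambda>j p q. if (j = 6 \<and> p \<in> (\<lambda>i. f 5 i 0) ` {..<k}) \<or> (j = 5 \<and> p < k) then 0 else f j p q)"

text \<open>Each heavy vertex has \<open>cap\<close> slots, and the log pays for all slots. This
  limits the cost of every scan of the heavy vertices.\<close>

lemma heavy_count:
  assumes "ds_inv vq n cap E f"
  shows "f 10 0 0 * cap \<le> 2 * f 11 0 0"
proof -
  have S: "slots_inv n cap f" and L: "log_inv n E f" using assms unfolding ds_inv_def by auto
  have "f 10 0 0 * cap = (\<Sum>w\<in>heavy f. f 4 w 0)"
    using slots_invD(11)[OF S] slots_inv_card(2)[OF S] by simp
  also have "\<dots> \<le> (\<Sum>w<n. f 4 w 0)" by (rule sum_mono2) (use slots_invD(9)[OF S] in auto)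
  also have "\<dots> \<le> 2 * f 11 0 0" by (rule log_invD(6)[OF L])
  finally show ?thesis .
qed

context ram
begin

lemma ok_clear_slots_row:
  assumes "w \<notin> {0, 5}" "R 0 = n" "R w < n" "small f" "row_ok n cap f (R w)"
  shows "ok (clear_slots w) R f (200 * (cap + 1))
    (\<lambda>R' f'. f' = (\<lambda>j p q. if j \<in> {2, 3, 4} \<and> p = R w then 0 else f j p q))"
  by (rule ok_mono[OF ok_clear_slots]) (use assms in \<open>auto simp: row_ok_def\<close>)

lemma small_mono: "small f \<Longrightarrow> (\<And>j p q. g j p q = 0 \<or> g j p q = f j p q) \<Longrightarrow> small g"
  unfolding small_def by (metis zero_le)

lemma ok_reset_step:
  assumes S: "slots_inv n cap f" and F: "flat n f" and b: "small f" and L: "\<And>i. f 8 i 0 < n \<and> f 9 i 0 < n"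
    and R: "R 0 = n" "R 10 = k" "k \<le> PB"
  shows "ok reset_step R (cleared f k) (600 * (cap + 1)) (\<lambda>R' f'. f' = cleared f (k + 1))"
proof -
  let ?u = "f 8 k 0" and ?v = "f 9 k 0" and ?V = "log_verts f k"
  have uv: "?u < n" "?v < n" using L by auto
  have uvW: "?u < W" "?v < W" "?u \<le> PB" "?v \<le> PB" using uv leW by auto
  have kW: "k < W" using R PB_bounds by linarith
  define g where "g = upd (upd (cleared f k) 8 k 0 0) 9 k 0 0"
  define g1 where "g1 = (\<lambda>j p q. if j \<in> {2, 3, 4} \<and> p = ?u then 0 else g j p q)"
  define g2 where "g2 = (\<lambda>j p q. if j \<in> {2, 3, 4} \<and> p = ?v then 0 else g1 j p q)"
  have sg: "small g" by (rule small_mono[OF b]) (auto simp: g_def cleared_def upd_apply)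
  have sg1: "small g1" by (rule small_mono[OF sg]) (auto simp: g1_def)
  have rg: "row_ok n cap g w" for w
    by (rule row_ok_cleared[OF S F, where X = ?V]) (auto simp: g_def cleared_def upd_apply)
  have rg1: "row_ok n cap g1 w" for w
    by (rule row_ok_cleared[OF S F, where X = "insert ?u ?V"]) (auto simp: g1_def g_def cleared_def upd_apply)
  let ?R = "R(1 := ?u, 2 := ?v)"
  have c89: "cleared f k 8 k 0 = ?u" "cleared f k 9 k 0 = ?v" unfolding cleared_def by auto
  have s1: "ok (Seq (Assign 1 (At 8 (Reg 10) zero)) (Seq (Assign 2 (At 9 (Reg 10) zero))
       (Seq (Put 8 (Reg 10) zero zero) (Put 9 (Reg 10) zero zero)))) R (cleared f k) 150 (\<lambda>R' f'. R' = ?R \<and> f' = g)"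
    by (rule ok_loop_free[where R' = ?R and f' = g])
      (use R kW uvW c89 n_pos W_small in \<open>auto simp: evs g_def\<close>)
  have wr: "written (clear_slots w) = {5}" for w by (auto simp: clear_slots_def clear_step_def)
  have s2: "ok (clear_slots 1) ?R g (200 * (cap + 1)) (\<lambda>R' f'. f' = g1)"
    by (rule ok_mono[OF ok_clear_slots_row[where cap = cap]]) (use R uv sg rg in \<open>auto simp: g1_def\<close>)
  have s3: "ok (clear_slots 2) R' g1 (200 * (cap + 1)) (\<lambda>R' f'. f' = g2)" if "R' 0 = n" "R' 2 = ?v" for R'
    by (rule ok_mono[OF ok_clear_slots_row[where cap = cap]]) (use that uv sg1 rg1 in \<open>auto simp: g2_def\<close>)
  have "ok reset_step R (cleared f k) (150 + (200 * (cap + 1) + 200 * (cap + 1))) (\<lambda>R' f'. f' = g2)"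
    unfolding reset_step_def
  proof (rule ok_Seq[OF s1], elim conjE, hypsubst)
    show "ok (Seq (clear_slots 1) (clear_slots 2)) ?R g (200 * (cap + 1) + 200 * (cap + 1)) (\<lambda>R' f'. f' = g2)"
      by (rule ok_Seq[OF s2], hypsubst, rule s3) (use R in \<open>auto simp: wr\<close>)
  qed
  moreover have "g2 = cleared f (k + 1)"
  proof (intro ext)
    fix j p q
    have V: "log_verts f (k + 1) = insert ?u (insert ?v ?V)" unfolding log_verts_def by (auto simp: less_Suc_eq)
    \<comment> \<open>Only column 0 is written, and the other columns of these tables are zero
      anyway.\<close>
    have z: "f j p q = 0" if "q \<noteq> 0" "j = 8 \<or> j = 9" using flatD(1)[OF F, of j q p] that by auto
    show "g2 j p q = cleared f (k + 1) j p q"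
      using z unfolding g2_def g1_def g_def cleared_def V upd_apply by (auto simp: less_Suc_eq)
  qed
  ultimately show ?thesis by (elim ok_mono) auto
qed

lemma ok_light_step:
  assumes F: "flat n f" and b: "small f" and k: "f 5 k 0 < n"
    and R: "R 0 = n" "R 10 = k" "k \<le> PB"
  shows "ok light_step R (lightened f k) 80 (\<lambda>R' f'. f' = lightened f (k + 1))"
proof (rule ok_loop_free[where R' = R and f' = "upd (upd (lightened f k) 6 (f 5 k 0) 0 0) 5 k 0 0"])
  have kW: "k < W" "f 5 k 0 < W" "f 5 k 0 \<le> PB" using R k PB_bounds by linarith+
  have l: "lightened f k 5 k 0 = f 5 k 0" unfolding lightened_def by auto
  then show "sem W \<epsilon> G light_step (R, memory n (lightened f k)) =
     (R, memory n (upd (upd (lightened f k) 6 (f 5 k 0) 0 0) 5 k 0 0))"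
    unfolding light_step_def using R kW n_pos W_small by (simp add: evs)
  show "upd (upd (lightened f k) 6 (f 5 k 0) 0 0) 5 k 0 0 = lightened f (k + 1)"
  proof (intro ext)
    fix j p q
    have z: "f j p q = 0" if "q \<noteq> 0" "j = 5 \<or> j = 6" using flatD(1)[OF F, of j q p] that by auto
    show "upd (upd (lightened f k) 6 (f 5 k 0) 0 0) 5 k 0 0 j p q = lightened f (k + 1) j p q"
      using z unfolding lightened_def upd_apply by (auto simp: less_Suc_eq lessThan_Suc)
  qed
qed (auto simp: light_step_def)

lemma ok_scalars_prog:
  assumes R: "R 0 = n" "R 11 = m" "m \<le> PB" and eps: "0 < \<epsilon>" "\<epsilon> < 1"
  shows "ok scalars_prog R f 150 (\<lambda>R' f'. R' = R \<and> f' = upd (upd (upd (upd f 10 0 0 0) 11 0 0 0)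
     12 0 0 (nat \<lfloor>real m powr \<epsilon>\<rfloor> - 1)) 13 0 0 (m div 2))"
proof (rule ok_loop_free[where R' = R])
  have "real m powr \<epsilon> \<le> real m"
  proof (cases "m = 0")
    case False
    then have "real m powr \<epsilon> \<le> real m powr 1" using eps by (intro powr_mono) auto
    then show ?thesis using False by simp
  qed simp
  then have "nat \<lfloor>real m powr \<epsilon>\<rfloor> \<le> m" by linarith
  moreover have mW: "m < W" "2 < W" "m div 2 < W" using R PB_bounds by linarith+
  ultimately have pW: "nat \<lfloor>real m powr \<epsilon>\<rfloor> < W" by linarith
  have e1: "ev R f' (Pow (Reg 11)) = nat \<lfloor>real m powr \<epsilon>\<rfloor>" for f' using R mW pW by (simp add: eval.simps)
  have e2: "ev R f' (Bin Div (Reg 11) (Num 2)) = m div 2" for f' using R mW by (simp add: eval.simps)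
  show "sem W \<epsilon> G scalars_prog (R, memory n f) = (R, memory n (upd (upd (upd (upd f 10 0 0 0) 11 0 0 0)
     12 0 0 (nat \<lfloor>real m powr \<epsilon>\<rfloor> - 1)) 13 0 0 (m div 2)))"
    unfolding scalars_prog_def using R n_pos W_small by (simp add: evs e1 e2)
qed (auto simp: scalars_prog_def)

end

definition restoring :: "bool \<Rightarrow> nat \<Rightarrow> nat \<Rightarrow> tables \<Rightarrow> nat \<Rightarrow> nat \<Rightarrow> (nat \<Rightarrow> nat) \<Rightarrow> tables \<Rightarrow> bool" where
  "restoring vq n cap f1 m k R f \<longleftrightarrow>
     ds_inv vq n cap ((\<lambda>i. {f1 14 i 0, f1 15 i 0}) ` {..<k}) f \<and> f 11 0 0 = k \<and> f 13 0 0 = m div 2 \<and>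
     (\<forall>p q. f 14 p q = (if p < k then 0 else f1 14 p q) \<and> f 15 p q = (if p < k then 0 else f1 15 p q)) \<and>
     R 11 = m \<and> R 0 = n \<and> (\<forall>r. 12 \<le> r \<longrightarrow> R r = 0)"

lemma restoringD:
  assumes "restoring vq n cap f1 m k R f"
  shows "ds_inv vq n cap ((\<lambda>i. {f1 14 i 0, f1 15 i 0}) ` {..<k}) f" "f 11 0 0 = k" "f 13 0 0 = m div 2"
    "\<And>p q. f 14 p q = (if p < k then 0 else f1 14 p q)" "\<And>p q. f 15 p q = (if p < k then 0 else f1 15 p q)"
    "R 11 = m" "R 0 = n" "\<And>r. 12 \<le> r \<Longrightarrow> R r = 0"
  using assms unfolding restoring_def by simp_all

lemma card_le_log:
  assumes "ds_inv vq n cap E f"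
  shows "card E \<le> f 11 0 0"
proof -
  have L: "log_inv n E f" using assms unfolding ds_inv_def by auto
  have "E \<subseteq> (\<lambda>i. {f 8 i 0, f 9 i 0}) ` {..<f 11 0 0}" using log_invD(4)[OF L] by fastforce
  then have "card E \<le> card ((\<lambda>i. {f 8 i 0, f 9 i 0}) ` {..<f 11 0 0})" by (intro card_mono) auto
  also have "\<dots> \<le> card {..<f 11 0 0}" by (rule card_image_le) simp
  finally show ?thesis by simp
qed

text \<open>Covers both the initial zero memory, with capacity one, and the moment of a rebuild at
  which all edges wait in tables 14 and 15.\<close>

lemma ds_inv_fresh:
  assumes z: "\<And>j p q. j \<notin> {12, 13, 14, 15} \<Longrightarrow> f j p q = 0" and c: "f 12 0 0 = cap - 1" "1 \<le> cap"
    and n: "0 < n" and fl: "\<And>j p q. j = 12 \<or> j = 13 \<Longrightarrow> p \<noteq> 0 \<or> q \<noteq> 0 \<Longrightarrow> f j p q = 0"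
    and f1: "\<And>p q. q \<noteq> 0 \<Longrightarrow> f 14 p q = 0 \<and> f 15 p q = 0" "\<And>p. f 14 p 0 < n \<and> f 15 p 0 < n"
  shows "ds_inv vq n cap {} f"
proof -
  have sl: "slots f w = {}" for w unfolding slots_def using z by simp
  have h: "heavy f = {}" unfolding heavy_def using z by simp
  have "slots_inv n cap f" unfolding slots_inv_def sl h using z c by simp
  moreover have "counts_inv vq n {} f" unfolding counts_inv_def using z by (simp add: codeg_def tri_def)
  moreover have "log_inv n {} f" unfolding log_inv_def using z n by simp
  moreover have "flat n f" unfolding flat_def
  proof (intro conjI allI impI)
    fix j p q :: nat assume j: "4 \<le> j" "j < 16" "q \<noteq> 0"
    show "f j p q = 0"
    proof (cases "j \<in> {12, 13, 14, 15}")
      case True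
      then show ?thesis using fl[of j p q] f1(1)[of q p] j by auto
    next
      case False
      then show ?thesis using z by simp
    qed
  next
    fix j p q :: nat assume j: "10 \<le> j" "j < 14" "p \<noteq> 0"
    show "f j p q = 0"
    proof (cases "j = 12 \<or> j = 13")
      case True
      then show ?thesis using fl[of j p q] j by auto
    next
      case False
      then show ?thesis using z[of j p q] j by auto
    qed
  next
    fix j p q :: nat assume j: "j = 1 \<or> 16 < j"
    then show "f j p q = 0" using z[of j p q] by auto
  next
    fix p show "f 14 p 0 < n" "f 15 p 0 < n" using f1(2) by auto
  qed
  ultimately show ?thesis unfolding ds_inv_def edge_set_def by simp
qed

context ram
begin

lemma ok_restore_step:
  assumes M: "restoring vq n cap f1 m k R f" and k: "k < m" and R10: "R 10 = k"
    and E: "edge_set n E" and Eq: "E = (\<lambda>i. {f1 14 i 0, f1 15 i 0}) ` {..<m}" and m: "m = card E"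
    and F1: "flat n f1" and cap: "cap \<le> PB"
  shows "ok (restore_step vq) R f (9500 * (cap + (if vq then 2 * m div cap else 0) + 1))
    (\<lambda>R' f'. restoring vq n cap f1 m (k + 1) (R'(10 := k + 1)) f')"
proof -
  let ?u = "f1 14 k 0" and ?v = "f1 15 k 0" and ?e = "\<lambda>i. {f1 14 i 0, f1 15 i 0}"
  note MD = restoringD[OF M]
  \<comment> \<open>A list of length \<open>m\<close> that enumerates \<open>m\<close> edges has no
    repetitions, so every restored edge is new.\<close>
  have inj: "inj_on ?e {..<m}" by (rule eq_card_imp_inj_on) (use m Eq in auto)
  have "?e k \<in> E" using k Eq by auto
  then have uv: "?u < n" "?v < n" "?u \<noteq> ?v" using edge_setD[OF E] by auto
  have new: "?e k \<notin> ?e ` {..<k}" using inj_on_lessThan_new[OF inj k] .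
  have uvW: "?u < W" "?v < W" using uv leW by auto
  have mb: "m \<le> n * n" using card_edge_set_le[OF E] m by simp
  have mPB: "m < PB" using mb unfolding PB_def by simp
  then have kb: "k \<le> PB" "k < W" using k PB_bounds by linarith+
  let ?R = "R(1 := ?u, 2 := ?v)"
  define g where "g = upd (upd f 14 k 0 0) 15 k 0 0"
  have f14: "f 14 k 0 = ?u" "f 15 k 0 = ?v" using MD(4)[of k 0] MD(5)[of k 0] by auto
  have s1: "ok (Seq (Assign 1 (At 14 (Reg 10) zero)) (Seq (Assign 2 (At 15 (Reg 10) zero))
       (Seq (Put 14 (Reg 10) zero zero) (Put 15 (Reg 10) zero zero)))) R f 150 (\<lambda>R' f'. R' = ?R \<and> f' = g)"
    by (rule ok_loop_free[where R' = ?R and f' = g])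
      (use MD(7) R10 kb uvW f14 n_pos W_small in \<open>auto simp: evs g_def\<close>)
  have same: "g j = f j" if "j < 14 \<or> 15 < j" for j using that unfolding g_def by (auto simp: upd_apply fun_eq_iff)
  have g14: "g 14 p q = (if p < k + 1 then 0 else f1 14 p q)" "g 15 p q = (if p < k + 1 then 0 else f1 15 p q)" for p q
    using MD(4)[of p q] MD(5)[of p q] flatD(1)[OF F1, of 14 q p] flatD(1)[OF F1, of 15 q p] unfolding g_def
    by (auto simp: upd_apply less_Suc_eq)
  have Ig: "ds_inv vq n cap (?e ` {..<k}) g"
  proof (rule ds_inv_cong[OF MD(1) same])
    fix p q :: nat
    show "g 14 p 0 < n \<and> g 15 p 0 < n" using flatD(4,5)[OF F1, of p] n_pos unfolding g14 by auto
    assume "q \<noteq> 0"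
    then show "g 14 p q = 0 \<and> g 15 p q = 0" using flatD(1)[OF F1, of 14 q p] flatD(1)[OF F1, of 15 q p] unfolding g14 by auto
  qed
  have t: "g 11 0 0 = k" "g 13 0 0 = m div 2" "g 10 = f 10" using same[of 11] same[of 13] same[of 10] MD(2,3) by auto
  have s2: "ok (add_edge vq) ?R g (9000 * (cap + (if vq then g 10 0 0 else 0) + 1))
    (\<lambda>R' f'. ds_inv vq n cap (insert (?e k) (?e ` {..<k})) f' \<and> f' 11 0 0 = g 11 0 0 + 1 \<and> (\<forall>j. j \<in> {12, 13, 14, 15} \<longrightarrow> f' j = g j))"
    by (rule ok_add_edge[OF Ig]) (use t k mPB cap MD(7) uv new in auto)
  have cap1: "1 \<le> cap" using Ig slots_invD(12)[of n cap g] unfolding ds_inv_def by simp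
  \<comment> \<open>The new log has \<open>k < m\<close> entries so far, and
    \<open>heavy_count\<close> applies under the new capacity.\<close>
  have h: "g 10 0 0 \<le> 2 * m div cap"
  proof -
    have "g 10 0 0 * cap \<le> 2 * m" using heavy_count[OF Ig] t k by simp
    then show ?thesis using cap1 by (simp add: less_eq_div_iff_mult_less_eq)
  qed
  have "ok (restore_step vq) R f (150 + 9000 * (cap + (if vq then g 10 0 0 else 0) + 1))
    (\<lambda>R' f'. restoring vq n cap f1 m (k + 1) (R'(10 := k + 1)) f')"
    unfolding restore_step_def
  proof (rule ok_Seq[OF s1], elim conjE, hypsubst, rule ok_mono[OF s2])
    fix R' f' assume 1: "ds_inv vq n cap (insert (?e k) (?e ` {..<k})) f' \<and> f' 11 0 0 = g 11 0 0 + 1 \<and> (\<forall>j. j \<in> {12, 13, 14, 15} \<longrightarrow> f' j = g j)"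
      and fr: "\<And>r. r \<notin> written (add_edge vq) \<Longrightarrow> R' r = ?R r"
    have fr': "R' r = ?R r" if "r < 5 \<or> 9 < r" for r by (rule fr) (rule written_small(2)[OF that])
    have e: "insert (?e k) (?e ` {..<k}) = ?e ` {..<k + 1}" by (auto simp: lessThan_Suc)
    have f': "f' 13 = g 13" "f' 14 = g 14" "f' 15 = g 15" using 1 by auto
    show "restoring vq n cap f1 m (k + 1) (R'(10 := k + 1)) f'"
      unfolding restoring_def e[symmetric] f'
      using 1 t g14 fr'[of 11] fr'[of 0] fr' MD(6-8) by simp
  qed simp
  then show ?thesis by (rule ok_mono) (use h in auto)
qed

lemma for_time_le:
  fixes N M T c e :: nat
  assumes "N \<le> M" "T + 10 + e \<le> c" shows "10 + e + N * (T + 10 + e) \<le> (M + 1) * c"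
proof -
  have "10 + e + N * (T + 10 + e) \<le> (N + 1) * (T + 10 + e)" by simp
  also have "\<dots> \<le> (M + 1) * c" by (rule mult_mono) (use assms in auto)
  finally show ?thesis .
qed

text \<open>\<open>X\<close> adds up the cost of an edge under the old and under the new capacity,
  and each log entry causes a bounded number of edge operations. The two assumptions on
  \<open>Z\<close> are for the loops before and after the change of capacity.\<close>

lemma okS_rebuild:
  assumes I: "ds_inv vq n cap E f" and b: "f 11 0 0 \<le> PB" "cap \<le> PB" "f 13 0 0 \<le> PB"
    and temp: "\<And>p. f 14 p 0 = 0 \<and> f 15 p 0 = 0"
    and R: "R 0 = n" "\<And>r. 12 \<le> r \<Longrightarrow> R r = 0" and eps: "0 < \<epsilon>" "\<epsilon> < 1"
    and m: "m = card E" and cap': "cap' = Suc (nat \<lfloor>real m powr \<epsilon>\<rfloor> - 1)"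
    and Z: "min (n * n) (2 * m + cap * (2 * f 11 0 0)) + f 11 0 0 + m + 1 \<le> Z"
      "min (n * n) (2 * m + cap' * (2 * m)) + m + m + 1 \<le> Z"
    and X: "X = (cap + (if vq then f 10 0 0 else 0) + 1) + (cap' + (if vq then 2 * m div cap' else 0) + 1)"
  shows "okS (rebuild vq) R f (20000 * ((f 11 0 0 + 1) * X)) (12 + 32 * Z + 10000 * X)
    (\<lambda>R' f'. ds_inv vq n cap' E f' \<and> f' 11 0 0 = m \<and> f' 13 0 0 = m div 2 \<and> (\<forall>p. f' 14 p 0 = 0 \<and> f' 15 p 0 = 0))"
proof -
  let ?L = "f 11 0 0" and ?S = "12 + 32 * Z + 10000 * X"
  have E: "edge_set n E" and S: "slots_inv n cap f" and F: "flat n f" and L: "log_inv n E f"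
    using I unfolding ds_inv_def by auto
  have finE: "finite E" by (rule finite_edge_set[OF E])
  have mL: "m \<le> ?L" using card_le_log[OF I] m by simp
  have mn: "m \<le> n * n" using card_edge_set_le[OF E] m by simp
  have mPB: "m \<le> PB" using mn PB_bounds by linarith
  have cap1: "1 \<le> cap" using slots_invD(12)[OF S] by simp
  have X1: "cap + (if vq then f 10 0 0 else 0) + 1 \<le> X" "cap' + (if vq then 2 * m div cap' else 0) + 1 \<le> X" "1 \<le> X" "cap + 1 \<le> X"
    using X by auto
  have capPB: "cap' \<le> PB"
  proof -
    have "real m powr \<epsilon> \<le> real m"
    proof (cases "m = 0")
      case False
      then have "real m powr \<epsilon> \<le> real m powr 1" using eps by (intro powr_mono) auto
      then show ?thesis using False by simp
    qed simp
    then have "nat \<lfloor>real m powr \<epsilon>\<rfloor> \<le> m" by linarith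
    then show ?thesis using mPB PB_bounds cap' by linarith
  qed
  let ?R0 = "R(11 := 0)"
  have M0: "moving vq n cap E f 0 (?R0(10 := 0)) f"
    by (rule movingI) (use I R temp in \<open>auto simp: logged_def\<close>)
  have tab1: "tables_le Z f' \<and> (\<forall>r. 12 \<le> r \<longrightarrow> R' r = 0)" if "moving vq n cap E f k R' f'" for k R' f'
  proof -
    note MD = movingD[OF that]
    have D: "card (logged E f k) \<le> m" unfolding m logged_def by (rule card_mono[OF finE]) auto
    have D': "card (E - logged E f k) \<le> m" unfolding m by (rule card_mono[OF finE]) auto
    have f11: "f' 11 = f 11" using MD(2)[of 11] by simp
    have "log_inv n (E - logged E f k) f'" using MD(1) unfolding ds_inv_def by simp
    from log_invD(6)[OF this] have "(\<Sum>w<n. f' 4 w 0) \<le> 2 * ?L" using f11 by simp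
    from ds_inv_tables_le[OF MD(1) MD(5) this]
    have "tables_le (min (n * n) (2 * card (E - logged E f k) + cap * (2 * ?L)) + f' 11 0 0 + R' 11 + 1) f'" .
    moreover have "min (n * n) (2 * card (E - logged E f k) + cap * (2 * ?L)) + f' 11 0 0 + R' 11 + 1 \<le> Z"
      using Z(1) D D' MD(3) f11 by (simp add: min_def split: if_splits)
    ultimately show ?thesis using MD(7) tables_le_weaken by blast
  qed
  have ev11: "ev R' f' (At 11 zero zero) = f' 11 0 0" if "R' 0 = n" "f' 11 0 0 \<le> PB" for R' f'
  proof -
    have "f' 11 0 0 < W" using that(2) PB_bounds by linarith
    then show ?thesis using that n_pos W_small by (simp add: evs)
  qed
  have s1: "okS (For 10 (At 11 zero zero) (move_step vq)) ?R0 f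
     (10 + expr_time (At 11 zero zero) + ?L * (4000 * (cap + (if vq then f 10 0 0 else 0) + 1) + 10 + expr_time (At 11 zero zero))) ?S
     (\<lambda>R' f'. moving vq n cap E f ?L R' f' \<and> R' 10 = ?L)"
  proof (rule okS_For_tables[where Z = Z and Inv = "moving vq n cap E f"])
    fix k R' f' assume k: "k < ?L" and M: "moving vq n cap E f k R' f'" and R10: "R' 10 = k"
    show "ok (move_step vq) R' f' (4000 * (cap + (if vq then f 10 0 0 else 0) + 1))
       (\<lambda>R' f'. moving vq n cap E f (k + 1) (R'(10 := k + 1)) f')"
      by (rule ok_move_step[OF M k E R10 b]) (use log_invD(2,3)[OF L] in simp)
  next
    show "10 \<notin> written (move_step vq)" using written_small(3)[of 10 vq] by (simp add: move_step_def)
    fix k R' f' assume "k \<le> ?L" and M: "moving vq n cap E f k R' f'" and R10: "R' 10 = k"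
    have "f' 11 = f 11" using movingD(2)[OF M, of 11] by simp
    then show "ev R' f' (At 11 zero zero) = ?L" using ev11[of R' f'] movingD(6)[OF M] b by simp
  next
    show "12 + 32 * Z + 4000 * (cap + (if vq then f 10 0 0 else 0) + 1) \<le> ?S" by (intro add_left_mono mult_le_mono X1) simp
  qed (use M0 b tab1 in auto)
  have s2: "okS (Seq (For 10 (At 11 zero zero) reset_step)
     (Seq (For 10 (At 10 zero zero) light_step)
     (Seq scalars_prog (For 10 (Reg 11) (restore_step vq))))) R1 f1 (15000 * ((?L + 1) * X)) ?S
     (\<lambda>R' f'. ds_inv vq n cap' E f' \<and> f' 11 0 0 = m \<and> f' 13 0 0 = m div 2 \<and> (\<forall>p. f' 14 p 0 = 0 \<and> f' 15 p 0 = 0))"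
    if M1: "moving vq n cap E f ?L R1 f1" for R1 f1
  proof -
    note MD = movingD[OF M1]
    \<comment> \<open>Every edge has a log entry, so the first loop has moved all of them.\<close>
    have lE: "logged E f ?L = E" unfolding logged_def using log_invD(4)[OF L] by auto
    have I1: "ds_inv vq n cap {} f1" using MD(1) lE by simp
    have S1: "slots_inv n cap f1" and C1: "counts_inv vq n {} f1" and F1: "flat n f1" and L1: "log_inv n {} f1"
      using I1 unfolding ds_inv_def by auto
    have same1: "f1 11 = f 11" "f1 13 = f 13" "f1 10 = f 10" using MD(2)[of 11] MD(2)[of 13] MD(2)[of 10] by auto
    have R11: "R1 11 = m" using MD(3) lE m by simp
    have Eq: "E = (\<lambda>i. {f1 14 i 0, f1 15 i 0}) ` {..<m}" using MD(4) lE R11 by simp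
    have sm1: "small f1" using ds_inv_small[OF I1] b same1 by simp
    have t1: "tables_le Z f1" using tab1[OF M1] by blast
    \<comment> \<open>With \<open>cap\<close> at least one, the loop over the heavy vertices has at
      most two rounds for each log entry.\<close>
    have h: "f 10 0 0 \<le> 2 * ?L"
    proof -
      have "f 10 0 0 * 1 \<le> f 10 0 0 * cap" using cap1 by (intro mult_left_mono) auto
      then show ?thesis using heavy_count[OF I] by linarith
    qed
    have hn: "f 10 0 0 \<le> n" using slots_inv_card(4)[OF S] .
    have p2: "okS (For 10 (At 11 zero zero) reset_step) R1 f1
       (10 + expr_time (At 11 zero zero) + ?L * (600 * (cap + 1) + 10 + expr_time (At 11 zero zero))) ?S
       (\<lambda>R' f'. (f' = cleared f1 ?L \<and> R' 11 = m \<and> R' 0 = n \<and> (\<forall>r. 12 \<le> r \<longrightarrow> R' r = 0)) \<and> R' 10 = ?L)"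
    proof (rule okS_For_tables[where Z = Z and Inv = "\<lambda>k R' f'. f' = cleared f1 k \<and> R' 11 = m \<and> R' 0 = n \<and> (\<forall>r. 12 \<le> r \<longrightarrow> R' r = 0)"])
      have wr: "written reset_step = {1, 2, 5}" by (auto simp: reset_step_def clear_slots_def clear_step_def)
      show "10 \<notin> written reset_step" unfolding wr by simp
      fix k and R' :: "nat \<Rightarrow> nat" and f' :: tables assume k: "k < ?L" and J: "f' = cleared f1 k \<and> R' 11 = m \<and> R' 0 = n \<and> (\<forall>r. 12 \<le> r \<longrightarrow> R' r = 0)" and R10: "R' 10 = k"
      have "ok reset_step R' (cleared f1 k) (600 * (cap + 1)) (\<lambda>R' f'. f' = cleared f1 (k + 1))"
        by (rule ok_reset_step[OF S1 F1 sm1]) (use J R10 k b log_invD(2,3)[OF L1] in auto)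
      then show "ok reset_step R' f' (600 * (cap + 1)) (\<lambda>R' f'. f' = cleared f1 (k + 1) \<and> (R'(10 := k + 1)) 11 = m \<and>
          (R'(10 := k + 1)) 0 = n \<and> (\<forall>r. 12 \<le> r \<longrightarrow> (R'(10 := k + 1)) r = 0))"
        unfolding conjunct1[OF J] by (rule ok_mono) (use J in \<open>auto simp: wr\<close>)
    next
      fix k and R' :: "nat \<Rightarrow> nat" and f' :: tables assume J: "f' = cleared f1 k \<and> R' 11 = m \<and> R' 0 = n \<and> (\<forall>r. 12 \<le> r \<longrightarrow> R' r = 0)"
      have "f' 11 = f1 11" using J unfolding cleared_def by simp
      then show "ev R' f' (At 11 zero zero) = ?L" using ev11[of R' f'] J b same1 by simp
    next
      show "12 + 32 * Z + 600 * (cap + 1) \<le> ?S" by (intro add_left_mono mult_le_mono X1) simp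
    next
      show "f1 = cleared f1 0 \<and> (R1(10 := 0)) 11 = m \<and> (R1(10 := 0)) 0 = n \<and> (\<forall>r. 12 \<le> r \<longrightarrow> (R1(10 := 0)) r = 0)"
        using R11 MD(6,7) by (auto simp: cleared_def log_verts_def fun_eq_iff)
    next
      fix k and R' :: "nat \<Rightarrow> nat" and f' :: tables assume J: "f' = cleared f1 k \<and> R' 11 = m \<and> R' 0 = n \<and> (\<forall>r. 12 \<le> r \<longrightarrow> R' r = 0)"
      have "tables_le Z (cleared f1 k)" by (rule tables_le_mono[OF t1]) (auto simp: cleared_def split: if_splits)
      then show "tables_le Z f' \<and> (\<forall>r. 12 \<le> r \<longrightarrow> R' r = 0)" using J by simp
    qed (use b in auto)
    define f2 where "f2 = cleared f1 ?L"
    have t2: "tables_le Z f2" by (rule tables_le_mono[OF t1]) (auto simp: f2_def cleared_def split: if_splits)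
    have sm2: "small f2" by (rule small_mono[OF sm1]) (auto simp: f2_def cleared_def)
    have F2: "flat n f2" using F1 unfolding f2_def cleared_def flat_def by auto
    have same2: "f2 5 = f1 5" "f2 10 = f1 10" unfolding f2_def cleared_def by auto
    have f5: "f2 5 k 0 < n" for k
    proof (cases "f1 5 k 0 = 0")
      case False
      then have "f1 5 k 0 \<in> heavy f1" using slots_invD(8)[OF S1, of k] unfolding heavy_def by auto
      then show ?thesis using slots_invD(9)[OF S1] same2 by auto
    qed (use n_pos same2 in auto)
    have p3: "okS (For 10 (At 10 zero zero) light_step) R2 f2
       (10 + expr_time (At 10 zero zero) + f 10 0 0 * (80 + 10 + expr_time (At 10 zero zero))) ?S
       (\<lambda>R' f'. (f' = lightened f2 (f 10 0 0) \<and> R' 11 = m \<and> R' 0 = n \<and> (\<forall>r. 12 \<le> r \<longrightarrow> R' r = 0)) \<and> R' 10 = f 10 0 0)"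
      if R2: "R2 11 = m \<and> R2 0 = n \<and> (\<forall>r. 12 \<le> r \<longrightarrow> R2 r = 0)" for R2
    proof (rule okS_For_tables[where Z = Z and Inv = "\<lambda>k R' f'. f' = lightened f2 k \<and> R' 11 = m \<and> R' 0 = n \<and> (\<forall>r. 12 \<le> r \<longrightarrow> R' r = 0)"])
      have wr: "written light_step = {}" by (auto simp: light_step_def)
      show "10 \<notin> written light_step" unfolding wr by simp
      fix k and R' :: "nat \<Rightarrow> nat" and f' :: tables assume k: "k < f 10 0 0" and J: "f' = lightened f2 k \<and> R' 11 = m \<and> R' 0 = n \<and> (\<forall>r. 12 \<le> r \<longrightarrow> R' r = 0)" and R10: "R' 10 = k"
      have "ok light_step R' (lightened f2 k) 80 (\<lambda>R' f'. f' = lightened f2 (k + 1))"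
        by (rule ok_light_step[OF F2 sm2 f5]) (use J R10 k hn PB_bounds in auto)
      then show "ok light_step R' f' 80 (\<lambda>R' f'. f' = lightened f2 (k + 1) \<and> (R'(10 := k + 1)) 11 = m \<and>
          (R'(10 := k + 1)) 0 = n \<and> (\<forall>r. 12 \<le> r \<longrightarrow> (R'(10 := k + 1)) r = 0))"
        unfolding conjunct1[OF J] by (rule ok_mono) (use J in \<open>auto simp: wr\<close>)
    next
      fix k and R' :: "nat \<Rightarrow> nat" and f' :: tables assume J: "f' = lightened f2 k \<and> R' 11 = m \<and> R' 0 = n \<and> (\<forall>r. 12 \<le> r \<longrightarrow> R' r = 0)"
      have "f' 10 = f 10" using J same1 same2 unfolding lightened_def by simp
      moreover have "f 10 0 0 < W" using hn PB_bounds by linarith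
      ultimately show "ev R' f' (At 10 zero zero) = f 10 0 0" using J n_pos W_small by (simp add: evs)
    next
      show "12 + 32 * Z + 80 \<le> ?S" using X1(3) by linarith
    next
      show "f2 = lightened f2 0 \<and> (R2(10 := 0)) 11 = m \<and> (R2(10 := 0)) 0 = n \<and> (\<forall>r. 12 \<le> r \<longrightarrow> (R2(10 := 0)) r = 0)"
        using R2 by (auto simp: lightened_def fun_eq_iff)
    next
      fix k and R' :: "nat \<Rightarrow> nat" and f' :: tables assume J: "f' = lightened f2 k \<and> R' 11 = m \<and> R' 0 = n \<and> (\<forall>r. 12 \<le> r \<longrightarrow> R' r = 0)"
      have "tables_le Z (lightened f2 k)" by (rule tables_le_mono[OF t2]) (auto simp: lightened_def split: if_splits)
      then show "tables_le Z f' \<and> (\<forall>r. 12 \<le> r \<longrightarrow> R' r = 0)" using J by simp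
    qed (use hn PB_bounds in auto)
    define f3 where "f3 = lightened f2 (f 10 0 0)"
    have t3: "tables_le Z f3" by (rule tables_le_mono[OF t2]) (auto simp: f3_def lightened_def split: if_splits)
    define f4 where "f4 = upd (upd (upd (upd f3 10 0 0 0) 11 0 0 0) 12 0 0 (nat \<lfloor>real m powr \<epsilon>\<rfloor> - 1)) 13 0 0 (m div 2)"
    have p4: "okS scalars_prog R3 f3 150 ?S (\<lambda>R' f'. R' = R3 \<and> f' = f4)"
      if R3: "R3 11 = m \<and> R3 0 = n \<and> (\<forall>r. 12 \<le> r \<longrightarrow> R3 r = 0)" for R3
    proof -
      have c: "finite_state (R3, memory n f3)" "cells_in_use (R3, memory n f3) \<le> 12 + 32 * Z"
        by (rule cells_le[OF n_pos t3]; use R3 in simp)+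
      have "ok scalars_prog R3 f3 150 (\<lambda>R' f'. R' = R3 \<and> f' = f4)"
        unfolding f4_def by (rule ok_scalars_prog) (use R3 mPB eps in auto)
      from okS_of_ok[OF this c(1)] show ?thesis by (rule okS_large) (use c(2) X1(3) in linarith)
    qed
    \<comment> \<open>The loops have visited logged vertices, log positions and listed heavy
      vertices only; the invariants show that nothing else was nonzero.\<close>
    have z4: "f4 j p q = 0" if "j \<notin> {12, 13, 14, 15}" for j p q
    proof -
      have range: "j \<in> {0, 1, 2, 3, 4, 5, 6, 7, 8, 9, 10, 11, 12, 13, 14, 15, 16} \<or> 16 < j"
        by (cases "16 < j") (auto simp: not_less eval_nat_numeral le_Suc_eq)
      note nj = that
      have f43: "f4 j p q = (if (j = 10 \<or> j = 11) \<and> p = 0 \<and> q = 0 then 0 else f3 j p q)"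
        using that unfolding f4_def upd_apply by auto
      \<comment> \<open>A row with a slot belongs to a logged vertex and has been cleared; a row
        without slots has nothing to clear.\<close>
      have z234: "p \<in> log_verts f1 ?L \<or> (f1 2 p q = 0 \<and> f1 3 p q = 0 \<and> f1 4 p q = 0)"
      proof (cases "f1 4 p 0 = 0")
        case True
        then have "slots f1 p = {}" unfolding slots_def by simp
        then show ?thesis using slots_invD(1)[OF S1, of p q] slots_invD(3)[OF S1, of p q] True flatD(1)[OF F1, of 4 q p]
          by (cases "q = 0") auto
      next
        case False
        then show ?thesis using log_invD(5)[OF L1, of p] same1 unfolding log_verts_def by simp
      qed
      have q0: "f1 j p q = 0" if "4 \<le> j" "j < 16" "f1 j p 0 = 0" using flatD(1)[OF F1 that(1,2), of q p] that(3) by (cases "q = 0") auto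
      consider "j = 0 \<or> j = 16" | "j = 1 \<or> 16 < j" | "j = 2 \<or> j = 3 \<or> j = 4" | "j = 5" | "j = 6" | "j = 7" | "j = 8 \<or> j = 9"
        | "j = 10 \<or> j = 11" using range nj by blast
      then have "f4 j p q = 0 \<or> f3 j p q = 0"
      proof cases
        case 1
        have "f1 0 p q = 0" "f1 16 p q = 0" using C1 unfolding counts_inv_def by (auto simp: codeg_def)
        then show ?thesis using 1 unfolding f3_def lightened_def f2_def cleared_def by auto
      next
        case 2
        then show ?thesis using flatD(3)[OF F1 2, of p q] unfolding f3_def lightened_def f2_def cleared_def by auto
      next
        case 3
        then show ?thesis using z234 unfolding f3_def lightened_def f2_def cleared_def by auto
      next
        case 4
        then show ?thesis using q0 slots_invD(8)[OF S1, of p] same1 unfolding f3_def lightened_def f2_def cleared_def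
          by (cases "f1 5 p 0 = 0") auto
      next
        case 5
        have "heavy f1 = (\<lambda>i. f2 5 i 0) ` {..<f 10 0 0}" unfolding heavy_def same2 same1 ..
        then show ?thesis using q0 5 slots_invD(10)[OF S1, of p] unfolding f3_def lightened_def
          by (cases "p \<in> heavy f1") (auto simp: f2_def cleared_def)
      next
        case 6
        have "f1 7 p 0 = 0" using C1 unfolding counts_inv_def by (auto simp: tri_def)
        then show ?thesis using q0 6 unfolding f3_def lightened_def f2_def cleared_def by auto
      next
        case 7
        then show ?thesis using q0 log_invD(1)[OF L1, of p] same1 unfolding f3_def lightened_def f2_def cleared_def
          by (cases "f1 j p 0 = 0") auto
      next
        case 8
        then show ?thesis using flatD(1)[OF F1, of j q p] flatD(2)[OF F1, of j p q] f43
          unfolding f3_def lightened_def f2_def cleared_def by (cases "p = 0 \<and> q = 0") auto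
      qed
      then show ?thesis using f43 by auto
    qed
    have f414: "f4 14 = f1 14" "f4 15 = f1 15"
      unfolding f4_def f3_def lightened_def f2_def cleared_def by (auto simp: upd_apply fun_eq_iff)
    have f412: "f4 12 0 0 = cap' - 1" "f4 13 0 0 = m div 2" unfolding f4_def cap' by (auto simp: upd_apply)
    have I4: "ds_inv vq n cap' {} f4"
    proof (rule ds_inv_fresh)
      show "f4 12 0 0 = cap' - 1" by (rule f412)
      show "\<And>j p q. j \<notin> {12, 13, 14, 15} \<Longrightarrow> f4 j p q = 0" by (rule z4)
    next
      fix j p q :: nat assume j: "j = 12 \<or> j = 13" "p \<noteq> 0 \<or> q \<noteq> 0"
      have "f1 j p q = 0" using flatD(1)[OF F1, of j q p] flatD(2)[OF F1, of j p q] j by auto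
      then show "f4 j p q = 0" using j unfolding f4_def f3_def lightened_def f2_def cleared_def by (auto simp: upd_apply)
    next
      fix p q :: nat assume "q \<noteq> 0"
      then show "f4 14 p q = 0 \<and> f4 15 p q = 0" unfolding f414 using flatD(1)[OF F1, of 14 q p] flatD(1)[OF F1, of 15 q p] by simp
    next
      fix p show "f4 14 p 0 < n \<and> f4 15 p 0 < n" unfolding f414 using flatD(4,5)[OF F1] by simp
    qed (use cap' n_pos in auto)
    have p5: "okS (For 10 (Reg 11) (restore_step vq)) R4 f4
       (10 + expr_time (Reg 11) + m * (9500 * (cap' + (if vq then 2 * m div cap' else 0) + 1) + 10 + expr_time (Reg 11))) ?S
       (\<lambda>R' f'. restoring vq n cap' f1 m m R' f' \<and> R' 10 = m)"
      if R4: "R4 11 = m \<and> R4 0 = n \<and> (\<forall>r. 12 \<le> r \<longrightarrow> R4 r = 0)" for R4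
    proof (rule okS_For_tables[where Z = Z and Inv = "restoring vq n cap' f1 m"])
      fix k R' f' assume k: "k < m" and M: "restoring vq n cap' f1 m k R' f'" and R10: "R' 10 = k"
      show "ok (restore_step vq) R' f' (9500 * (cap' + (if vq then 2 * m div cap' else 0) + 1))
         (\<lambda>R' f'. restoring vq n cap' f1 m (k + 1) (R'(10 := k + 1)) f')"
        by (rule ok_restore_step[OF M k R10 E Eq m F1 capPB])
    next
      show "10 \<notin> written (restore_step vq)" using written_small(2)[of 10 vq] by (simp add: restore_step_def)
      fix k R' f' assume M: "restoring vq n cap' f1 m k R' f'"
      have "m < W" using mPB PB_bounds by linarith
      then show "ev R' f' (Reg 11) = m" using restoringD(6)[OF M] by (simp add: evs)
    next
      show "12 + 32 * Z + 9500 * (cap' + (if vq then 2 * m div cap' else 0) + 1) \<le> ?S" by (intro add_left_mono mult_le_mono X1) simp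
    next
      show "restoring vq n cap' f1 m 0 (R4(10 := 0)) f4"
        unfolding restoring_def using I4 f412 f414 R4 z4 by simp
    next
      fix k R' f' assume k: "k \<le> m" and M: "restoring vq n cap' f1 m k R' f'"
      note RD = restoringD[OF M]
      let ?E = "(\<lambda>i. {f1 14 i 0, f1 15 i 0}) ` {..<k}"
      have "log_inv n ?E f'" using RD(1) unfolding ds_inv_def by simp
      from log_invD(6)[OF this] have sum: "(\<Sum>w<n. f' 4 w 0) \<le> 2 * m" using RD(2) k by simp
      have J: "p < m" if "f' 14 p 0 \<noteq> 0 \<or> f' 15 p 0 \<noteq> 0" for p
        using that MD(5)[of p] R11 RD(4)[of p 0] RD(5)[of p 0] by (auto split: if_splits)
      have "card ?E \<le> m" using card_image_le[of "{..<k}" "\<lambda>i. {f1 14 i 0, f1 15 i 0}"] k by simp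
      then have "min (n * n) (2 * card ?E + cap' * (2 * m)) + f' 11 0 0 + m + 1 \<le> Z"
        using Z(2) RD(2) k by (simp add: min_def split: if_splits)
      then have "tables_le Z f'" using ds_inv_tables_le[OF RD(1) J sum] tables_le_weaken by blast
      then show "tables_le Z f' \<and> (\<forall>r. 12 \<le> r \<longrightarrow> R' r = 0)" using RD(8) by blast
    qed (use mPB in auto)
    have last: "ds_inv vq n cap' E f' \<and> f' 11 0 0 = m \<and> f' 13 0 0 = m div 2 \<and> (\<forall>p. f' 14 p 0 = 0 \<and> f' 15 p 0 = 0)"
      if M: "restoring vq n cap' f1 m m R' f'" for R' f'
    proof -
      note RD = restoringD[OF M]
      have "f' 14 p 0 = 0 \<and> f' 15 p 0 = 0" for p
      proof (cases "p < m")
        case False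
        then have "\<not> (f1 14 p 0 \<noteq> 0 \<or> f1 15 p 0 \<noteq> 0)" using MD(5)[of p] R11 by metis
        then show ?thesis using RD(4)[of p 0] RD(5)[of p 0] False by simp
      qed (use RD(4)[of p 0] RD(5)[of p 0] in simp)
      then show ?thesis using RD(1-3) Eq[symmetric] by simp
    qed
    let ?T2 = "10 + expr_time (At 11 zero zero) + ?L * (600 * (cap + 1) + 10 + expr_time (At 11 zero zero))"
    let ?T3 = "10 + expr_time (At 10 zero zero) + f 10 0 0 * (80 + 10 + expr_time (At 10 zero zero))"
    let ?T5 = "10 + expr_time (Reg 11) + m * (9500 * (cap' + (if vq then 2 * m div cap' else 0) + 1) + 10 + expr_time (Reg 11))"
    have all: "okS (Seq (For 10 (At 11 zero zero) reset_step) (Seq (For 10 (At 10 zero zero) light_step)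
     (Seq scalars_prog (For 10 (Reg 11) (restore_step vq))))) R1 f1 (?T2 + (?T3 + (150 + ?T5))) ?S
     (\<lambda>R' f'. restoring vq n cap' f1 m m R' f' \<and> R' 10 = m)"
    proof (rule okS_Seq[OF p2])
      fix R2 :: "nat \<Rightarrow> nat" and f2' :: tables assume 2: "(f2' = cleared f1 ?L \<and> R2 11 = m \<and> R2 0 = n \<and> (\<forall>r. 12 \<le> r \<longrightarrow> R2 r = 0)) \<and> R2 10 = ?L"
      then have e2: "f2' = f2" unfolding f2_def by simp
      show "okS (Seq (For 10 (At 10 zero zero) light_step) (Seq scalars_prog (For 10 (Reg 11) (restore_step vq)))) R2 f2'
         (?T3 + (150 + ?T5)) ?S (\<lambda>R' f'. restoring vq n cap' f1 m m R' f' \<and> R' 10 = m)"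
        unfolding e2
      proof (rule okS_Seq[OF p3])
        show "R2 11 = m \<and> R2 0 = n \<and> (\<forall>r. 12 \<le> r \<longrightarrow> R2 r = 0)" using 2 by simp
        fix R3 :: "nat \<Rightarrow> nat" and f3' :: tables assume 3: "(f3' = lightened f2 (f 10 0 0) \<and> R3 11 = m \<and> R3 0 = n \<and> (\<forall>r. 12 \<le> r \<longrightarrow> R3 r = 0)) \<and> R3 10 = f 10 0 0"
        then have e3: "f3' = f3" unfolding f3_def by simp
        show "okS (Seq scalars_prog (For 10 (Reg 11) (restore_step vq))) R3 f3'
          (150 + ?T5) ?S (\<lambda>R' f'. restoring vq n cap' f1 m m R' f' \<and> R' 10 = m)"
          unfolding e3
        proof (rule okS_Seq[OF p4])
          show R3: "R3 11 = m \<and> R3 0 = n \<and> (\<forall>r. 12 \<le> r \<longrightarrow> R3 r = 0)" using 3 by simp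
          fix R4 :: "nat \<Rightarrow> nat" and f4' :: tables assume "R4 = R3 \<and> f4' = f4"
          then show "okS (For 10 (Reg 11) (restore_step vq)) R4 f4' ?T5 ?S (\<lambda>R' f'. restoring vq n cap' f1 m m R' f' \<and> R' 10 = m)"
            using p5[OF R3] by simp
        qed
      qed
    qed
    have T2: "?T2 \<le> (?L + 1) * (700 * X)" by (rule for_time_le) (use X1 in simp_all)
    have T3: "?T3 \<le> (2 * ?L + 1) * (200 * X)" by (rule for_time_le) (use X1 h in simp_all)
    have T5: "?T5 \<le> (?L + 1) * (9600 * X)" by (rule for_time_le) (use X1(2,3) mL in simp_all)
    have Y: "(2 * ?L + 1) * (200 * X) \<le> 400 * ((?L + 1) * X)" by (simp add: algebra_simps)
    have one: "1 \<le> (?L + 1) * X" using X1(3) by simp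
    show ?thesis
    proof (rule okS_mono[OF all])
      have "?T2 + (?T3 + (150 + ?T5)) \<le> 700 * ((?L + 1) * X) + (400 * ((?L + 1) * X) + (150 + 9600 * ((?L + 1) * X)))"
        using T2 T3 T5 Y by (simp add: algebra_simps del: macro_simps)
      also have "\<dots> \<le> 15000 * ((?L + 1) * X)" using one by linarith
      finally show "?T2 + (?T3 + (150 + ?T5)) \<le> 15000 * ((?L + 1) * X)" .
    qed (use last in auto)
  qed
  have t0: "tables_le Z f" using tab1[OF M0] by blast
  have "okS (rebuild vq) R f ((1 + expr_time zero) + ((10 + expr_time (At 11 zero zero) + ?L * (4000 * (cap + (if vq then f 10 0 0 else 0) + 1) + 10 + expr_time (At 11 zero zero))) + 15000 * ((?L + 1) * X))) ?S
    (\<lambda>R' f'. ds_inv vq n cap' E f' \<and> f' 11 0 0 = m \<and> f' 13 0 0 = m div 2 \<and> (\<forall>p. f' 14 p 0 = 0 \<and> f' 15 p 0 = 0))"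
    unfolding rebuild_def
  proof (rule okS_Seq[OF okS_Assign[where Q = "\<lambda>R' f'. R' = ?R0 \<and> f' = f"]])
    show e: "R(11 := ev R f zero) = ?R0 \<and> f = f" using W_small by (simp add: evs)
    show "cells_in_use (R, memory n f) \<le> ?S" using cells_le(2)[where R = R, OF n_pos t0 R(2)] by simp
    show "cells_in_use (R(11 := ev R f zero), memory n f) \<le> ?S"
      unfolding conjunct1[OF e] using cells_le(2)[where R = ?R0, OF n_pos t0] R(2) by simp
    fix R' f' assume "R' = ?R0 \<and> f' = f"
    then show "okS (Seq (For 10 (At 11 zero zero) (move_step vq)) (Seq (For 10 (At 11 zero zero) reset_step)
     (Seq (For 10 (At 10 zero zero) light_step)
     (Seq scalars_prog (For 10 (Reg 11) (restore_step vq)))))) R' f'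
     ((10 + expr_time (At 11 zero zero) + ?L * (4000 * (cap + (if vq then f 10 0 0 else 0) + 1) + 10 + expr_time (At 11 zero zero))) + 15000 * ((?L + 1) * X)) ?S
     (\<lambda>R' f'. ds_inv vq n cap' E f' \<and> f' 11 0 0 = m \<and> f' 13 0 0 = m div 2 \<and> (\<forall>p. f' 14 p 0 = 0 \<and> f' 15 p 0 = 0))"
      using okS_Seq[OF s1] s2 by blast
  qed
  moreover have "(1 + expr_time zero) + (t + 15000 * y) \<le> 20000 * y" if "t \<le> (?L + 1) * (4100 * X)" "y = (?L + 1) * X" for t y
  proof -
    have "t \<le> 4100 * y" "1 \<le> y" using that X1(3) by (simp_all add: algebra_simps)
    then show ?thesis by simp
  qed
  moreover have "10 + expr_time (At 11 zero zero) + ?L * (4000 * (cap + (if vq then f 10 0 0 else 0) + 1) + 10 + expr_time (At 11 zero zero))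
     \<le> (?L + 1) * (4100 * X)" by (rule for_time_le) (use X1(1,3) in simp_all)
  ultimately show ?thesis by (blast intro: okS_mono)
qed

end

section \<open>Queries\<close>

definition triangle :: "'a \<Rightarrow> 'a \<Rightarrow> 'a \<Rightarrow> 'a graph" where
  "triangle a b c = ({a, b, c}, {{a, b}, {b, c}, {a, c}})"

lemma triangle_commute: "triangle a b c = triangle b a c" "triangle a b c = triangle a c b"
  unfolding triangle_def by (auto simp: insert_commute)

lemma verts_edges [simp]: "verts (V, E) = V" "edges (V, E) = E"
  by (simp_all add: verts_def edges_def)

lemma edge_set_other_end:
  assumes "edge_set n E" "e \<in> E" "y \<in> e"
  shows "\<exists>z. e = {y, z} \<and> z \<noteq> y"
proof -
  obtain u v where "e = {u, v}" "u \<noteq> v" using assms(1,2) unfolding edge_set_def by blast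
  then show ?thesis using assms(3) by (cases "y = u") (auto simp: insert_commute)
qed

text \<open>The corners are the preimages of 0, 1 and 2. As \<open>isomorphic\<close> speaks about
  pairs of vertices only, \<open>simple_graph\<close> is what excludes further edges.\<close>

lemma isomorphic_three_cycleD:
  assumes H: "simple_graph H" "isomorphic H three_cycle"
  obtains a b c where "H = triangle a b c" "a \<noteq> b" "b \<noteq> c" "a \<noteq> c"
proof -
  have C: "verts three_cycle = {0, 1, 2}" "edges three_cycle = {{0, 1}, {1, 2}, {0, 2}}"
    by (simp_all add: three_cycle_def)
  from H(2) obtain f where f: "bij_betw f (verts H) {0, 1, 2}"
    and e': "\<forall>u\<in>verts H. \<forall>v\<in>verts H. {u, v} \<in> edges H \<longleftrightarrow> {f u, f v} \<in> edges three_cycle"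
    unfolding isomorphic_def C(1) by (elim exE conjE)
  have e: "{u, v} \<in> edges H \<longleftrightarrow> {f u, f v} \<in> {{0, 1}, {1, 2}, {0, 2}}" if "u \<in> verts H" "v \<in> verts H" for u v
    using e'[rule_format, OF that] unfolding C(2) .
  define g where "g = inv_into (verts H) f"
  have g: "g i \<in> verts H" "f (g i) = i" if "i \<in> {0, 1, 2}" for i
    using that f unfolding g_def bij_betw_def by (auto intro: inv_into_into f_inv_into_f)
  have gi: "g i \<in> verts H \<and> f (g i) = i" if "i = 0 \<or> i = 1 \<or> i = 2" for i using g[of i] that by auto
  let ?a = "g 0" and ?b = "g 1" and ?c = "g 2"
  have abc: "?a \<in> verts H" "?b \<in> verts H" "?c \<in> verts H" "f ?a = 0" "f ?b = 1" "f ?c = 2"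
    using gi[of 0] gi[of 1] gi[of 2] by auto
  have d: "?a \<noteq> ?b" "?b \<noteq> ?c" "?a \<noteq> ?c" using abc(4-6) by auto
  have V: "verts H = {?a, ?b, ?c}"
  proof
    show "verts H \<subseteq> {?a, ?b, ?c}"
    proof
      fix x assume x: "x \<in> verts H"
      then have "f x \<in> {0, 1, 2}" using f unfolding bij_betw_def by blast
      then have "f x = f ?a \<or> f x = f ?b \<or> f x = f ?c" using abc by auto
      moreover have inj: "inj_on f (verts H)" using f unfolding bij_betw_def by blast
      ultimately show "x \<in> {?a, ?b, ?c}"
        using inj_onD[OF inj _ x abc(1)] inj_onD[OF inj _ x abc(2)] inj_onD[OF inj _ x abc(3)] by blast
    qed
  qed (use abc in auto)
  have ed: "{?a, ?b} \<in> edges H" "{?b, ?c} \<in> edges H" "{?a, ?c} \<in> edges H"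
    using e[of ?a ?b] e[of ?b ?c] e[of ?a ?c] abc by auto
  have E: "edges H = {{?a, ?b}, {?b, ?c}, {?a, ?c}}"
  proof
    show "edges H \<subseteq> {{?a, ?b}, {?b, ?c}, {?a, ?c}}"
    proof
      fix x assume "x \<in> edges H"
      then have x: "x \<subseteq> {?a, ?b, ?c}" "card x = 2" using H(1) V unfolding simple_graph_def by auto
      then obtain u v where "x = {u, v}" "u \<noteq> v" unfolding card_2_iff by auto
      then show "x \<in> {{?a, ?b}, {?b, ?c}, {?a, ?c}}" using x(1) by (auto simp: insert_commute)
    qed
  qed (use ed in auto)
  have "H = (verts H, edges H)" unfolding verts_def edges_def by simp
  then have "H = triangle ?a ?b ?c" unfolding triangle_def V E .
  then show ?thesis using that d by blast
qed

lemma isomorphic_triangle: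
  assumes "a \<noteq> b" "b \<noteq> c" "a \<noteq> c"
  shows "isomorphic (triangle a b c) three_cycle"
proof -
  define f where "f x = (if x = a then 0 else if x = b then 1 else 2 :: nat)" for x
  have "bij_betw f {a, b, c} {0, 1, 2}"
    unfolding bij_betw_def inj_on_def f_def using assms by auto
  moreover have "{u, v} \<in> {{a, b}, {b, c}, {a, c}} \<longleftrightarrow> {f u, f v} \<in> {{0, 1}, {1, 2}, {0, 2}}"
    if "u \<in> {a, b, c}" "v \<in> {a, b, c}" for u v
    using that assms unfolding f_def by (auto simp: doubleton_eq_iff)
  ultimately show ?thesis unfolding isomorphic_def three_cycle_def triangle_def verts_edges
    by (intro exI[of _ f] conjI ballI) simp_all
qed

lemma triangle_subgraphs:
  assumes "edge_set n E"
  shows "{H. subgraph H ({..<n}, E) \<and> isomorphic H three_cycle} =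
    {triangle a b c | a b c. {a, b} \<in> E \<and> {b, c} \<in> E \<and> {a, c} \<in> E}" (is "?L = ?R")
proof
  show "?L \<subseteq> ?R"
  proof
    fix H assume H: "H \<in> ?L"
    then have s: "simple_graph H" "isomorphic H three_cycle" "edges H \<subseteq> E" unfolding subgraph_def by auto
    from isomorphic_three_cycleD[OF s(1,2)] obtain a b c where abc: "H = triangle a b c" by blast
    then have "{a, b} \<in> E" "{b, c} \<in> E" "{a, c} \<in> E" using s(3) unfolding triangle_def by auto
    then show "H \<in> ?R" using abc by blast
  qed
  show "?R \<subseteq> ?L"
  proof
    fix H assume "H \<in> ?R"
    then obtain a b c where H: "H = triangle a b c" and e: "{a, b} \<in> E" "{b, c} \<in> E" "{a, c} \<in> E" by blast
    note d = edge_setD[OF assms e(1)] edge_setD[OF assms e(2)] edge_setD[OF assms e(3)]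
    have "simple_graph H" unfolding H simple_graph_def triangle_def using d by auto
    moreover have "verts H \<subseteq> {..<n}" "edges H \<subseteq> E" using d e unfolding H triangle_def by auto
    ultimately show "H \<in> ?L" using isomorphic_triangle[OF d(1) d(4) d(7)] unfolding subgraph_def H by simp
  qed
qed

text \<open>Triangles at \<open>v\<close> correspond to their opposite edges: \<open>F\<close> adds
  \<open>v\<close> and joins it to both ends. Since \<open>v\<close> is not in \<open>e\<close>, the
  vertex set \<open>insert v e\<close> gives \<open>e\<close> back.\<close>

lemma subgraph_count_vertex:
  assumes E: "edge_set n E"
  shows "subgraph_count ({..<n}, E) three_cycle (Vertex v) = card {e \<in> E. \<forall>x\<in>e. {v, x} \<in> E}"
proof -
  let ?X = "{e \<in> E. \<forall>x\<in>e. {v, x} \<in> E}"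
  define F where "F e = (insert v e, insert e ((\<lambda>x. {v, x}) ` e))" for e :: "nat set"
  have F: "F {b, c} = triangle v b c" for b c unfolding F_def triangle_def by auto
  have nv: "v \<notin> e" if "e \<in> ?X" for e using that edge_set_singleton[OF E, of v] by auto
  have inj: "inj_on F ?X"
  proof
    fix e e' assume e: "e \<in> ?X" "e' \<in> ?X" and "F e = F e'"
    then have "insert v e = insert v e'" unfolding F_def by simp
    then show "e = e'" using insert_ident[OF nv[OF e(1)] nv[OF e(2)]] by simp
  qed
  have "{H. subgraph H ({..<n}, E) \<and> isomorphic H three_cycle \<and> contains H (Vertex v)} = F ` ?X"
  proof
    show "{H. subgraph H ({..<n}, E) \<and> isomorphic H three_cycle \<and> contains H (Vertex v)} \<subseteq> F ` ?X"
    proof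
      fix H assume "H \<in> {H. subgraph H ({..<n}, E) \<and> isomorphic H three_cycle \<and> contains H (Vertex v)}"
      then have "H \<in> {triangle a b c | a b c. {a, b} \<in> E \<and> {b, c} \<in> E \<and> {a, c} \<in> E}" and v: "v \<in> verts H"
        using triangle_subgraphs[OF E] by auto
      then obtain a b c where H: "H = triangle a b c" and e: "{a, b} \<in> E" "{b, c} \<in> E" "{a, c} \<in> E" by blast
      consider "v = a" | "v = b" | "v = c" using v unfolding H triangle_def by auto
      \<comment> \<open>By symmetry \<open>v\<close> can be taken as the first corner.\<close>
      then obtain b' c' where H': "H = triangle v b' c'" and e': "{v, b'} \<in> E" "{b', c'} \<in> E" "{v, c'} \<in> E"
      proof cases
        case 1
        then show ?thesis using that H e by simp
      next
        case 2
        show ?thesis by (rule that[of a c]) (use 2 H e triangle_commute(1)[of a b c] in \<open>simp_all add: insert_commute\<close>)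
      next
        case 3
        show ?thesis
          by (rule that[of a b]) (use 3 H e triangle_commute(2)[of a b c] triangle_commute(1)[of a c b] in \<open>simp_all add: insert_commute\<close>)
      qed
      then have "H = F {b', c'}" "{b', c'} \<in> ?X" using F by auto
      then show "H \<in> F ` ?X" by blast
    qed
    show "F ` ?X \<subseteq> {H. subgraph H ({..<n}, E) \<and> isomorphic H three_cycle \<and> contains H (Vertex v)}"
    proof
      fix H assume "H \<in> F ` ?X"
      then obtain e where H: "H = F e" and e: "e \<in> ?X" by blast
      have eE: "e \<in> E" using e by simp
      obtain b c where bc: "e = {b, c}" using E[unfolded edge_set_def, rule_format, OF eE] by blast
      then have "H = triangle v b c" using H F by simp
      moreover have "{v, b} \<in> E" "{b, c} \<in> E" "{v, c} \<in> E" using e bc by auto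
      ultimately have "H \<in> {triangle a b c | a b c. {a, b} \<in> E \<and> {b, c} \<in> E \<and> {a, c} \<in> E}" "v \<in> verts H"
        unfolding triangle_def by auto
      then show "H \<in> {H. subgraph H ({..<n}, E) \<and> isomorphic H three_cycle \<and> contains H (Vertex v)}"
        unfolding triangle_subgraphs[OF E, symmetric] by simp
    qed
  qed
  then show ?thesis unfolding subgraph_count_def using card_image[OF inj] by simp
qed

text \<open>A triangle on a given edge is determined by its third vertex, which is a common
  neighbour of the ends.\<close>

lemma subgraph_count_edge:
  assumes E: "edge_set n E" and uv: "{u, v} \<in> E"
  shows "subgraph_count ({..<n}, E) three_cycle (Edge {u, v}) = card {z. {u, z} \<in> E \<and> {v, z} \<in> E}"
proof -
  let ?X = "{z. {u, z} \<in> E \<and> {v, z} \<in> E}"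
  have ne: "u \<noteq> v" using edge_setD[OF E uv] by simp
  have nz: "z \<noteq> u" "z \<noteq> v" if "z \<in> ?X" for z using that edge_setD(1)[OF E] by auto
  have inj: "inj_on (triangle u v) ?X"
  proof
    fix z z' assume z: "z \<in> ?X" "z' \<in> ?X" and "triangle u v z = triangle u v z'"
    then have "{u, v, z} = {u, v, z'}" unfolding triangle_def by simp
    then show "z = z'" using nz[OF z(1)] by auto
  qed
  have "{H. subgraph H ({..<n}, E) \<and> isomorphic H three_cycle \<and> contains H (Edge {u, v})} = triangle u v ` ?X"
  proof
    show "{H. subgraph H ({..<n}, E) \<and> isomorphic H three_cycle \<and> contains H (Edge {u, v})} \<subseteq> triangle u v ` ?X"
    proof
      fix H assume "H \<in> {H. subgraph H ({..<n}, E) \<and> isomorphic H three_cycle \<and> contains H (Edge {u, v})}"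
      then have "H \<in> {triangle a b c | a b c. {a, b} \<in> E \<and> {b, c} \<in> E \<and> {a, c} \<in> E}" and v: "{u, v} \<in> edges H"
        using triangle_subgraphs[OF E] by auto
      then obtain a b c where H: "H = triangle a b c" and e: "{a, b} \<in> E" "{b, c} \<in> E" "{a, c} \<in> E" by blast
      have T: "\<exists>z. triangle a b c = triangle u v z \<and> {u, z} \<in> E \<and> {v, z} \<in> E"
        if "{u, v} = {a, b}" "{b, c} \<in> E" "{a, c} \<in> E" for a b c
      proof -
        have "(u = a \<and> v = b) \<or> (u = b \<and> v = a)" using that(1) by (auto simp: doubleton_eq_iff)
        then show ?thesis using that triangle_commute(1)[of a b c] by (intro exI[of _ c]) auto
      qed
      consider "{u, v} = {a, b}" | "{u, v} = {b, c}" | "{u, v} = {a, c}" using v unfolding H triangle_def by auto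
      then obtain z where "H = triangle u v z" "{u, z} \<in> E" "{v, z} \<in> E"
      proof cases
        case 1
        then show ?thesis using that T[OF 1] H e by blast
      next
        case 2
        have "{c, a} \<in> E" "{b, a} \<in> E" using e by (simp_all add: insert_commute)
        moreover have "triangle a b c = triangle b c a" using triangle_commute(1)[of a b c] triangle_commute(2)[of b a c] by simp
        ultimately show ?thesis using that T[OF 2] H by auto
      next
        case 3
        have "{c, b} \<in> E" using e by (simp add: insert_commute)
        then show ?thesis using that T[OF 3] H e triangle_commute(2)[of a b c] by auto
      qed
      then show "H \<in> triangle u v ` ?X" by blast
    qed
    show "triangle u v ` ?X \<subseteq> {H. subgraph H ({..<n}, E) \<and> isomorphic H three_cycle \<and> contains H (Edge {u, v})}"
    proof
      fix H assume "H \<in> triangle u v ` ?X"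
      then obtain z where H: "H = triangle u v z" and z: "{u, z} \<in> E" "{v, z} \<in> E" by blast
      then have "H \<in> {triangle a b c | a b c. {a, b} \<in> E \<and> {b, c} \<in> E \<and> {a, c} \<in> E}" "{u, v} \<in> edges H"
        using uv unfolding triangle_def by auto
      then show "H \<in> {H. subgraph H ({..<n}, E) \<and> isomorphic H three_cycle \<and> contains H (Edge {u, v})}"
        unfolding triangle_subgraphs[OF E, symmetric] by simp
    qed
  qed
  then show ?thesis unfolding subgraph_count_def using card_image[OF inj] by simp
qed

text \<open>Register 0 receives the answer at the very end, since table accesses read
  \<open>n\<close> there.\<close>

definition edge_query :: com where
  "edge_query = Seq (Assign 7 (At 16 (Reg 1) (Reg 2))) (Seq (heavy_prog None) (Assign 0 (Reg 7)))"

definition pair_step :: com where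
  "pair_step = Seq (Assign 6 (At 3 (Reg 1) (Reg 5)))
     (If (Bin Eq (Bin Add (At 0 (Reg 1) (Reg 6)) (At 0 (Reg 9) (Reg 6))) (Num 2))
       (Assign 7 (Bin Add (Reg 7) one)) Skip)"

text \<open>The inner loop stops before the index of the outer one, so each unordered pair of slots
  is examined at most once.\<close>

definition vertex_step :: com where
  "vertex_step = Seq (Assign 9 (At 3 (Reg 1) (Reg 10))) (If (At 0 (Reg 1) (Reg 9)) (For 5 (Reg 10) pair_step) Skip)"

definition vertex_query :: com where
  "vertex_query = Seq (Assign 7 (At 7 (Reg 1) zero))
     (Seq (For 10 (At 4 (Reg 1) zero) vertex_step) (Assign 0 (Reg 7)))"

section \<open>Correctness of the queries\<close>

context ram
begin

lemma ok_edge_query: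
  assumes I: "ds_inv vq n cap E f" and b: "small f" and R: "R 0 = n" "R 1 = u" "R 2 = v" and e: "{u, v} \<in> E"
  shows "ok edge_query R f (400 * (f 10 0 0 + 1))
    (\<lambda>R' f'. f' = f \<and> R' 0 = card {z. {u, z} \<in> E \<and> {v, z} \<in> E})"
proof -
  have E: "edge_set n E" and S: "slots_inv n cap f" and C: "counts_inv vq n E f"
    using I unfolding ds_inv_def by auto
  note SD = slots_invD[OF S] and card = slots_inv_card[OF S]
  have uv: "u \<noteq> v" "u < n" "v < n" using edge_setD[OF E e] by auto
  have W: "u < W" "v < W" "u \<le> PB" "v \<le> PB" using uv leW by auto
  have f16: "f 16 u v = codeg n E (slots f) u v" and f0: "\<And>p q. f 0 p q = of_bool ({p, q} \<in> E)"
    and cov: "\<And>w x. {w, x} \<in> E \<Longrightarrow> x \<in> slots f w \<or> w \<in> heavy f"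
    using C unfolding counts_inv_def by auto
  have cW: "codeg n E (slots f) u v < W" "codeg n E (slots f) u v \<le> n" using codeg_le leW by auto
  let ?R = "R(7 := codeg n E (slots f) u v)"
  define Cn where "Cn w \<longleftrightarrow> {w, u} \<in> E \<and> {w, v} \<in> E \<and> \<not> (u \<in> slots f w \<and> v \<in> slots f w)" for w
  let ?q = "card {z. {u, z} \<in> E \<and> {v, z} \<in> E}"
  have q: "?q = codeg n E (slots f) u v + card {z \<in> heavy f. Cn z}"
    unfolding Cn_def by (rule card_codeg_split[OF E uv(1) cov])
  have qW: "?q < W" using finite_card_common(2)[OF E, of u "\<lambda>z. {v, z} \<in> E"] leW by auto
  have s1: "ok (Assign 7 (At 16 (Reg 1) (Reg 2))) R f 20 (\<lambda>R' f'. R' = ?R \<and> f' = f)"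
    by (rule ok_loop_free[where R' = ?R and f' = f]) (use W uv f16 R cW in \<open>auto simp: evs\<close>)
  have s2: "ok (heavy_prog None) ?R f (300 * (f 10 0 0 + 1)) (\<lambda>R' f'. f' = f \<and> R' 7 = ?q)"
    by (rule ok_mono[OF ok_heavy_prog[where A = "\<lambda>p q. {p, q} \<in> E" and B = "\<lambda>w x. x \<in> slots f w" and C = Cn]])
      (use R uv small_bounded[OF b] SD card f0 cW q in \<open>auto simp: Cn_def\<close>)
  have s3: "ok (Assign 0 (Reg 7)) R' f 10 (\<lambda>R' f'. f' = f \<and> R' 0 = ?q)" if "R' 7 = ?q" for R'
    by (rule ok_loop_free[where R' = "R'(0 := ?q)" and f' = f]) (use that qW in \<open>auto simp: evs\<close>)
  have "ok edge_query R f (20 + (300 * (f 10 0 0 + 1) + 10)) (\<lambda>R' f'. f' = f \<and> R' 0 = ?q)"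
    unfolding edge_query_def
    by (rule ok_Seq[OF s1], elim conjE, hypsubst, rule ok_Seq[OF s2], elim conjE, hypsubst, rule s3) simp
  then show ?thesis by (rule ok_mono) auto
qed

lemma ok_pair_loop:
  assumes R: "R 0 = n" "R 1 = v" "R 9 = y" "R 10 = k" "R 7 + k \<le> PB + n" and v: "v < n" "y < n"
    and k: "k < n" and inj: "inj_on (f 3 v) {..<k}" and s: "\<And>i. i < k \<Longrightarrow> f 3 v i < n"
    and f0: "\<And>p q. f 0 p q = of_bool ({p, q} \<in> E)"
  shows "ok (For 5 (Reg 10) pair_step) R f (200 * (k + 1))
    (\<lambda>R' f'. f' = f \<and> R' 7 = R 7 + card {z \<in> f 3 v ` {..<k}. {v, z} \<in> E \<and> {y, z} \<in> E})"
proof -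
  define c where "c i = card {z \<in> f 3 v ` {..<i}. {v, z} \<in> E \<and> {y, z} \<in> E}" for i :: nat
  have W: "v < W" "y < W" "v \<le> PB" "y \<le> PB" "k < W" using v k leW by auto
  have ck: "c i \<le> i" for i
  proof -
    have "c i \<le> card (f 3 v ` {..<i})" unfolding c_def by (intro card_mono) auto
    also have "\<dots> \<le> i" using card_image_le[of "{..<i}" "f 3 v"] by simp
    finally show ?thesis .
  qed
  have loop: "ok (For 5 (Reg 10) pair_step) R f (10 + expr_time (Reg 10) + k * (100 + 10 + expr_time (Reg 10)))
     (\<lambda>R' f'. (f' = f \<and> R' 7 = R 7 + c k \<and> (\<forall>r. r \<notin> {5, 6, 7} \<longrightarrow> R' r = R r)) \<and> R' 5 = k)"
  proof (rule ok_For)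
    fix i and R' :: "nat \<Rightarrow> nat" and f' :: tables
    assume i: "i < k" and I: "f' = f \<and> R' 7 = R 7 + c i \<and> (\<forall>r. r \<notin> {5, 6, 7} \<longrightarrow> R' r = R r)" and R5: "R' 5 = i"
    let ?z = "f 3 v i"
    have z: "?z < n" "?z < W" "?z \<le> PB" using s[OF i] leW by auto
    have iW: "i < n" "i < W" using i k leW by auto
    have R': "R' 0 = n" "R' 1 = v" "R' 9 = y" "R' (Suc 0) = v" using I R by auto
    have new: "?z \<notin> f 3 v ` {..<i}" using inj_on_lessThan_new[OF inj i] .
    have cS: "c (Suc i) = c i + of_bool ({v, ?z} \<in> E \<and> {y, ?z} \<in> E)"
    proof -
      have "{z \<in> f 3 v ` {..<Suc i}. {v, z} \<in> E \<and> {y, z} \<in> E} = (if {v, ?z} \<in> E \<and> {y, ?z} \<in> E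
         then insert ?z {z \<in> f 3 v ` {..<i}. {v, z} \<in> E \<and> {y, z} \<in> E} else {z \<in> f 3 v ` {..<i}. {v, z} \<in> E \<and> {y, z} \<in> E})"
        by (auto simp: lessThan_Suc)
      then show ?thesis using new unfolding c_def by simp
    qed
    let ?R6 = "R'(6 := ?z)"
    have e6: "ev R' f (At 3 (Reg 1) (Reg 5)) = ?z" using R' R5 iW W z by (simp add: evs)
    have eA: "ev ?R6 f (At 0 (Reg 1) (Reg 6)) = of_bool ({v, ?z} \<in> E)"
        "ev ?R6 f (At 0 (Reg 9) (Reg 6)) = of_bool ({y, ?z} \<in> E)"
      using R' z W W_small f0 by (simp_all add: evs)
    have "R' 7 + 1 < W" using I R(5) ck[of i] i PB_bounds by linarith
    then have e7: "ev ?R6 f (Bin Add (Reg 7) one) = R' 7 + 1" using W_small by (simp add: evs)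
    let ?R = "if {v, ?z} \<in> E \<and> {y, ?z} \<in> E then ?R6(7 := R' 7 + 1) else ?R6"
    have "sem W \<epsilon> G pair_step (R', memory n f') = (?R, memory n f)"
      using I unfolding pair_step_def sem.simps fst_conv snd_conv
      by (simp only: e6 ev_both[OF eA] e7) auto
    then show "ok pair_step R' f' 100
        (\<lambda>R' f'. f' = f \<and> (R'(5 := i + 1)) 7 = R 7 + c (i + 1) \<and> (\<forall>r. r \<notin> {5, 6, 7} \<longrightarrow> (R'(5 := i + 1)) r = R r))"
      using I cS by (intro ok_loop_free[where R' = ?R and f' = f]) (auto simp: pair_step_def)
  next
    fix i and R' :: "nat \<Rightarrow> nat" and f' :: tables
    assume I: "f' = f \<and> R' 7 = R 7 + c i \<and> (\<forall>r. r \<notin> {5, 6, 7} \<longrightarrow> R' r = R r)"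
    then show "ev R' f' (Reg 10) = k" using R W by (simp add: evs)
  next
    show "f = f \<and> (R(5 := 0)) 7 = R 7 + c 0 \<and> (\<forall>r. r \<notin> {5, 6, 7} \<longrightarrow> (R(5 := 0)) r = R r)" by (simp add: c_def)
  qed (use k PB_bounds in \<open>auto simp: pair_step_def\<close>)
  then show ?thesis by (rule ok_mono) (auto simp: c_def)
qed

lemma ok_vertex_query:
  assumes I: "ds_inv True n cap E f" and b: "small f" and R: "R 0 = n" "R 1 = v" and v: "v < n"
  shows "ok vertex_query R f (400 * (f 4 v 0 + 1)\<^sup>2)
    (\<lambda>R' f'. f' = f \<and> R' 0 = card {e \<in> E. \<forall>x\<in>e. {v, x} \<in> E})"
proof -
  have E: "edge_set n E" and S: "slots_inv n cap f" and C: "counts_inv True n E f"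
    using I unfolding ds_inv_def by auto
  have finE: "finite E" by (rule finite_edge_set[OF E])
  note SD = slots_invD[OF S] and card = slots_inv_card[OF S]
  have f7: "f 7 v 0 = tri E (slots f) v" and f0: "\<And>p q. f 0 p q = of_bool ({p, q} \<in> E)"
    using C unfolding counts_inv_def by auto
  have bd: "f j p q \<le> PB" for j p q using b unfolding small_def by blast
  have bdW: "f j p q < W" for j p q using bd[of j p q] PB_bounds by linarith
  have W: "v < W" "v \<le> PB" using v leW by auto
  let ?N = "f 4 v 0"
  define Q where "Q k = {e \<in> E. (\<forall>x\<in>e. {v, x} \<in> E) \<and> e \<subseteq> f 3 v ` {..<k}}" for k :: nat
  have Qn: "card (Q k) \<le> n * n" for k
  proof -
    have "card (Q k) \<le> card E" unfolding Q_def by (rule card_mono[OF finE]) auto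
    then show ?thesis using card_edge_set_le[OF E] by simp
  qed
  have t7: "f 7 v 0 \<le> n * n" using tri_le[OF E, of "slots f" v] card_edge_set_le[OF E] f7 by simp
  \<comment> \<open>Slot \<open>k\<close> contributes the edges that join it to earlier slots,
    provided that it is a neighbour of \<open>v\<close> now; slots of deleted edges are passed
    over.\<close>
  have QS: "card (Q (Suc k)) = card (Q k) + (if {v, f 3 v k} \<in> E then card {z \<in> f 3 v ` {..<k}. {v, z} \<in> E \<and> {f 3 v k, z} \<in> E} else 0)"
    if k: "k < ?N" for k
  proof -
    let ?y = "f 3 v k"
    let ?Y = "if {v, ?y} \<in> E then {z \<in> f 3 v ` {..<k}. {v, z} \<in> E \<and> {?y, z} \<in> E} else {}"
    have new: "?y \<notin> f 3 v ` {..<k}" using inj_on_lessThan_new[OF SD(2) k] .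
    have "Q (Suc k) = Q k \<union> (\<lambda>z. {?y, z}) ` ?Y"
    proof
      show "Q (Suc k) \<subseteq> Q k \<union> (\<lambda>z. {?y, z}) ` ?Y"
      proof
        fix e assume e: "e \<in> Q (Suc k)"
        show "e \<in> Q k \<union> (\<lambda>z. {?y, z}) ` ?Y"
        proof (cases "?y \<in> e")
          case True
          have eE: "e \<in> E" using e unfolding Q_def by simp
          obtain z where z: "e = {?y, z}" "z \<noteq> ?y" using edge_set_other_end[OF E eE True] by blast
          then have "z \<in> ?Y" "{v, ?y} \<in> E" using e unfolding Q_def by (auto simp: lessThan_Suc)
          then show ?thesis using z by auto
        next
          case False
          then show ?thesis using e unfolding Q_def by (auto simp: lessThan_Suc)
        qed
      qed
      show "Q k \<union> (\<lambda>z. {?y, z}) ` ?Y \<subseteq> Q (Suc k)" unfolding Q_def by (auto simp: lessThan_Suc split: if_splits)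
    qed
    moreover have "Q k \<inter> (\<lambda>z. {?y, z}) ` ?Y = {}" unfolding Q_def using new by auto
    moreover have "finite (Q k)" unfolding Q_def using finE by simp
    moreover have "inj_on (\<lambda>z. {?y, z}) ?Y" by (auto simp: inj_on_def doubleton_eq_iff)
    ultimately show ?thesis by (simp add: card_Un_disjoint card_image)
  qed
  let ?R = "R(7 := f 7 v 0)"
  have s1: "ok (Assign 7 (At 7 (Reg 1) zero)) R f 20 (\<lambda>R' f'. R' = ?R \<and> f' = f)"
    by (rule ok_loop_free[where R' = ?R and f' = f]) (use W R n_pos bdW W_small in \<open>auto simp: evs\<close>)
  have s2: "ok (For 10 (At 4 (Reg 1) zero) vertex_step) ?R f
     (10 + expr_time (At 4 (Reg 1) zero) + ?N * (300 * (?N + 1) + 10 + expr_time (At 4 (Reg 1) zero)))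
     (\<lambda>R' f'. (f' = f \<and> R' 7 = f 7 v 0 + card (Q ?N) \<and> R' 0 = n \<and> R' 1 = v) \<and> R' 10 = ?N)"
  proof (rule ok_For)
    fix k and R' :: "nat \<Rightarrow> nat" and f' :: tables
    assume k: "k < ?N" and J: "f' = f \<and> R' 7 = f 7 v 0 + card (Q k) \<and> R' 0 = n \<and> R' 1 = v" and R10: "R' 10 = k"
    let ?y = "f 3 v k"
    have kn: "k < n" "k < W" using k card(3)[of v] leW by auto
    have y: "?y < n" "?y < W" using SD(5)[of v] k leW unfolding slots_def by auto
    let ?R9 = "R'(9 := ?y)"
    have a1: "ok (Assign 9 (At 3 (Reg 1) (Reg 10))) R' f' 20 (\<lambda>R'' f''. R'' = ?R9 \<and> f'' = f)"
      by (rule ok_loop_free[where R' = ?R9 and f' = f]) (use J R10 kn W bdW in \<open>auto simp: evs\<close>)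
    have eA: "ev ?R9 f (At 0 (Reg 1) (Reg 9)) = of_bool ({v, ?y} \<in> E)"
      unfolding f0[symmetric] using J y W bdW by (simp add: evs)
    let ?P = "\<lambda>R' f'. f' = f \<and> (R'(10 := k + 1)) 7 = f 7 v 0 + card (Q (k + 1)) \<and> (R'(10 := k + 1)) 0 = n \<and> (R'(10 := k + 1)) 1 = v"
    have "ok (If (At 0 (Reg 1) (Reg 9)) (For 5 (Reg 10) pair_step) Skip) ?R9 f
      (1 + expr_time (At 0 (Reg 1) (Reg 9)) + 200 * (k + 1)) ?P"
    proof (rule ok_If)
      assume "ev ?R9 f (At 0 (Reg 1) (Reg 9)) \<noteq> 0"
      then have e: "{v, ?y} \<in> E" unfolding eA by auto
      have "ok (For 5 (Reg 10) pair_step) ?R9 f (200 * (k + 1)) (\<lambda>R' f'. f' = f \<and> R' 7 = ?R9 7 + card {z \<in> f 3 v ` {..<k}. {v, z} \<in> E \<and> {?y, z} \<in> E})"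
      proof (rule ok_pair_loop)
        show "inj_on (f 3 v) {..<k}" using SD(2)[of v] k by (auto intro: inj_on_subset)
        fix i assume "i < k"
        then have "f 3 v i \<in> slots f v" using k unfolding slots_def by auto
        then show "f 3 v i < n" using SD(5)[of v] by auto
      next
        have "f 7 v 0 + card (Q k) \<le> PB" using Qn[of k] t7 unfolding PB_def by simp
        then show "?R9 7 + k \<le> PB + n" using J kn by simp
      qed (use J R10 kn v y f0 in auto)
      then show "ok (For 5 (Reg 10) pair_step) ?R9 f (200 * (k + 1)) ?P"
        by (rule ok_mono) (use J QS[OF k] e in \<open>auto simp: pair_step_def\<close>)
    next
      assume "ev ?R9 f (At 0 (Reg 1) (Reg 9)) = 0"
      then have e: "{v, ?y} \<notin> E" unfolding eA by auto
      show "ok Skip ?R9 f (200 * (k + 1)) ?P"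
        by (rule ok_loop_free[where R' = ?R9 and f' = f]) (use J QS[OF k] e in auto)
    qed
    then have "ok vertex_step R' f' (20 + (1 + expr_time (At 0 (Reg 1) (Reg 9)) + 200 * (k + 1))) ?P"
      unfolding vertex_step_def by (intro ok_Seq[OF a1]) auto
    then show "ok vertex_step R' f' (300 * (?N + 1)) ?P" by (rule ok_mono) (use k in auto)
  next
    fix k and R' :: "nat \<Rightarrow> nat" and f' :: tables
    assume "f' = f \<and> R' 7 = f 7 v 0 + card (Q k) \<and> R' 0 = n \<and> R' 1 = v"
    then show "ev R' f' (At 4 (Reg 1) zero) = ?N" using W n_pos W_small bdW by (simp add: evs)
  next
    show "f = f \<and> (?R(10 := 0)) 7 = f 7 v 0 + card (Q 0) \<and> (?R(10 := 0)) 0 = n \<and> (?R(10 := 0)) 1 = v"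
    proof -
      have "Q 0 = {}" unfolding Q_def using edge_setD[OF E] E unfolding edge_set_def by auto
      then show ?thesis using R by simp
    qed
  qed (use card(3)[of v] PB_bounds in \<open>auto simp: vertex_step_def pair_step_def\<close>)
  let ?q = "card {e \<in> E. \<forall>x\<in>e. {v, x} \<in> E}"
  have q: "?q = f 7 v 0 + card (Q ?N)"
  proof -
    \<comment> \<open>The triangle table and the scan split the triangles according to whether the
      opposite edge lies within the slots.\<close>
    have "{e \<in> E. \<forall>x\<in>e. {v, x} \<in> E} = {e \<in> E. (\<forall>x\<in>e. {v, x} \<in> E) \<and> \<not> e \<subseteq> slots f v} \<union> Q ?N"
      unfolding Q_def slots_def by auto
    moreover have "{e \<in> E. (\<forall>x\<in>e. {v, x} \<in> E) \<and> \<not> e \<subseteq> slots f v} \<inter> Q ?N = {}"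
      unfolding Q_def slots_def by auto
    moreover have "finite (Q ?N)" unfolding Q_def using finE by simp
    ultimately show ?thesis unfolding f7 tri_def using finE by (simp add: card_Un_disjoint)
  qed
  have "?q \<le> n * n" using card_mono[OF finE, of "{e \<in> E. \<forall>x\<in>e. {v, x} \<in> E}"] card_edge_set_le[OF E] by simp
  then have qW: "?q < W" using PB_bounds by linarith
  have s3: "ok (Assign 0 (Reg 7)) R' f 10 (\<lambda>R' f'. f' = f \<and> R' 0 = ?q)" if "R' 7 = ?q" for R'
    by (rule ok_loop_free[where R' = "R'(0 := ?q)" and f' = f]) (use that qW in \<open>auto simp: evs\<close>)
  have "ok vertex_query R f (20 + ((10 + expr_time (At 4 (Reg 1) zero) + ?N * (300 * (?N + 1) + 10 + expr_time (At 4 (Reg 1) zero))) + 10))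
    (\<lambda>R' f'. f' = f \<and> R' 0 = ?q)"
    unfolding vertex_query_def
  proof (rule ok_Seq[OF s1], elim conjE, hypsubst, rule ok_Seq[OF s2])
    fix R' :: "nat \<Rightarrow> nat" and f' :: tables
    assume "(f' = f \<and> R' 7 = f 7 v 0 + card (Q ?N) \<and> R' 0 = n \<and> R' 1 = v) \<and> R' 10 = ?N"
    then show "ok (Assign 0 (Reg 7)) R' f' 10 (\<lambda>R' f'. f' = f \<and> R' 0 = ?q)" using s3[of R'] q by simp
  qed
  then show ?thesis by (rule ok_mono) (auto simp: power2_eq_square algebra_simps)
qed

end

section \<open>Phases\<close>

text \<open>Amounts to the maximum of 1 and the rounded power; the form with \<open>Suc\<close>
  matches the truncated predecessor in table 12.\<close>

definition cap_of :: "real \<Rightarrow> nat \<Rightarrow> nat" where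
  "cap_of \<epsilon> m = Suc (nat \<lfloor>real m powr \<epsilon>\<rfloor> - 1)"

text \<open>\<open>m0\<close> is the number of edges at the start of the phase, \<open>cnt\<close> the number of updates since.\<close>

definition phase :: "real \<Rightarrow> bool \<Rightarrow> nat \<Rightarrow> nat set set \<Rightarrow> tables \<Rightarrow> nat \<Rightarrow> nat \<Rightarrow> bool" where
  "phase \<epsilon> vq n E f m0 cnt \<longleftrightarrow> ds_inv vq n (cap_of \<epsilon> m0) E f \<and> f 13 0 0 + cnt = m0 div 2 \<and>
     f 11 0 0 \<le> m0 + cnt \<and> m0 \<le> card E + cnt \<and> m0 \<le> n * n \<and> (\<forall>p. f 14 p 0 = 0 \<and> f 15 p 0 = 0)"

text \<open>The update that finds the counter at 0 rebuilds, so a phase comprises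
  \<open>m0 div 2 + 1\<close> updates. In particular a phase is not empty when
  \<open>m0 \<le> 1\<close>.\<close>

definition finish :: "bool \<Rightarrow> com" where
  "finish vq = If (At 13 zero zero) (Put 13 zero zero (Bin Sub (At 13 zero zero) one)) (rebuild vq)"

text \<open>The cost of one edge operation under the old capacity plus that under the new one. With
  \<open>q\<close> bounding the length of the log, \<open>2 * q div cap_of \<epsilon> m0\<close>
  bounds the number of heavy vertices.\<close>

definition work :: "real \<Rightarrow> bool \<Rightarrow> nat \<Rightarrow> nat \<Rightarrow> nat \<Rightarrow> nat" where
  "work \<epsilon> vq m0 q m = (cap_of \<epsilon> m0 + (if vq then 2 * q div cap_of \<epsilon> m0 else 0) + 1) +
     (cap_of \<epsilon> m + (if vq then 2 * m div cap_of \<epsilon> m else 0) + 1)"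

text \<open>Bounds the support of a single table between the rounds of an update, including a
  rebuild under either capacity.\<close>

definition room :: "real \<Rightarrow> nat \<Rightarrow> nat \<Rightarrow> nat \<Rightarrow> nat \<Rightarrow> nat" where
  "room \<epsilon> n m0 q m = min (n * n) (2 * q + 2 * (cap_of \<epsilon> m0 * q) + 2 * (cap_of \<epsilon> m * m)) + 2 * q + 1"

lemma phaseD:
  assumes "phase \<epsilon> vq n E f m0 cnt"
  shows "ds_inv vq n (cap_of \<epsilon> m0) E f" "f 13 0 0 + cnt = m0 div 2" "f 11 0 0 \<le> m0 + cnt" "m0 \<le> card E + cnt"
    "m0 \<le> n * n" "\<And>p. f 14 p 0 = 0 \<and> f 15 p 0 = 0"
  using assms unfolding phase_def by simp_all

lemma cap_of_le:
  assumes "0 < \<epsilon>" "\<epsilon> < 1"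
  shows "cap_of \<epsilon> m \<le> max 1 m"
proof (cases "m = 0")
  case False
  then have "real m powr \<epsilon> \<le> real m powr 1" using assms by (intro powr_mono) auto
  then have "real m powr \<epsilon> \<le> real m" using False by simp
  then have "nat \<lfloor>real m powr \<epsilon>\<rfloor> \<le> m" by linarith
  then show ?thesis using False unfolding cap_of_def by simp
qed (simp add: cap_of_def)

lemma ds_inv_tables_room:
  assumes I: "ds_inv vq n (cap_of \<epsilon> m0) E f" and t: "\<And>p. f 14 p 0 = 0 \<and> f 15 p 0 = 0" and q: "f 11 0 0 \<le> q"
  shows "tables_le (room \<epsilon> n m0 q m) f"
proof -
  have L: "log_inv n E f" using I unfolding ds_inv_def by auto
  have "tables_le (min (n * n) (2 * card E + cap_of \<epsilon> m0 * (2 * q)) + f 11 0 0 + 0 + 1) f"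
    by (rule ds_inv_tables_le[OF I]) (use t log_invD(6)[OF L] q in auto)
  moreover have "min (n * n) (2 * card E + cap_of \<epsilon> m0 * (2 * q)) + f 11 0 0 + 0 + 1 \<le> room \<epsilon> n m0 q m"
    using card_le_log[OF I] q unfolding room_def by (simp add: min_def)
  ultimately show ?thesis by (rule tables_le_weaken)
qed

context ram
begin

text \<open>Insertion and deletion enter as the program \<open>c\<close>, under a common time bound.
  Of the two outcomes, the first continues the phase, and the second ends it with a rebuild that
  costs \<open>work\<close>, up to a constant, for each log entry.\<close>

lemma okS_update:
  assumes P: "phase \<epsilon> vq n E f m0 cnt" and eps: "0 < \<epsilon>" "\<epsilon> < 1"
    and R: "R 0 = n" "\<And>r. 12 \<le> r \<Longrightarrow> R r = 0"
    and c: "ok c R f (9000 * (cap_of \<epsilon> m0 + (if vq then f 10 0 0 else 0) + 1))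
       (\<lambda>R' f'. ds_inv vq n (cap_of \<epsilon> m0) E' f' \<and> f' 11 0 0 \<le> f 11 0 0 + 1 \<and> (\<forall>j. j \<in> {13, 14, 15} \<longrightarrow> f' j = f j))"
    and w: "\<And>r. r < 5 \<or> 9 < r \<Longrightarrow> r \<notin> written c"
    and E': "card E \<le> card E' + 1"
    and q: "q = f 11 0 0 + 1" and m: "m = card E'"
  shows "\<exists>T m1 cnt1. okS (Seq c (finish vq)) R f T (12 + 32 * room \<epsilon> n m0 q m + 20000 * work \<epsilon> vq m0 q m)
       (\<lambda>R' f'. phase \<epsilon> vq n E' f' m1 cnt1) \<and>
     (m1 = m0 \<and> cnt1 = cnt + 1 \<and> T \<le> 10000 * work \<epsilon> vq m0 q m \<or>
      cnt1 = 0 \<and> cnt = m0 div 2 \<and> T \<le> 10000 * work \<epsilon> vq m0 q m + 20000 * ((q + 1) * work \<epsilon> vq m0 q m))"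
proof -
  note PD = phaseD[OF P]
  let ?cap = "cap_of \<epsilon> m0" and ?Z = "room \<epsilon> n m0 q m" and ?Y = "work \<epsilon> vq m0 q m"
  let ?S = "12 + 32 * ?Z + 20000 * ?Y"
  have cnt: "cnt \<le> m0 div 2" using PD(2) by simp
  have qPB: "q \<le> PB"
  proof -
    have "q \<le> m0 + m0 div 2 + 1" using q PD(3) cnt by simp
    also have "\<dots> \<le> PB" using PD(5) unfolding PB_def by simp
    finally show ?thesis .
  qed
  have capPB: "?cap \<le> PB"
  proof -
    have "?cap \<le> max 1 m0" by (rule cap_of_le[OF eps])
    then show ?thesis using PD(5) PB_bounds by linarith
  qed
  have b13: "f 13 0 0 \<le> PB" using PD(2,5) unfolding PB_def by simp
  have heavy_le: "g 10 0 0 \<le> 2 * q div ?cap" if "ds_inv vq n ?cap E1 g" "g 11 0 0 \<le> q" for E1 g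
  proof -
    have "g 10 0 0 * ?cap \<le> 2 * q" using heavy_count[OF that(1)] that(2) by simp
    moreover have "0 < ?cap" unfolding cap_of_def by simp
    ultimately show ?thesis by (simp add: less_eq_div_iff_mult_less_eq)
  qed
  have tau: "?cap + (if vq then f 10 0 0 else 0) + 1 \<le> ?Y"
    using heavy_le[OF PD(1)] q unfolding work_def by simp
  have Y1: "1 \<le> ?Y" unfolding work_def by simp
  let ?T1 = "9000 * (?cap + (if vq then f 10 0 0 else 0) + 1)"
  have T1: "?T1 \<le> 9000 * ?Y" by (rule mult_left_mono[OF tau]) simp
  have t0: "tables_le ?Z f" by (rule ds_inv_tables_room[OF PD(1,6)]) (use q in simp)
  have c0: "finite_state (R, memory n f)" "cells_in_use (R, memory n f) \<le> 12 + 32 * ?Z"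
    by (rule cells_le[OF n_pos t0 R(2)]; assumption)+
  let ?Q1 = "\<lambda>R' f'. ds_inv vq n ?cap E' f' \<and> f' 11 0 0 \<le> f 11 0 0 + 1 \<and> (\<forall>j. j \<in> {13, 14, 15} \<longrightarrow> f' j = f j)"
  have s1: "okS c R f ?T1 ?S ?Q1"
    by (rule okS_large[OF okS_of_ok[OF c c0(1)]]) (use c0(2) T1 in linarith)
  have after: "R1 0 = n \<and> (\<forall>r. 12 \<le> r \<longrightarrow> R1 r = 0) \<and> tables_le ?Z f1 \<and> f1 13 0 0 = f 13 0 0 \<and>
     (\<forall>p. f1 14 p 0 = 0 \<and> f1 15 p 0 = 0) \<and> f1 11 0 0 \<le> q \<and> ds_inv vq n ?cap E' f1"
    if Q: "?Q1 R1 f1" and fr: "\<And>r. r \<notin> written c \<Longrightarrow> R1 r = R r" for R1 f1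
  proof -
    have e: "f1 13 = f 13" "f1 14 = f 14" "f1 15 = f 15" using Q by auto
    have t: "\<And>p. f1 14 p 0 = 0 \<and> f1 15 p 0 = 0" using PD(6) e by simp
    have "tables_le ?Z f1" by (rule ds_inv_tables_room) (use Q t q in auto)
    moreover have "R1 r = R r" if "r = 0 \<or> 12 \<le> r" for r using fr[of r] w[of r] that by auto
    ultimately show ?thesis using R Q t q e by auto
  qed
  have ev13: "ev R1 f1 (At 13 zero zero) = f 13 0 0" if "R1 0 = n" "f1 13 0 0 = f 13 0 0" for R1 f1
  proof -
    have "f 13 0 0 < W" using b13 PB_bounds by linarith
    then show ?thesis using that n_pos W_small by (simp add: evs)
  qed
  show ?thesis
  proof (cases "f 13 0 0 = 0")
    case False
    have "okS (Seq c (finish vq)) R f (?T1 + (1 + expr_time (At 13 zero zero) + 50)) ?S (\<lambda>R' f'. phase \<epsilon> vq n E' f' m0 (cnt + 1))"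
    proof (rule okS_Seq[OF s1])
      fix R1 :: "nat \<Rightarrow> nat" and f1 :: tables
      assume Q: "?Q1 R1 f1" and fr: "\<And>r. r \<notin> written c \<Longrightarrow> R1 r = R r"
      note A = after[OF Q fr]
      let ?f2 = "upd f1 13 0 0 (f 13 0 0 - 1)"
      have I2: "ds_inv vq n ?cap E' ?f2"
      proof -
        have E: "edge_set n E'" and S: "slots_inv n ?cap f1" and C: "counts_inv vq n E' f1" and F: "flat n f1" and L: "log_inv n E' f1"
          using A unfolding ds_inv_def by auto
        have e: "?f2 j = f1 j" if "j \<noteq> 13" for j using that by (auto simp: upd_apply fun_eq_iff)
        have S2: "slots_inv n ?cap ?f2" "slots ?f2 = slots f1" "heavy ?f2 = heavy f1"
          by (rule slots_inv_cong[OF S]; use e in auto)+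
        have C2: "counts_inv vq n E' ?f2" by (rule counts_inv_cong[OF C]) (use e S2 in auto)
        have t: "?f2 4 = f1 4" "?f2 8 = f1 8" "?f2 9 = f1 9" "?f2 11 = f1 11" using e by auto
        have L2: "log_inv n E' ?f2" using L unfolding log_inv_def t .
        have "flat n ?f2" using F unfolding flat_def by (auto simp: upd_apply)
        then show ?thesis using E S2 C2 L2 unfolding ds_inv_def by blast
      qed
      \<comment> \<open>One update changes the counter, the length of the log and a loss of edges by
        at most one, which the increment of \<open>cnt\<close> balances.\<close>
      have P2: "phase \<epsilon> vq n E' ?f2 m0 (cnt + 1)"
        unfolding phase_def using I2 A PD(2-5) q E' False by (auto simp: upd_apply)
      have sm: "ok (Put 13 zero zero (Bin Sub (At 13 zero zero) one)) R1 f1 50 (\<lambda>R' f'. phase \<epsilon> vq n E' f' m0 (cnt + 1))"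
      proof (rule ok_loop_free[where R' = R1 and f' = ?f2])
        show "phase \<epsilon> vq n E' ?f2 m0 (cnt + 1)" by (rule P2)
        have e1: "ev R1 f1 (At 13 zero zero) = f 13 0 0" using ev13 A by simp
        have e2: "ev R1 f1 zero = 0" "ev R1 f1 one = 1" using W_small by (simp_all add: ev_Num)
        show "sem W \<epsilon> G (Put 13 zero zero (Bin Sub (At 13 zero zero) one)) (R1, memory n f1) = (R1, memory n ?f2)"
          using A n_pos by (subst sem_Put) (simp_all add: e1 e2 e2[simplified] ev_Sub)
      qed auto
      have c1: "finite_state (R1, memory n f1)" "cells_in_use (R1, memory n f1) \<le> 12 + 32 * ?Z"
        by (rule cells_le[where R = R1 and Z = ?Z, OF n_pos]; use A in simp)+
      have "okS (Put 13 zero zero (Bin Sub (At 13 zero zero) one)) R1 f1 50 ?S (\<lambda>R' f'. phase \<epsilon> vq n E' f' m0 (cnt + 1))"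
        by (rule okS_large[OF okS_of_ok[OF sm c1(1)]]) (use c1(2) Y1 in linarith)
      then show "okS (finish vq) R1 f1 (1 + expr_time (At 13 zero zero) + 50) ?S (\<lambda>R' f'. phase \<epsilon> vq n E' f' m0 (cnt + 1))"
        unfolding finish_def using False ev13[of R1 f1] A by (intro okS_If) auto
    qed
    moreover have "?T1 + (1 + expr_time (At 13 zero zero) + 50) \<le> 10000 * ?Y" using T1 Y1 by simp
    ultimately show ?thesis by blast
  next
    case True
    let ?T2 = "20000 * ((q + 1) * ?Y)"
    have "okS (Seq c (finish vq)) R f (?T1 + (1 + expr_time (At 13 zero zero) + ?T2)) ?S (\<lambda>R' f'. phase \<epsilon> vq n E' f' m 0)"
    proof (rule okS_Seq[OF s1])
      fix R1 :: "nat \<Rightarrow> nat" and f1 :: tables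
      assume Q: "?Q1 R1 f1" and fr: "\<And>r. r \<notin> written c \<Longrightarrow> R1 r = R r"
      note A = after[OF Q fr]
      have I1: "ds_inv vq n ?cap E' f1" using A by blast
      have E1: "edge_set n E'" using I1 unfolding ds_inv_def by blast
      have mq: "m \<le> q" using card_le_log[OF I1] A m by simp
      define X where "X = (?cap + (if vq then f1 10 0 0 else 0) + 1) + (cap_of \<epsilon> m + (if vq then 2 * m div cap_of \<epsilon> m else 0) + 1)"
      have XY: "X \<le> ?Y" using heavy_le[OF I1] A unfolding X_def work_def by simp
      have "okS (rebuild vq) R1 f1 (20000 * ((f1 11 0 0 + 1) * X)) (12 + 32 * ?Z + 10000 * X)
        (\<lambda>R' f'. ds_inv vq n (cap_of \<epsilon> m) E' f' \<and> f' 11 0 0 = m \<and> f' 13 0 0 = m div 2 \<and> (\<forall>p. f' 14 p 0 = 0 \<and> f' 15 p 0 = 0))"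
      proof (rule okS_rebuild[OF I1 _ capPB])
        show "min (n * n) (2 * m + ?cap * (2 * f1 11 0 0)) + f1 11 0 0 + m + 1 \<le> ?Z"
        proof -
          have "?cap * f1 11 0 0 \<le> ?cap * q" by (rule mult_left_mono) (use A in auto)
          moreover have "?cap * (2 * f1 11 0 0) = 2 * (?cap * f1 11 0 0)" by simp
          ultimately have "2 * m + ?cap * (2 * f1 11 0 0) \<le> 2 * q + 2 * (?cap * q) + 2 * (cap_of \<epsilon> m * m)" using mq by linarith
          then have "min (n * n) (2 * m + ?cap * (2 * f1 11 0 0)) \<le> min (n * n) (2 * q + 2 * (?cap * q) + 2 * (cap_of \<epsilon> m * m))"
            by (rule min.mono[OF order_refl])
          moreover have "f1 11 0 0 \<le> q" using A by blast
          ultimately show ?thesis unfolding room_def using mq by linarith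
        qed
        show "min (n * n) (2 * m + cap_of \<epsilon> m * (2 * m)) + m + m + 1 \<le> ?Z"
        proof -
          have "2 * m + cap_of \<epsilon> m * (2 * m) \<le> 2 * q + 2 * (?cap * q) + 2 * (cap_of \<epsilon> m * m)" using mq by simp
          then have "min (n * n) (2 * m + cap_of \<epsilon> m * (2 * m)) \<le> min (n * n) (2 * q + 2 * (?cap * q) + 2 * (cap_of \<epsilon> m * m))"
            by (rule min.mono[OF order_refl])
          then show ?thesis unfolding room_def using mq by linarith
        qed
      qed (use A qPB b13 eps m in \<open>auto simp: cap_of_def X_def\<close>)
      then have "okS (rebuild vq) R1 f1 ?T2 ?S (\<lambda>R' f'. phase \<epsilon> vq n E' f' m 0)"
      proof (rule okS_mono)
        show "20000 * ((f1 11 0 0 + 1) * X) \<le> ?T2" by (intro mult_le_mono order_refl XY) (use A in simp)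
        show "12 + 32 * ?Z + 10000 * X \<le> ?S" using XY by simp
        fix R' f' assume B: "ds_inv vq n (cap_of \<epsilon> m) E' f' \<and> f' 11 0 0 = m \<and> f' 13 0 0 = m div 2 \<and> (\<forall>p. f' 14 p 0 = 0 \<and> f' 15 p 0 = 0)"
        then show "phase \<epsilon> vq n E' f' m 0" unfolding phase_def using m card_edge_set_le[OF E1] by simp
      qed
      then show "okS (finish vq) R1 f1 (1 + expr_time (At 13 zero zero) + ?T2) ?S (\<lambda>R' f'. phase \<epsilon> vq n E' f' m 0)"
        unfolding finish_def using True ev13[of R1 f1] A by (intro okS_If) auto
    qed
    moreover have "?T1 + (1 + expr_time (At 13 zero zero) + ?T2) \<le> 10000 * ?Y + ?T2" using T1 Y1 by simp
    moreover have "cnt = m0 div 2" using PD(2) True by simp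
    ultimately show ?thesis by blast
  qed
qed

end

text \<open>Since \<open>c powr a \<le> c\<close>, a factor between two sizes also works for their
  powers, and the final constants do not depend on the exponent.\<close>

lemma powr_scale:
  fixes x y c a :: real
  assumes "0 \<le> x" "x \<le> c * y" "1 \<le> c" "0 \<le> y" "0 \<le> a" "a \<le> 1"
  shows "x powr a \<le> c * y powr a"
proof -
  have "x powr a \<le> (c * y) powr a" using assms by (intro powr_mono2) auto
  also have "\<dots> = c powr a * y powr a" using assms by (simp add: powr_mult)
  also have "\<dots> \<le> c powr 1 * y powr a" using assms by (intro mult_right_mono powr_mono) auto
  finally show ?thesis using assms by simp
qed

text \<open>Rounding down a number that is at least 1 loses less than a factor of 2; replacing
  \<open>m\<close> by \<open>max 1 m\<close> covers the empty graph.\<close>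

lemma cap_of_bounds:
  assumes "0 < \<epsilon>" "\<epsilon> < 1"
  shows "real (cap_of \<epsilon> m) \<le> real (max 1 m) powr \<epsilon>" "real (max 1 m) powr \<epsilon> \<le> 2 * real (cap_of \<epsilon> m)"
proof -
  have "real (cap_of \<epsilon> m) \<le> real (max 1 m) powr \<epsilon> \<and> real (max 1 m) powr \<epsilon> \<le> 2 * real (cap_of \<epsilon> m)"
  proof (cases "m = 0")
    case False
    then have M: "max 1 m = m" by simp
    have x: "1 \<le> real m powr \<epsilon>" using False assms by (intro ge_one_powr_ge_zero) auto
    then have f: "1 \<le> \<lfloor>real m powr \<epsilon>\<rfloor>" by linarith
    then have "real (cap_of \<epsilon> m) = of_int \<lfloor>real m powr \<epsilon>\<rfloor>" unfolding cap_of_def by linarith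
    moreover have "1 \<le> real_of_int \<lfloor>real m powr \<epsilon>\<rfloor>" using f by linarith
    ultimately show ?thesis unfolding M by (intro conjI) linarith+
  qed (simp add: cap_of_def)
  then show "real (cap_of \<epsilon> m) \<le> real (max 1 m) powr \<epsilon>" "real (max 1 m) powr \<epsilon> \<le> 2 * real (cap_of \<epsilon> m)"
    by auto
qed

text \<open>Dividing by \<open>cap_of\<close> costs a factor 2 for rounding, and each log entry
  stands for two slots; together this gives the factor 4.\<close>

lemma heavy_bound:
  assumes eps: "0 < \<epsilon>" "\<epsilon> < 1" and q: "real q \<le> c * real (max 1 m)"
  shows "real (2 * q div cap_of \<epsilon> m) \<le> 4 * c * real (max 1 m) powr (1 - \<epsilon>)"
proof -
  let ?M = "real (max 1 m)" and ?k = "real (cap_of \<epsilon> m)"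
  have M: "1 \<le> ?M" by simp
  have k: "0 < ?k" unfolding cap_of_def by simp
  have p: "0 < ?M powr \<epsilon>" using M by simp
  have c: "0 \<le> c"
  proof (rule ccontr)
    assume "\<not> 0 \<le> c"
    then have "c * ?M < 0" using M by (intro mult_neg_pos) auto
    then show False using q by linarith
  qed
  have "real (2 * q div cap_of \<epsilon> m) \<le> real (2 * q) / ?k" by (rule of_nat_div_le_of_nat)
  also have "\<dots> \<le> 2 * (c * ?M) / ?k" using q k by (intro divide_right_mono) auto
  also have "\<dots> \<le> 2 * (c * ?M) / (?M powr \<epsilon> / 2)"
    using cap_of_bounds(2)[OF eps, of m] p k c M by (intro divide_left_mono mult_pos_pos mult_nonneg_nonneg) linarith+
  also have "\<dots> = 4 * c * (?M powr 1 / ?M powr \<epsilon>)" using M by simp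
  also have "?M powr 1 / ?M powr \<epsilon> = ?M powr (1 - \<epsilon>)" by (rule powr_diff[symmetric])
  finally show ?thesis .
qed

text \<open>\<open>m\<close> may already be the number of edges after the next update, whence the
  terms \<open>+ 1\<close>. As \<open>cnt\<close> is at most half of \<open>m0\<close>, neither the
  edges lost nor the entries added to the log change the order of magnitude.\<close>

lemma phase_sizes:
  fixes m0 cnt l m n :: nat
  assumes "m0 \<le> m + cnt + 1" "cnt \<le> m0 div 2" "l \<le> m0 + cnt" "m \<le> l + 1" "m0 \<le> n * n" "0 < n"
  shows "max 1 m0 \<le> 4 * max 1 m" "max 1 m \<le> 3 * max 1 m0" "l + 1 \<le> 3 * max 1 m0" "max 1 m0 \<le> n * n"
proof -
  have "1 \<le> n * n" using assms(6) by (metis One_nat_def Suc_leI nat_0_less_mult_iff)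
  then show "max 1 m0 \<le> n * n" using assms(5) by simp
qed (use assms(1-4) in linarith)+

definition update_exp :: "real \<Rightarrow> bool \<Rightarrow> real" where
  "update_exp \<epsilon> vq = (if vq then max \<epsilon> (1 - \<epsilon>) else \<epsilon>)"

lemma update_exp_bounds:
  assumes "0 < \<epsilon>" "\<epsilon> < 1"
  shows "0 < update_exp \<epsilon> vq" "update_exp \<epsilon> vq < 1" "\<epsilon> \<le> update_exp \<epsilon> vq" "vq \<Longrightarrow> 1 - \<epsilon> \<le> update_exp \<epsilon> vq"
  using assms unfolding update_exp_def by (auto simp: max_def)

lemma work_bound:
  assumes eps: "0 < \<epsilon>" "\<epsilon> < 1" and q: "q \<le> 3 * max 1 m0" and m: "max 1 m \<le> 3 * max 1 m0"
  shows "real (work \<epsilon> vq m0 q m) \<le> 32 * real (max 1 m0) powr update_exp \<epsilon> vq"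
proof -
  let ?M = "real (max 1 m0)" and ?m = "real (max 1 m)" and ?a = "update_exp \<epsilon> vq"
  note A = update_exp_bounds[OF eps]
  have M: "1 \<le> ?M" "1 \<le> ?m" by auto
  have m': "?m powr ?a \<le> 3 * ?M powr ?a"
    by (rule powr_scale) (use m A[of vq] in auto)
  have one: "1 \<le> ?M powr ?a" using A(1)[of vq] by (intro ge_one_powr_ge_zero) auto
  have k1: "real (cap_of \<epsilon> m0) \<le> ?M powr ?a"
    using cap_of_bounds(1)[OF eps, of m0] powr_mono[OF A(3)[of vq] M(1)] by linarith
  have k2: "real (cap_of \<epsilon> m) \<le> ?m powr ?a"
    using cap_of_bounds(1)[OF eps, of m] powr_mono[OF A(3)[of vq] M(2)] by linarith
  have h1: "real (if vq then 2 * q div cap_of \<epsilon> m0 else 0) \<le> 12 * ?M powr ?a"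
  proof (cases vq)
    case True
    have "real q \<le> 3 * ?M" using q by linarith
    from heavy_bound[OF eps this] have "real (2 * q div cap_of \<epsilon> m0) \<le> 12 * ?M powr (1 - \<epsilon>)" by simp
    then show ?thesis using True powr_mono[OF A(4)[OF True] M(1)] by simp
  qed simp
  have h2: "real (if vq then 2 * m div cap_of \<epsilon> m else 0) \<le> 4 * ?m powr ?a"
  proof (cases vq)
    case True
    have "real m \<le> 1 * ?m" by simp
    from heavy_bound[OF eps this] have "real (2 * m div cap_of \<epsilon> m) \<le> 4 * ?m powr (1 - \<epsilon>)" by simp
    then show ?thesis using True powr_mono[OF A(4)[OF True] M(2)] by simp
  qed simp
  have "real (work \<epsilon> vq m0 q m) = real (cap_of \<epsilon> m0) + real (if vq then 2 * q div cap_of \<epsilon> m0 else 0) +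
     real (cap_of \<epsilon> m) + real (if vq then 2 * m div cap_of \<epsilon> m else 0) + 2" unfolding work_def by simp
  \<comment> \<open>The summands give 1 + 12 + 3 + 12 + 2, where \<open>m'\<close> turns powers of
    \<open>m\<close> into powers of \<open>m0\<close>; the sum is rounded up to 32.\<close>
  then show ?thesis using k1 k2 h1 h2 one m' by linarith
qed

definition space_bound :: "real \<Rightarrow> nat \<Rightarrow> nat \<Rightarrow> real" where
  "space_bound \<epsilon> n m = min (real n ^ 2) (real (max 1 m) powr (1 + \<epsilon>))"

text \<open>For space, a bound on \<open>work\<close> linear in \<open>m0\<close> is enough: up to
  constants, and with 0 read as 1, \<open>m0\<close> is at most \<open>n * n\<close> and at most
  \<open>m\<close>, so it fits under both parts of the minimum.\<close>

lemma space_bounds: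
  assumes eps: "0 < \<epsilon>" "\<epsilon> < 1" and q: "q \<le> 3 * max 1 m0" and m: "max 1 m \<le> 3 * max 1 m0"
    and M: "max 1 m0 \<le> 4 * max 1 m" "max 1 m0 \<le> n * n"
  shows "1 \<le> space_bound \<epsilon> n m" "real (max 1 m0) \<le> 4 * space_bound \<epsilon> n m"
    "real (work \<epsilon> vq m0 q m) \<le> 100 * space_bound \<epsilon> n m" "real (room \<epsilon> n m0 q m) \<le> 150 * space_bound \<epsilon> n m"
proof -
  let ?B = "space_bound \<epsilon> n m" and ?M = "real (max 1 m0)" and ?m = "real (max 1 m)"
  have M1: "1 \<le> ?M" "1 \<le> ?m" by auto
  have nn: "?M \<le> real n ^ 2" using M(2) by (metis of_nat_le_iff of_nat_mult power2_eq_square)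
  have mm: "?m \<le> ?m powr (1 + \<epsilon>)" using powr_mono[of 1 "1 + \<epsilon>" ?m] eps M1 by simp
  have Mm: "?M \<le> 4 * ?m" using M(1) by linarith
  show one: "1 \<le> ?B" unfolding space_bound_def using nn mm M1 by linarith
  have "?M / 4 \<le> ?B" unfolding space_bound_def using nn mm Mm M1 by (intro min.boundedI) linarith+
  then show MB: "?M \<le> 4 * ?B" by linarith
  have k: "cap_of \<epsilon> m0 \<le> max 1 m0" "cap_of \<epsilon> m \<le> max 1 m" using cap_of_le[OF eps] by auto
  have "work \<epsilon> vq m0 q m \<le> (cap_of \<epsilon> m0 + 2 * q + 1) + (cap_of \<epsilon> m + 2 * m + 1)"
    unfolding work_def using div_le_dividend[of "2 * q" "cap_of \<epsilon> m0"] div_le_dividend[of "2 * m" "cap_of \<epsilon> m"]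
    by (cases vq; simp only: if_True if_False; linarith)
  also have "\<dots> \<le> 25 * max 1 m0" using k q m by linarith
  finally have "real (work \<epsilon> vq m0 q m) \<le> 25 * ?M" by linarith
  then show "real (work \<epsilon> vq m0 q m) \<le> 100 * ?B" using MB by linarith
  have q': "real q \<le> 3 * ?M" using q by linarith
  \<comment> \<open>The product of capacity and log length is the origin of the exponent
    \<open>1 + \<epsilon>\<close>.\<close>
  have kq: "real (cap_of \<epsilon> m0 * q) \<le> 48 * ?m powr (1 + \<epsilon>)"
  proof -
    have "real (cap_of \<epsilon> m0 * q) = real (cap_of \<epsilon> m0) * real q" by simp
    also have "\<dots> \<le> ?M powr \<epsilon> * (3 * ?M)" by (intro mult_mono cap_of_bounds(1)[OF eps] q') auto
    also have "\<dots> \<le> (4 * ?m powr \<epsilon>) * (3 * (4 * ?m))"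
      using powr_scale[of ?M 4 ?m \<epsilon>] Mm eps by (intro mult_mono) auto
    also have "\<dots> = 48 * (?m powr 1 * ?m powr \<epsilon>)" by simp
    also have "?m powr 1 * ?m powr \<epsilon> = ?m powr (1 + \<epsilon>)" by (rule powr_add[symmetric])
    finally show ?thesis .
  qed
  have km: "real (cap_of \<epsilon> m * m) \<le> ?m powr (1 + \<epsilon>)"
  proof -
    have "real (cap_of \<epsilon> m * m) = real (cap_of \<epsilon> m) * real m" by simp
    also have "\<dots> \<le> ?m powr \<epsilon> * ?m" by (intro mult_mono cap_of_bounds(1)[OF eps]) auto
    also have "\<dots> = ?m powr 1 * ?m powr \<epsilon>" by simp
    also have "\<dots> = ?m powr (1 + \<epsilon>)" by (rule powr_add[symmetric])
    finally show ?thesis .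
  qed
  define A where "A = 2 * q + 2 * (cap_of \<epsilon> m0 * q) + 2 * (cap_of \<epsilon> m * m)"
  \<comment> \<open>The constant is 24 + 96 + 2, one number for each summand of
    \<open>A\<close>.\<close>
  have A: "real A \<le> 122 * ?m powr (1 + \<epsilon>)"
  proof -
    have "real A = 2 * real q + 2 * real (cap_of \<epsilon> m0 * q) + 2 * real (cap_of \<epsilon> m * m)" unfolding A_def by simp
    then show ?thesis using kq km q' Mm mm by linarith
  qed
  have "real (min (n * n) A) \<le> 122 * ?B"
  proof -
    have "real (min (n * n) A) \<le> real (n * n)" by (simp only: of_nat_le_iff min.cobounded1)
    also have "\<dots> = real n ^ 2" by (simp add: power2_eq_square)
    finally have 1: "real (min (n * n) A) \<le> real n ^ 2" .
    have 2: "real (min (n * n) A) \<le> real A" by simp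
    have "real (min (n * n) A) / 122 \<le> ?B" unfolding space_bound_def using 1 2 A
      by (intro min.boundedI) linarith+
    then show ?thesis by linarith
  qed
  moreover have "real (2 * q + 1) \<le> 28 * ?B" using q' MB one by linarith
  moreover have "real (room \<epsilon> n m0 q m) = real (min (n * n) A) + real (2 * q + 1)" unfolding room_def A_def by simp
  ultimately show "real (room \<epsilon> n m0 q m) \<le> 150 * ?B" by linarith
qed

section \<open>Time and space bounds\<close>

definition counting_structure :: "bool \<Rightarrow> data_structure" where
  "counting_structure vq = \<lparr>insert_prog = Seq (add_edge vq) (finish vq), delete_prog = Seq (del_edge vq) (finish vq),
     query_prog = (if vq then vertex_query else edge_query)\<rparr>"

definition query_bound :: "real \<Rightarrow> bool \<Rightarrow> nat \<Rightarrow> nat \<Rightarrow> real" where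
  "query_bound \<epsilon> vq m n =
     (if vq then min (real m powr (2 * \<epsilon>)) (real n ^ 2) else min (real m powr (1 - \<epsilon>)) (real n))"

text \<open>
  A rebuild costs at most \<open>20000 * (q + 1)\<close> times the work bound \<open>32 * m0 powr \<alpha>\<close>, and
  \<open>q + 1 \<le> 3 * (cnt + 1)\<close> at the end of a phase; hence the constant \<open>20000 * 3 * 32\<close>.
\<close>

definition potential :: "real \<Rightarrow> bool \<Rightarrow> nat \<Rightarrow> nat \<Rightarrow> real" where
  "potential \<epsilon> vq m0 cnt = 1920000 * real cnt * real (max 1 m0) powr update_exp \<epsilon> vq"

section \<open>Single updates and queries\<close>

context ram
begin

text \<open>\<open>potential\<close> depends on \<open>m0\<close>, which is fixed within a phase, so
  an update raises it by a fixed amount until a rebuild spends all of it. Only the last step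
  converts powers of \<open>m0\<close> into powers of the current number of edges, at the cost of a
  factor 4.\<close>

lemma update_exec:
  assumes P: "phase \<epsilon> vq n E f m0 cnt" and eps: "0 < \<epsilon>" "\<epsilon> < 1"
    and R: "R 0 = n" "\<And>r. 12 \<le> r \<Longrightarrow> R r = 0"
    and c: "ok c R f (9000 * (cap_of \<epsilon> m0 + (if vq then f 10 0 0 else 0) + 1))
       (\<lambda>R' f'. ds_inv vq n (cap_of \<epsilon> m0) E' f' \<and> f' 11 0 0 \<le> f 11 0 0 + 1 \<and> (\<forall>j. j \<in> {13, 14, 15} \<longrightarrow> f' j = f j))"
    and w: "\<And>r. r < 5 \<or> 9 < r \<Longrightarrow> r \<notin> written c"
    and E': "card E \<le> card E' + 1" "card E' \<le> card E + 1"
  shows "\<exists>t p R' f' m1 cnt1. exec W \<epsilon> G (Seq c (finish vq)) (R, memory n f) t p (R', memory n f') \<and>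
     phase \<epsilon> vq n E' f' m1 cnt1 \<and> real p \<le> 10000000 * space_bound \<epsilon> n (card E') \<and>
     real t + potential \<epsilon> vq m1 cnt1 \<le> potential \<epsilon> vq m0 cnt + 10000000 * real (max 1 (card E')) powr update_exp \<epsilon> vq"
proof -
  note PD = phaseD[OF P]
  define q m where "q = f 11 0 0 + 1" and "m = card E'"
  let ?Y = "work \<epsilon> vq m0 q m" and ?Z = "room \<epsilon> n m0 q m" and ?a = "update_exp \<epsilon> vq"
  let ?M = "real (max 1 m0)" and ?m = "real (max 1 m)" and ?B = "space_bound \<epsilon> n m"
  have cnt: "cnt \<le> m0 div 2" using PD(2) by simp
  have "m0 \<le> m + cnt + 1" using PD(4) E' unfolding m_def by simp
  moreover have "m \<le> f 11 0 0 + 1" using card_le_log[OF PD(1)] E' unfolding m_def by simp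
  ultimately have sz: "max 1 m0 \<le> 4 * max 1 m" "max 1 m \<le> 3 * max 1 m0" "q \<le> 3 * max 1 m0" "max 1 m0 \<le> n * n"
    using phase_sizes[OF _ cnt PD(3) _ PD(5) n_pos] unfolding q_def by blast+
  note WB = work_bound[OF eps sz(3,2), of vq] and SB = space_bounds[OF eps sz(3,2,1,4)]
  have Mm: "?M powr ?a \<le> 4 * ?m powr ?a"
    by (rule powr_scale) (use sz(1) update_exp_bounds[OF eps, of vq] in auto)
  obtain T m1 cnt1 where S: "okS (Seq c (finish vq)) R f T (12 + 32 * ?Z + 20000 * ?Y) (\<lambda>R' f'. phase \<epsilon> vq n E' f' m1 cnt1)"
    and alt: "m1 = m0 \<and> cnt1 = cnt + 1 \<and> T \<le> 10000 * ?Y \<or>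
      cnt1 = 0 \<and> cnt = m0 div 2 \<and> T \<le> 10000 * ?Y + 20000 * ((q + 1) * ?Y)"
    using okS_update[OF P eps R c w E'(1) q_def m_def] by blast
  from S obtain t p R' f' where ex: "exec W \<epsilon> G (Seq c (finish vq)) (R, memory n f) t p (R', memory n f')"
    and t: "t \<le> T" and p: "p \<le> 12 + 32 * ?Z + 20000 * ?Y" and ph: "phase \<epsilon> vq n E' f' m1 cnt1"
    unfolding okS_def by blast
  have "real p \<le> 12 + 32 * real ?Z + 20000 * real ?Y" using p by linarith
  then have space: "real p \<le> 10000000 * ?B" using SB(1) SB(3)[of vq] SB(4) by linarith
  \<comment> \<open>The constant is 320000 for the update itself, from \<open>10000 * 32\<close>,
    plus 1920000 for its share in the rebuild.\<close>
  have "real t + potential \<epsilon> vq m1 cnt1 \<le> potential \<epsilon> vq m0 cnt + 2240000 * ?M powr ?a"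
    using alt
  proof
    assume A: "m1 = m0 \<and> cnt1 = cnt + 1 \<and> T \<le> 10000 * ?Y"
    then have "real t \<le> 10000 * real ?Y" using t by linarith
    then have "real t \<le> 320000 * ?M powr ?a" using WB by linarith
    then show ?thesis using A unfolding potential_def by (simp add: algebra_simps)
  next
    assume A: "cnt1 = 0 \<and> cnt = m0 div 2 \<and> T \<le> 10000 * ?Y + 20000 * ((q + 1) * ?Y)"
    then have "cnt = m0 div 2" by blast
    then have "m0 \<le> 2 * cnt + 1" by presburger
    then have "q + 1 \<le> 3 * (cnt + 1)" using PD(3) unfolding q_def by simp
    then have "real (q + 1) \<le> real (3 * (cnt + 1))" by (simp only: of_nat_le_iff)
    then have "real (q + 1) \<le> 3 * (real cnt + 1)" by simp
    then have "real (q + 1) * real ?Y \<le> (3 * (real cnt + 1)) * (32 * ?M powr ?a)"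
      using WB by (intro mult_mono) auto
    moreover have "real t \<le> 10000 * real ?Y + 20000 * (real (q + 1) * real ?Y)"
    proof -
      have "real t \<le> real (10000 * ?Y + 20000 * ((q + 1) * ?Y))" using t A by (metis le_trans of_nat_le_iff)
      also have "\<dots> = 10000 * real ?Y + 20000 * (real (q + 1) * real ?Y)" by (simp add: algebra_simps)
      finally show ?thesis .
    qed
    ultimately have "real t \<le> 320000 * ?M powr ?a + 20000 * ((3 * (real cnt + 1)) * (32 * ?M powr ?a))"
      using WB by linarith
    then show ?thesis using A unfolding potential_def by (simp add: algebra_simps)
  qed
  then have "real t + potential \<epsilon> vq m1 cnt1 \<le> potential \<epsilon> vq m0 cnt + 10000000 * ?m powr ?a"
    using Mm powr_ge_zero[of ?m ?a] by linarith
  then show ?thesis using ex ph space unfolding m_def by blast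
qed

text \<open>The space during a query is bounded by that of the tables plus its running time, so the
  query bound must stay below the space bound. The factor 19600 is \<open>400 * 49\<close>, from
  edge queries.\<close>

lemma query_exec:
  assumes P: "phase \<epsilon> vq n E f m0 cnt" and eps: "0 < \<epsilon>" "\<epsilon> < 1"
    and R: "\<And>r. 12 \<le> r \<Longrightarrow> R r = 0"
    and c: "ok c R f T (\<lambda>R' f'. f' = f \<and> R' 0 = ans)" and T: "real T \<le> 19600 * b" "b \<le> space_bound \<epsilon> n (card E)"
  shows "\<exists>t p R'. exec W \<epsilon> G c (R, memory n f) t p (R', memory n f) \<and> R' 0 = ans \<and>
     real t \<le> 10000000 * b \<and> real p \<le> 10000000 * space_bound \<epsilon> n (card E)"
proof -
  note PD = phaseD[OF P]
  define q m where "q = f 11 0 0 + 1" and "m = card E"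
  have cnt: "cnt \<le> m0 div 2" using PD(2) by simp
  have "m0 \<le> m + cnt + 1" using PD(4) unfolding m_def by simp
  moreover have "m \<le> f 11 0 0 + 1" using card_le_log[OF PD(1)] unfolding m_def by simp
  ultimately have sz: "max 1 m0 \<le> 4 * max 1 m" "max 1 m \<le> 3 * max 1 m0" "q \<le> 3 * max 1 m0" "max 1 m0 \<le> n * n"
    using phase_sizes[OF _ cnt PD(3) _ PD(5) n_pos] unfolding q_def by blast+
  note SB = space_bounds[OF eps sz(3,2,1,4)]
  have "tables_le (room \<epsilon> n m0 q m) f" by (rule ds_inv_tables_room[OF PD(1,6)]) (simp add: q_def)
  note cl = cells_le[where R = R, OF n_pos this R]
  from okS_of_ok[OF c cl(1)] obtain t p R' f' where ex: "exec W \<epsilon> G c (R, memory n f) t p (R', memory n f')"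
    and t: "t \<le> T" and p: "p \<le> cells_in_use (R, memory n f) + T" and f': "f' = f" and a: "R' 0 = ans"
    unfolding okS_def by blast
  have b: "0 \<le> b" using T(1) of_nat_0_le_iff[of T, where 'a = real] by linarith
  have "real t \<le> 10000000 * b" using t T(1) b by linarith
  moreover have "real p \<le> 12 + 32 * real (room \<epsilon> n m0 q m) + real T" using p cl(2) by linarith
  then have "real p \<le> 10000000 * space_bound \<epsilon> n m" using SB(1,4) T unfolding m_def by linarith
  ultimately show ?thesis using ex a unfolding f' m_def by blast
qed

lemma edge_query_exec:
  assumes P: "phase \<epsilon> False n E f m0 cnt" and eps: "0 < \<epsilon>" "\<epsilon> < 1" and e: "{u, v} \<in> E"
    and R: "R 0 = n" "R 1 = u" "R 2 = v" "\<And>r. 12 \<le> r \<Longrightarrow> R r = 0"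
  shows "\<exists>t p R'. exec W \<epsilon> G edge_query (R, memory n f) t p (R', memory n f) \<and>
     R' 0 = subgraph_count ({..<n}, E) three_cycle (Edge {u, v}) \<and>
     real t \<le> 10000000 * query_bound \<epsilon> False (max 1 (card E)) n \<and> real p \<le> 10000000 * space_bound \<epsilon> n (card E)"
proof -
  note PD = phaseD[OF P]
  have E: "edge_set n E" and S: "slots_inv n (cap_of \<epsilon> m0) f" using PD(1) unfolding ds_inv_def by auto
  let ?m = "real (max 1 (card E))" and ?M = "real (max 1 m0)"
  have cnt: "cnt \<le> m0 div 2" using PD(2) by simp
  have "m0 \<le> card E + cnt + 1" using PD(4) by simp
  moreover have "card E \<le> f 11 0 0 + 1" using card_le_log[OF PD(1)] by simp
  ultimately have sz: "max 1 m0 \<le> 4 * max 1 (card E)" "f 11 0 0 + 1 \<le> 3 * max 1 m0"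
    using phase_sizes[OF _ cnt PD(3) _ PD(5) n_pos] by blast+
  have cap: "cap_of \<epsilon> m0 \<le> PB"
    using cap_of_le[OF eps, of m0] PD(5) PB_bounds by linarith
  have sm: "small f"
    by (rule ds_inv_small[OF PD(1) _ cap]) (use PD(2,3,5) cnt in \<open>auto simp: PB_def\<close>)
  define b where "b = query_bound \<epsilon> False (max 1 (card E)) n"
  have b_eq: "b = min (?m powr (1 - \<epsilon>)) (real n)" unfolding b_def query_bound_def by simp
  have c: "ok edge_query R f (400 * (f 10 0 0 + 1))
    (\<lambda>R' f'. f' = f \<and> R' 0 = subgraph_count ({..<n}, E) three_cycle (Edge {u, v}))"
    unfolding subgraph_count_edge[OF E e] by (rule ok_edge_query[OF PD(1) sm R(1-3) e])
  have m1: "1 \<le> ?m" by simp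
  \<comment> \<open>The factor 49 is 48 + 1: \<open>heavy_bound\<close> with a log of length at most
    \<open>3 * max 1 m0\<close> gives 12, and passing from \<open>m0\<close> to the current number
    of edges gives 4.\<close>
  have h: "real (f 10 0 0 + 1) \<le> 49 * b"
  proof -
    have "f 10 0 0 * cap_of \<epsilon> m0 \<le> 2 * f 11 0 0" by (rule heavy_count[OF PD(1)])
    then have "f 10 0 0 \<le> 2 * f 11 0 0 div cap_of \<epsilon> m0" by (simp add: less_eq_div_iff_mult_less_eq cap_of_def)
    moreover have "real (2 * f 11 0 0 div cap_of \<epsilon> m0) \<le> 4 * 3 * ?M powr (1 - \<epsilon>)"
      by (rule heavy_bound[OF eps]) (use sz(2) in linarith)
    moreover have "?M powr (1 - \<epsilon>) \<le> 4 * ?m powr (1 - \<epsilon>)" by (rule powr_scale) (use sz(1) eps in auto)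
    ultimately have "real (f 10 0 0) \<le> 48 * ?m powr (1 - \<epsilon>)" by linarith
    moreover have "1 \<le> ?m powr (1 - \<epsilon>)" using eps by (intro ge_one_powr_ge_zero) auto
    moreover have "f 10 0 0 \<le> n" by (rule slots_inv_card(4)[OF S])
    moreover have "1 \<le> n" using n_pos by simp
    moreover have "h + 1 \<le> 49 * min x y" if "h \<le> 48 * x" "1 \<le> x" "h \<le> y" "1 \<le> y" for h x y :: real
      using that by (simp add: min_def)
    ultimately have "real (f 10 0 0) + 1 \<le> 49 * min (?m powr (1 - \<epsilon>)) (real n)" by simp
    then show ?thesis unfolding b_eq by simp
  qed
  have "?m powr (1 - \<epsilon>) \<le> ?m powr (1 + \<epsilon>)" using eps m1 by (intro powr_mono) auto
  moreover have "real n \<le> real n ^ 2" using n_pos by (simp add: power2_eq_square)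
  ultimately have "b \<le> min (?m powr (1 + \<epsilon>)) (real n ^ 2)" unfolding b_eq by (rule min.mono)
  then have "b \<le> space_bound \<epsilon> n (card E)" unfolding space_bound_def by (simp add: min.commute)
  moreover have "real (400 * (f 10 0 0 + 1)) \<le> 19600 * b" using h by simp
  ultimately show ?thesis using query_exec[OF P eps R(4) c] unfolding b_def by blast
qed

lemma vertex_query_exec:
  assumes P: "phase \<epsilon> True n E f m0 cnt" and eps: "0 < \<epsilon>" "\<epsilon> < 1" and v: "v < n"
    and R: "R 0 = n" "R 1 = v" "\<And>r. 12 \<le> r \<Longrightarrow> R r = 0"
  shows "\<exists>t p R'. exec W \<epsilon> G vertex_query (R, memory n f) t p (R', memory n f) \<and>
     R' 0 = subgraph_count ({..<n}, E) three_cycle (Vertex v) \<and>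
     real t \<le> 10000000 * query_bound \<epsilon> True (max 1 (card E)) n \<and> real p \<le> 10000000 * space_bound \<epsilon> n (card E)"
proof -
  note PD = phaseD[OF P]
  have E: "edge_set n E" and S: "slots_inv n (cap_of \<epsilon> m0) f" using PD(1) unfolding ds_inv_def by auto
  let ?m = "real (max 1 (card E))" and ?M = "real (max 1 m0)"
  have cnt: "cnt \<le> m0 div 2" using PD(2) by simp
  have "m0 \<le> card E + cnt + 1" using PD(4) by simp
  moreover have "card E \<le> f 11 0 0 + 1" using card_le_log[OF PD(1)] by simp
  ultimately have sz: "max 1 m0 \<le> 4 * max 1 (card E)"
    using phase_sizes[OF _ cnt PD(3) _ PD(5) n_pos] by blast
  have cap: "cap_of \<epsilon> m0 \<le> PB"
    using cap_of_le[OF eps, of m0] PD(5) PB_bounds by linarith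
  have sm: "small f"
    by (rule ds_inv_small[OF PD(1) _ cap]) (use PD(2,3,5) cnt in \<open>auto simp: PB_def\<close>)
  define b where "b = query_bound \<epsilon> True (max 1 (card E)) n"
  have b_eq: "b = min (?m powr (2 * \<epsilon>)) (real n ^ 2)" unfolding b_def query_bound_def by simp
  have c: "ok vertex_query R f (400 * (f 4 v 0 + 1)\<^sup>2)
    (\<lambda>R' f'. f' = f \<and> R' 0 = subgraph_count ({..<n}, E) three_cycle (Vertex v))"
    unfolding subgraph_count_vertex[OF E] by (rule ok_vertex_query[OF PD(1) sm R(1,2) v])
  have m1: "1 \<le> ?m" by simp
  let ?l = "real (f 4 v 0 + 1)"
  \<comment> \<open>The factor 25 is \<open>(4 + 1) ^ 2\<close>: 4 comes from passing to the current
    number of edges, and 1 from the increment in \<open>?l\<close>.\<close>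
  have h: "?l ^ 2 \<le> 25 * b"
  proof -
    have "f 4 v 0 \<le> cap_of \<epsilon> m0" by (rule slots_invD(4)[OF S])
    moreover have "real (cap_of \<epsilon> m0) \<le> ?M powr \<epsilon>" by (rule cap_of_bounds(1)[OF eps])
    moreover have "?M powr \<epsilon> \<le> 4 * ?m powr \<epsilon>" by (rule powr_scale) (use sz eps in auto)
    moreover have "1 \<le> ?m powr \<epsilon>" using eps by (intro ge_one_powr_ge_zero) auto
    ultimately have "?l \<le> 5 * ?m powr \<epsilon>" by linarith
    then have "?l ^ 2 \<le> (5 * ?m powr \<epsilon>) ^ 2" by (intro power_mono) auto
    also have "\<dots> = 25 * (?m powr \<epsilon> * ?m powr \<epsilon>)" by (simp add: power2_eq_square)
    also have "?m powr \<epsilon> * ?m powr \<epsilon> = ?m powr (2 * \<epsilon>)" by (simp flip: powr_add)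
    finally have 1: "?l ^ 2 \<le> 25 * ?m powr (2 * \<epsilon>)" .
    have "f 4 v 0 \<le> n" by (rule slots_inv_card(3)[OF S])
    then have "?l \<le> 2 * real n" using n_pos by linarith
    then have "?l ^ 2 \<le> (2 * real n) ^ 2" by (intro power_mono) auto
    also have "\<dots> = 4 * real n ^ 2" by (simp add: power_mult_distrib)
    also have "\<dots> \<le> 25 * real n ^ 2" by simp
    finally have 2: "?l ^ 2 \<le> 25 * real n ^ 2" .
    have "?l ^ 2 / 25 \<le> b" unfolding b_eq using 1 2 by (intro min.boundedI) linarith+
    then show ?thesis by linarith
  qed
  \<comment> \<open>Since \<open>\<epsilon> < 1\<close>, the query time fits into the space
    bound.\<close>
  have "?m powr (2 * \<epsilon>) \<le> ?m powr (1 + \<epsilon>)" using eps m1 by (intro powr_mono) auto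
  then have "b \<le> min (?m powr (1 + \<epsilon>)) (real n ^ 2)" unfolding b_eq by (rule min.mono) simp
  then have "b \<le> space_bound \<epsilon> n (card E)" unfolding space_bound_def by (simp add: min.commute)
  moreover have "real (400 * (f 4 v 0 + 1)\<^sup>2) \<le> 19600 * b"
  proof -
    have "real (400 * (f 4 v 0 + 1)\<^sup>2) = 400 * ?l ^ 2" by simp
    moreover have "0 \<le> b" unfolding b_eq by simp
    ultimately show ?thesis using h by linarith
  qed
  ultimately show ?thesis using query_exec[OF P eps R(3) c] unfolding b_def by blast
qed

end

section \<open>Sequences of operations\<close>

definition allowed_queries :: "bool \<Rightarrow> oper set" where
  "allowed_queries vq = (if vq then vertex_queries else edge_queries)"

text \<open>Each case interprets the locale with the graph that the program sees, which for an
  update is the graph after it. Updates are measured with the potential; queries leave the phase as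
  it is.\<close>

lemma oper_step:
  assumes P: "phase \<epsilon> vq n E f m0 cnt" and eps: "0 < \<epsilon>" "\<epsilon> < 1" and n: "0 < n" and W: "W = (n + 2) ^ 10"
    and x: "valid_oper ({..<n}, E) x" "is_update x \<or> x \<in> allowed_queries vq"
  shows "\<exists>E' t p R' f' m1 cnt1. apply_oper x ({..<n}, E) = ({..<n}, E') \<and>
     exec W \<epsilon> ({..<n}, E') (prog_of (counting_structure vq) x) (input_regs n x, memory n f) t p (R', memory n f') \<and>
     phase \<epsilon> vq n E' f' m1 cnt1 \<and> real p \<le> 10000000 * space_bound \<epsilon> n (card E') \<and>
     (if is_update x
      then real t + potential \<epsilon> vq m1 cnt1 \<le> potential \<epsilon> vq m0 cnt + 10000000 * real (max 1 (card E')) powr update_exp \<epsilon> vq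
      else R' 0 = expected_answer ({..<n}, E') three_cycle x \<and> m1 = m0 \<and> cnt1 = cnt \<and>
        real t \<le> 10000000 * query_bound \<epsilon> vq (max 1 (card E')) n)"
proof -
  note PD = phaseD[OF P]
  have E: "edge_set n E" using PD(1) unfolding ds_inv_def by auto
  have finE: "finite E" by (rule finite_edge_set[OF E])
  have cnt: "cnt \<le> m0 div 2" using PD(2) by simp
  show ?thesis
  proof (cases x)
    case (Insert u v)
    let ?E = "insert {u, v} E"
    interpret ram n W \<epsilon> "({..<n}, ?E)" by unfold_locales (use n W in auto)
    have uv: "u < n" "v < n" "u \<noteq> v" "{u, v} \<notin> E" using x(1) Insert by auto
    have cap: "cap_of \<epsilon> m0 \<le> PB" using cap_of_le[OF eps, of m0] PD(5) PB_bounds by linarith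
    have b: "f 11 0 0 < PB" "f 13 0 0 \<le> PB" using PD(2,3,5) cnt by (auto simp: PB_def)
    let ?R = "input_regs n x"
    have R: "?R 0 = n" "?R 1 = u" "?R 2 = v" "\<And>r. 12 \<le> r \<Longrightarrow> ?R r = 0" using Insert by auto
    have c: "ok (add_edge vq) ?R f (9000 * (cap_of \<epsilon> m0 + (if vq then f 10 0 0 else 0) + 1))
       (\<lambda>R' f'. ds_inv vq n (cap_of \<epsilon> m0) ?E f' \<and> f' 11 0 0 \<le> f 11 0 0 + 1 \<and> (\<forall>j. j \<in> {13, 14, 15} \<longrightarrow> f' j = f j))"
      by (rule ok_mono[OF ok_add_edge[OF PD(1) b(1) cap b(2) R(1-3) uv]]) auto
    have card: "card E \<le> card ?E + 1" "card ?E \<le> card E + 1" using uv finE by auto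
    show ?thesis
      using update_exec[OF P eps R(1,4) c written_small(2) card] Insert
      by (intro exI[of _ ?E]) (simp add: counting_structure_def)
  next
    case (Delete u v)
    let ?E = "E - {{u, v}}"
    interpret ram n W \<epsilon> "({..<n}, ?E)" by unfold_locales (use n W in auto)
    have uv: "{u, v} \<in> E" using x(1) Delete by auto
    have cap: "cap_of \<epsilon> m0 \<le> PB" using cap_of_le[OF eps, of m0] PD(5) PB_bounds by linarith
    have b: "f 11 0 0 \<le> PB" "f 13 0 0 \<le> PB" using PD(2,3,5) cnt by (auto simp: PB_def)
    have sm: "small f" by (rule ds_inv_small[OF PD(1) b(1) cap b(2)])
    let ?R = "input_regs n x"
    have R: "?R 0 = n" "?R 1 = u" "?R 2 = v" "\<And>r. 12 \<le> r \<Longrightarrow> ?R r = 0" using Delete by auto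
    have c: "ok (del_edge vq) ?R f (9000 * (cap_of \<epsilon> m0 + (if vq then f 10 0 0 else 0) + 1))
       (\<lambda>R' f'. ds_inv vq n (cap_of \<epsilon> m0) ?E f' \<and> f' 11 0 0 \<le> f 11 0 0 + 1 \<and> (\<forall>j. j \<in> {13, 14, 15} \<longrightarrow> f' j = f j))"
      by (rule ok_mono[OF ok_del_edge[OF PD(1) sm R(1-3) uv]]) auto
    have card: "card E \<le> card ?E + 1" "card ?E \<le> card E + 1" using uv finE by (auto simp: card_Diff_singleton)
    show ?thesis
      using update_exec[OF P eps R(1,4) c written_small(3) card] Delete
      by (intro exI[of _ ?E]) (simp add: counting_structure_def)
  next
    case (Query_vertex v)
    interpret ram n W \<epsilon> "({..<n}, E)" by unfold_locales (use n W in auto)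
    have vq: "vq" using x(2) Query_vertex unfolding allowed_queries_def edge_queries_def by (auto split: if_splits)
    have v: "v < n" using x(1) Query_vertex by auto
    let ?R = "input_regs n x"
    have R: "?R 0 = n" "?R 1 = v" "\<And>r. 12 \<le> r \<Longrightarrow> ?R r = 0" using Query_vertex by auto
    have P': "phase \<epsilon> True n E f m0 cnt" using P vq by simp
    obtain t p R' where *: "exec W \<epsilon> ({..<n}, E) vertex_query (?R, memory n f) t p (R', memory n f)"
      "R' 0 = subgraph_count ({..<n}, E) three_cycle (Vertex v)"
      "real t \<le> 10000000 * query_bound \<epsilon> True (max 1 (card E)) n" "real p \<le> 10000000 * space_bound \<epsilon> n (card E)"
      using vertex_query_exec[OF P' eps v R] by blast
    show ?thesis
      by (rule exI[of _ E], rule exI[of _ t], rule exI[of _ p], rule exI[of _ R'], rule exI[of _ f], rule exI[of _ m0], rule exI[of _ cnt])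
        (use * P vq Query_vertex in \<open>simp add: counting_structure_def\<close>)
  next
    case (Query_edge u v)
    interpret ram n W \<epsilon> "({..<n}, E)" by unfold_locales (use n W in auto)
    have vq: "\<not> vq" using x(2) Query_edge unfolding allowed_queries_def vertex_queries_def by (auto split: if_splits)
    have e: "{u, v} \<in> E" using x(1) Query_edge by auto
    let ?R = "input_regs n x"
    have R: "?R 0 = n" "?R 1 = u" "?R 2 = v" "\<And>r. 12 \<le> r \<Longrightarrow> ?R r = 0" using Query_edge by auto
    have P': "phase \<epsilon> False n E f m0 cnt" using P vq by simp
    obtain t p R' where *: "exec W \<epsilon> ({..<n}, E) edge_query (?R, memory n f) t p (R', memory n f)"
      "R' 0 = subgraph_count ({..<n}, E) three_cycle (Edge {u, v})"
      "real t \<le> 10000000 * query_bound \<epsilon> False (max 1 (card E)) n" "real p \<le> 10000000 * space_bound \<epsilon> n (card E)"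
      using edge_query_exec[OF P' eps e R] by blast
    show ?thesis
      by (rule exI[of _ E], rule exI[of _ t], rule exI[of _ p], rule exI[of _ R'], rule exI[of _ f], rule exI[of _ m0], rule exI[of _ cnt])
        (use * P vq Query_edge in \<open>simp add: counting_structure_def\<close>)
  qed
qed

lemma valid_opers_snoc:
  "valid_opers G (xs @ [x]) \<longleftrightarrow> valid_opers G xs \<and> valid_oper (fold apply_oper xs G) x"
  by (induction xs arbitrary: G) auto

text \<open>The first phase has \<open>m0 = 0\<close> and ends with the first update.\<close>

lemma phase_init:
  assumes "0 < n"
  shows "phase \<epsilon> vq n {} (\<lambda>_ _ _. 0) 0 0"
proof -
  have "ds_inv vq n 1 {} (\<lambda>_ _ _. 0)" by (rule ds_inv_fresh) (use assms in auto)
  then show ?thesis unfolding phase_def cap_of_def by simp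
qed

text \<open>The potential is 0 at the start, and its differences telescope over the updates; queries
  do not change it.\<close>

lemma run_bounds:
  assumes eps: "0 < \<epsilon>" "\<epsilon> < 1" and n: "0 < n" and W: "W = (n + 2) ^ 10"
    and "valid_opers (empty_graph n) xs" "\<forall>x\<in>set xs. is_update x \<or> x \<in> allowed_queries vq"
  shows "\<exists>E f m0 cnt es. run W \<epsilon> (counting_structure vq) n xs ({..<n}, E) (memory n f) es \<and>
    fold apply_oper xs (empty_graph n) = ({..<n}, E) \<and> phase \<epsilon> vq n E f m0 cnt \<and>
    (\<forall>e\<in>set es. \<not> is_update (ev_oper e) \<longrightarrow>
       ev_answer e = expected_answer (ev_graph e) three_cycle (ev_oper e) \<and>
       real (ev_time e) \<le> 10000000 * ev_bound (query_bound \<epsilon> vq) e) \<and>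
    (\<Sum>e\<leftarrow>filter (is_update \<circ> ev_oper) es. real (ev_time e)) + potential \<epsilon> vq m0 cnt \<le>
      10000000 * (\<Sum>e\<leftarrow>filter (is_update \<circ> ev_oper) es. ev_bound (\<lambda>m n. real m powr update_exp \<epsilon> vq) e) \<and>
    (\<forall>e\<in>set es. real (ev_space e) \<le> 10000000 * ev_bound (\<lambda>m n. min (real n ^ 2) (real m powr (1 + \<epsilon>))) e)"
  using assms(5,6)
proof (induction xs rule: rev_induct)
  case Nil
  have m: "memory n (\<lambda>_ _ _. 0) = (\<lambda>_. 0)" unfolding memory_def by simp
  have "run W \<epsilon> (counting_structure vq) n [] ({..<n}, {}) (memory n (\<lambda>_ _ _. 0)) []"
    unfolding m empty_graph_def[symmetric] by (rule run_Nil)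
  then show ?case using phase_init[OF n, of \<epsilon> vq]
    by (intro exI[of _ "{}"] exI[of _ "\<lambda>_ _ _. 0"] exI[of _ 0] exI[of _ "[]"]) (simp add: empty_graph_def potential_def)
next
  case (snoc x xs)
  from snoc.prems have v: "valid_opers (empty_graph n) xs" "valid_oper (fold apply_oper xs (empty_graph n)) x"
    and a: "\<forall>x\<in>set xs. is_update x \<or> x \<in> allowed_queries vq" "is_update x \<or> x \<in> allowed_queries vq"
    unfolding valid_opers_snoc by auto
  from snoc.IH[OF v(1) a(1)] obtain E f m0 cnt es where
    r: "run W \<epsilon> (counting_structure vq) n xs ({..<n}, E) (memory n f) es"
    and G: "fold apply_oper xs (empty_graph n) = ({..<n}, E)" and P: "phase \<epsilon> vq n E f m0 cnt"
    and Q: "\<forall>e\<in>set es. \<not> is_update (ev_oper e) \<longrightarrow>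
       ev_answer e = expected_answer (ev_graph e) three_cycle (ev_oper e) \<and>
       real (ev_time e) \<le> 10000000 * ev_bound (query_bound \<epsilon> vq) e"
    and T: "(\<Sum>e\<leftarrow>filter (is_update \<circ> ev_oper) es. real (ev_time e)) + potential \<epsilon> vq m0 cnt \<le>
      10000000 * (\<Sum>e\<leftarrow>filter (is_update \<circ> ev_oper) es. ev_bound (\<lambda>m n. real m powr update_exp \<epsilon> vq) e)"
    and S: "\<forall>e\<in>set es. real (ev_space e) \<le> 10000000 * ev_bound (\<lambda>m n. min (real n ^ 2) (real m powr (1 + \<epsilon>))) e"
    by blast
  from oper_step[OF P eps n W _ a(2)] v(2) G obtain E' t p R' f' m1 cnt1 where
    G': "apply_oper x ({..<n}, E) = ({..<n}, E')"
    and ex: "exec W \<epsilon> ({..<n}, E') (prog_of (counting_structure vq) x) (input_regs n x, memory n f) t p (R', memory n f')"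
    and P': "phase \<epsilon> vq n E' f' m1 cnt1" and sp: "real p \<le> 10000000 * space_bound \<epsilon> n (card E')"
    and st: "if is_update x
      then real t + potential \<epsilon> vq m1 cnt1 \<le> potential \<epsilon> vq m0 cnt + 10000000 * real (max 1 (card E')) powr update_exp \<epsilon> vq
      else R' 0 = expected_answer ({..<n}, E') three_cycle x \<and> m1 = m0 \<and> cnt1 = cnt \<and>
        real t \<le> 10000000 * query_bound \<epsilon> vq (max 1 (card E')) n" by auto
  let ?e = "\<lparr>ev_oper = x, ev_graph = ({..<n}, E'), ev_answer = R' 0, ev_time = t, ev_space = p\<rparr>"
  have r': "run W \<epsilon> (counting_structure vq) n (xs @ [x]) ({..<n}, E') (memory n f') (es @ [?e])"
    by (rule run_snoc[OF r G'[symmetric] ex])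
  have b: "ev_bound h ?e = h (max 1 (card E')) n" for h unfolding ev_bound_def by simp
  show ?case
  proof (intro exI conjI)
    show "run W \<epsilon> (counting_structure vq) n (xs @ [x]) ({..<n}, E') (memory n f') (es @ [?e])" by (rule r')
    show "fold apply_oper (xs @ [x]) (empty_graph n) = ({..<n}, E')" using G G' by simp
    show "phase \<epsilon> vq n E' f' m1 cnt1" by (rule P')
    show "\<forall>e\<in>set (es @ [?e]). \<not> is_update (ev_oper e) \<longrightarrow>
       ev_answer e = expected_answer (ev_graph e) three_cycle (ev_oper e) \<and>
       real (ev_time e) \<le> 10000000 * ev_bound (query_bound \<epsilon> vq) e"
      using Q st b by auto
    show "\<forall>e\<in>set (es @ [?e]). real (ev_space e) \<le> 10000000 * ev_bound (\<lambda>m n. min (real n ^ 2) (real m powr (1 + \<epsilon>))) e"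
      using S sp b unfolding space_bound_def by auto
    show "(\<Sum>e\<leftarrow>filter (is_update \<circ> ev_oper) (es @ [?e]). real (ev_time e)) + potential \<epsilon> vq m1 cnt1 \<le>
      10000000 * (\<Sum>e\<leftarrow>filter (is_update \<circ> ev_oper) (es @ [?e]). ev_bound (\<lambda>m n. real m powr update_exp \<epsilon> vq) e)"
      using T st b[of "\<lambda>m n. real m powr update_exp \<epsilon> vq"] by (cases "is_update x") (simp_all add: distrib_left)
  qed
qed

lemma potential_nonneg: "0 \<le> potential \<epsilon> vq m0 cnt"
  unfolding potential_def by simp

lemma counting_structure_correct:
  assumes eps: "0 < \<epsilon>" "\<epsilon> < 1"
  shows "dynamic_subgraph_counting \<epsilon> three_cycle (allowed_queries vq) (query_bound \<epsilon> vq)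
    (\<lambda>m n. real m powr update_exp \<epsilon> vq) (\<lambda>m n. min (real n ^ 2) (real m powr (1 + \<epsilon>)))"
  unfolding dynamic_subgraph_counting_def
\<comment> \<open>The witness 10 is the exponent in \<open>W_eq\<close>.\<close>
proof (rule exI[of _ "counting_structure vq"], rule exI[of _ 10], rule exI[of _ 10000000], intro allI impI, elim conjE)
  fix n xs assume v: "valid_opers (empty_graph n) xs" and a: "\<forall>x\<in>set xs. is_update x \<or> x \<in> allowed_queries vq"
  show "\<exists>G M es. run ((n + 2) ^ 10) \<epsilon> (counting_structure vq) n xs G M es \<and>
           (\<forall>e\<in>set es. \<not> is_update (ev_oper e) \<longrightarrow>
              ev_answer e = expected_answer (ev_graph e) three_cycle (ev_oper e) \<and>
              real (ev_time e) \<le> 10000000 * ev_bound (query_bound \<epsilon> vq) e) \<and>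
           (\<Sum>e\<leftarrow>filter (is_update \<circ> ev_oper) es. real (ev_time e)) \<le>
             10000000 * (\<Sum>e\<leftarrow>filter (is_update \<circ> ev_oper) es. ev_bound (\<lambda>m n. real m powr update_exp \<epsilon> vq) e) \<and>
           (\<forall>e\<in>set es. real (ev_space e) \<le> 10000000 * ev_bound (\<lambda>m n. min (real n ^ 2) (real m powr (1 + \<epsilon>))) e)"
  proof (cases "n = 0")
    \<comment> \<open>The locale assumes \<open>0 < n\<close>. Without vertices no operation is
      valid, so only the empty run remains.\<close>
    case True
    have "xs = []"
    proof (cases xs)
      case (Cons x ys)
      then have "valid_oper (empty_graph 0) x" using v True by simp
      then show ?thesis by (cases x) (auto simp: empty_graph_def)
    qed
    then show ?thesis using run_Nil[of "(n + 2) ^ 10" \<epsilon> "counting_structure vq" n]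
      by (intro exI[of _ "empty_graph n"] exI[of _ "\<lambda>_. 0"] exI[of _ "[]"]) simp
  next
    case False
    then have n: "0 < n" by simp
    from run_bounds[OF eps n refl v a] obtain E f m0 cnt es where
      "run ((n + 2) ^ 10) \<epsilon> (counting_structure vq) n xs ({..<n}, E) (memory n f) es"
      "\<forall>e\<in>set es. \<not> is_update (ev_oper e) \<longrightarrow>
         ev_answer e = expected_answer (ev_graph e) three_cycle (ev_oper e) \<and>
         real (ev_time e) \<le> 10000000 * ev_bound (query_bound \<epsilon> vq) e"
      "(\<Sum>e\<leftarrow>filter (is_update \<circ> ev_oper) es. real (ev_time e)) + potential \<epsilon> vq m0 cnt \<le>
        10000000 * (\<Sum>e\<leftarrow>filter (is_update \<circ> ev_oper) es. ev_bound (\<lambda>m n. real m powr update_exp \<epsilon> vq) e)"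
      "\<forall>e\<in>set es. real (ev_space e) \<le> 10000000 * ev_bound (\<lambda>m n. min (real n ^ 2) (real m powr (1 + \<epsilon>))) e"
      by blast
    moreover note potential_nonneg[of \<epsilon> vq m0 cnt]
    ultimately show ?thesis
      by (intro exI[of _ "({..<n}, E)"] exI[of _ "memory n f"] exI[of _ es]) auto
  qed
qed

theorem theorem3p16:
  fixes \<epsilon> :: real
  assumes "0 < \<epsilon>" and "\<epsilon> < 1"
  shows "dynamic_subgraph_counting \<epsilon> three_cycle vertex_queries
           (\<lambda>m n. min (real m powr (2 * \<epsilon>)) (real n ^ 2))
           (\<lambda>m n. real m powr max \<epsilon> (1 - \<epsilon>))
           (\<lambda>m n. min (real n ^ 2) (real m powr (1 + \<epsilon>))) \<and>
         dynamic_subgraph_counting \<epsilon> three_cycle edge_queries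
           (\<lambda>m n. min (real m powr (1 - \<epsilon>)) (real n))
           (\<lambda>m n. real m powr \<epsilon>)
           (\<lambda>m n. min (real n ^ 2) (real m powr (1 + \<epsilon>)))"
  using counting_structure_correct[OF assms, of True] counting_structure_correct[OF assms, of False]
  by (simp add: allowed_queries_def update_exp_def query_bound_def[abs_def])

end
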